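(* Assume that $n\geq 4$. Let $V$ be a complex vector space with basis $v_1,\ldots,v_n$, on which the symmetric group $S_n$ acts by permuting the basis: ${}^{\sigma}v_i=v_{\sigma(i)}$. Let $q_{ii}=1$ and $q_{ij}=-1$ for $i\neq j$. The maps $\kappa:V\times V\to\mathbb{C}S_n$ for which $\mathcal{H}_{\mathbf{q},\kappa}$ is a quantum Drinfeld Hecke algebra form a five-dimensional vector space with basis consisting of the maps $V\times V\to\mathbb{C}S_n$ determined by their effect on pairs $(v_i,v_j)$, $i\neq j$, given respectively by \begin{align*} &(v_i,v_j)\mapsto 1,\\ &(v_i,v_j)\mapsto (ij),\\ &(v_i,v_j)\mapsto \sum_{k\neq i,j}\big((ik)+(jk)\big),\\ &(v_i,v_j)\mapsto \sum_{\substack{k,l\notin\{i,j\}\\ k\neq l}}(ik)(jl),\\ &(v_i,v_j)\mapsto \sum_{k\neq i,j}\big((ijk)+(ikj)\big). \end{align*}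
   Context: $S_{\mathbf{q}}(V)=\mathbb{C}\langle v_1,\ldots,v_n\mid v_iv_j=q_{ij}v_jv_i\ \forall i,j\rangle$, i.e. here $v_iv_j=-v_jv_i$ for $i\ne j$; the action of $G=S_n$ on $V$ extends to it by algebra automorphisms. $T(V)$ is the tensor algebra. For an algebra $A$ with an action of $G$ by automorphisms $a\mapsto{}^g a$, the skew group algebra $A\rtimes G$ is the free left $A$-module with basis $G$ and multiplication $(ag)(bh)=a({}^g b)\,gh$. The maps $\kappa:V\times V\to\mathbb{C}G$ under consideration are bilinear and satisfy $\kappa(v_i,v_j)=-q_{ij}\kappa(v_j,v_i)$ for all $i,j$ (so here $\kappa(v_i,v_i)=0$ and $\kappa(v_i,v_j)=\kappa(v_j,v_i)$ for $i\neq j$). For such $\kappa$, $$\mathcal{H}_{\mathbf{q},\kappa}=T(V)\rtimes G\,/\,(v_iv_j-q_{ij}v_jv_i-\kappa(v_i,v_j)\mid 1\le i,j\le n),$$ filtered with each $v_i$ in degree $1$ and each $g\in G$ in degree $0$; it is called a quantum Drinfeld Hecke algebra if its associated graded algebra is isomorphic (as a graded algebra) to $S_{\mathbf{q}}(V)\rtimes G$. Cycle notation is used for permutations and all summation indices range over $\{1,\ldots,n\}$. *)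

theory Defs
  imports
    "HOL-Library.Poly_Mapping"
    "HOL-Library.Function_Algebras"
    "HOL-Combinatorics.Perm"
    "HOL-Combinatorics.Cycles"
    "HOL-Algebra.QuotRing"
    "HOL-Algebra.Module"
    Complex_Main
begin

section \<open>Algebras over the complex numbers as records\<close>

text \<open>
  The record type \<^typ>\<open>('c, 'a) Module.module\<close> (a ring with a scalar multiplication) serves as the
  signature of an associative unital algebra; the locale \<^locale>\<open>algebra\<close> is not used because it asks
  for commutativity. The cosets of an ideal are scaled as the library multiplies them in
  \<^const>\<open>rcoset_mult\<close>.
\<close>

definition quot_alg :: "('c, 'a, 'm) module_scheme \<Rightarrow> 'a set \<Rightarrow> ('c, 'a set) module"
  where "quot_alg A I =
    \<lparr>carrier = carrier (A Quot I), mult = mult (A Quot I), one = one (A Quot I),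
     zero = zero (A Quot I), add = add (A Quot I),
     smult = (\<lambda>c X. \<Union>x\<in>X. I +>\<^bsub>A\<^esub> (c \<odot>\<^bsub>A\<^esub> x))\<rparr>"

text \<open>
  Skew group algebra of \<open>A\<close> with a finite group, the type \<open>'g\<close>: the function \<open>f\<close> stands for the sum of
  all \<open>f g \<cdot> g\<close>, and the coefficient of a product at \<open>x\<close> collects all \<open>(a g) (b h) = a (\<^sup>g b) g h\<close> with
  \<open>g h = x\<close>. For infinite \<open>'g\<close> finite supports would be needed.
\<close>

definition skew_group_alg ::
    "('c, 'a, 'm) module_scheme \<Rightarrow> ('g::monoid_mult \<Rightarrow> 'a \<Rightarrow> 'a) \<Rightarrow> ('c, 'g \<Rightarrow> 'a) module"
  where "skew_group_alg A act =
    \<lparr>carrier = {f. \<forall>g. f g \<in> carrier A},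
     mult = (\<lambda>f f' x. finsum A (\<lambda>(g, h). f g \<otimes>\<^bsub>A\<^esub> act g (f' h)) {(g, h). g * h = x}),
     one = (\<lambda>x. if x = 1 then \<one>\<^bsub>A\<^esub> else \<zero>\<^bsub>A\<^esub>),
     zero = (\<lambda>x. \<zero>\<^bsub>A\<^esub>),
     add = (\<lambda>f f' x. f x \<oplus>\<^bsub>A\<^esub> f' x),
     smult = (\<lambda>c f x. c \<odot>\<^bsub>A\<^esub> f x)\<rparr>"

text \<open>
  Associated graded algebra of an increasing filtration \<open>F 0 \<subseteq> F 1 \<subseteq> \<dots>\<close> with \<open>F (-1) = 0\<close>. An element is
  a finitely supported family of cosets \<open>x m \<in> F m / F (m - 1)\<close>.
\<close>

definition filt_prev :: "('a, 'm) ring_scheme \<Rightarrow> (nat \<Rightarrow> 'a set) \<Rightarrow> nat \<Rightarrow> 'a set"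
  where "filt_prev A F m = (case m of 0 \<Rightarrow> {\<zero>\<^bsub>A\<^esub>} | Suc k \<Rightarrow> F k)"

definition assoc_graded ::
    "('c, 'a, 'm) module_scheme \<Rightarrow> (nat \<Rightarrow> 'a set) \<Rightarrow> ('c, nat \<Rightarrow> 'a set) module"
  where "assoc_graded A F =
    \<lparr>carrier = {x. (\<forall>m. x m \<in> (\<lambda>a. filt_prev A F m +>\<^bsub>A\<^esub> a) ` F m)
                   \<and> finite {m. x m \<noteq> filt_prev A F m}},
     mult = (\<lambda>x y m. \<Union>a\<in>Pi UNIV x. \<Union>b\<in>Pi UNIV y.
               filt_prev A F m +>\<^bsub>A\<^esub> (\<Oplus>\<^bsub>A\<^esub>i\<in>{..m}. a i \<otimes>\<^bsub>A\<^esub> b (m - i))),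
     one = (\<lambda>m. filt_prev A F m +>\<^bsub>A\<^esub> (if m = 0 then \<one>\<^bsub>A\<^esub> else \<zero>\<^bsub>A\<^esub>)),
     zero = filt_prev A F,
     add = (\<lambda>x y m. x m <+>\<^bsub>A\<^esub> y m),
     smult = (\<lambda>c x m. \<Union>a\<in>x m. filt_prev A F m +>\<^bsub>A\<^esub> (c \<odot>\<^bsub>A\<^esub> a))\<rparr>"

definition assoc_graded_comp ::
    "('c, 'a, 'm) module_scheme \<Rightarrow> (nat \<Rightarrow> 'a set) \<Rightarrow> nat \<Rightarrow> (nat \<Rightarrow> 'a set) set"
  where "assoc_graded_comp A F m =
    {x \<in> carrier (assoc_graded A F). \<forall>k. k \<noteq> m \<longrightarrow> x k = filt_prev A F k}"

definition graded_alg_isomorphic ::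
    "('c, 'a, 'm) module_scheme \<Rightarrow> (nat \<Rightarrow> 'a set) \<Rightarrow>
     ('c, 'b, 'k) module_scheme \<Rightarrow> (nat \<Rightarrow> 'b set) \<Rightarrow> bool"
  where "graded_alg_isomorphic A A_comp B B_comp \<longleftrightarrow>
    (\<exists>\<phi>\<in>ring_iso A B.
       (\<forall>c. \<forall>x\<in>carrier A. \<phi> (c \<odot>\<^bsub>A\<^esub> x) = c \<odot>\<^bsub>B\<^esub> \<phi> x) \<and>
       (\<forall>m. \<phi> ` A_comp m = B_comp m))"


section \<open>Tensor algebra and group algebra\<close>

definition pm_scale :: "complex \<Rightarrow> ('k \<Rightarrow>\<^sub>0 complex) \<Rightarrow> ('k \<Rightarrow>\<^sub>0 complex)"
  where "pm_scale c = Poly_Mapping.map ((*) c)"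

text \<open>
  Lists form the free monoid, written additively so that the convolution product of
  \<^theory>\<open>HOL-Library.Poly_Mapping\<close> makes \<^typ>\<open>'n list \<Rightarrow>\<^sub>0 complex\<close> the free algebra on \<^typ>\<open>'n\<close>. It
  realises the tensor algebra of a space \<open>V\<close> with basis \<open>v\<close>, indexed by \<^typ>\<open>'n\<close>: the word
  \<open>[i\<^sub>1, \<dots>, i\<^sub>k]\<close> is \<open>v i\<^sub>1 \<otimes> \<dots> \<otimes> v i\<^sub>k\<close>.
\<close>

instantiation list :: (type) monoid_add
begin

definition zero_list :: "'a list"
  where "zero_list = []"

definition plus_list :: "'a list \<Rightarrow> 'a list \<Rightarrow> 'a list"
  where "plus_list = (@)"

instance
  by standard (simp_all add: zero_list_def plus_list_def)

end

definition tensor_alg :: "(complex, 'n list \<Rightarrow>\<^sub>0 complex) module"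
  where "tensor_alg =
    \<lparr>carrier = UNIV, mult = (*), one = 1, zero = 0, add = (+), smult = pm_scale\<rparr>"

definition tgen :: "'n \<Rightarrow> 'n list \<Rightarrow>\<^sub>0 complex"
  where "tgen i = Poly_Mapping.single [i] 1"

definition coord ::
    "(complex \<Rightarrow> 'v::ab_group_add \<Rightarrow> 'v) \<Rightarrow> ('n \<Rightarrow> 'v) \<Rightarrow> 'v \<Rightarrow> 'n \<Rightarrow> complex"
  where "coord sV v x i = Modules.module.representation sV (range v) x (v i)"

definition tensor_incl ::
    "(complex \<Rightarrow> 'v::ab_group_add \<Rightarrow> 'v) \<Rightarrow> ('n::finite \<Rightarrow> 'v) \<Rightarrow> 'v \<Rightarrow> ('n list \<Rightarrow>\<^sub>0 complex)"
  where "tensor_incl sV v x = (\<Sum>i\<in>UNIV. pm_scale (coord sV v x i) (tgen i))"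

text \<open>The extension to the tensor algebra, by algebra endomorphisms, of linear maps \<open>act g\<close> of \<open>V\<close>.\<close>

definition tensor_act ::
    "(complex \<Rightarrow> 'v::ab_group_add \<Rightarrow> 'v) \<Rightarrow> ('n::finite \<Rightarrow> 'v) \<Rightarrow> ('g \<Rightarrow> 'v \<Rightarrow> 'v) \<Rightarrow>
     'g \<Rightarrow> ('n list \<Rightarrow>\<^sub>0 complex) \<Rightarrow> ('n list \<Rightarrow>\<^sub>0 complex)"
  where "tensor_act sV v act g p =
    (\<Sum>w\<in>Poly_Mapping.keys p.
       pm_scale (Poly_Mapping.lookup p w)
         (prod_list (map (\<lambda>i. tensor_incl sV v (act g (v i))) w)))"

definition tensor_comp :: "nat \<Rightarrow> ('n list \<Rightarrow>\<^sub>0 complex) set"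
  where "tensor_comp m = {p. \<forall>w\<in>Poly_Mapping.keys p. length w = m}"

definition tensor_filt :: "nat \<Rightarrow> ('n list \<Rightarrow>\<^sub>0 complex) set"
  where "tensor_filt m = {p. \<forall>w\<in>Poly_Mapping.keys p. length w \<le> m}"

definition q_commutator :: "('n \<Rightarrow> 'n \<Rightarrow> complex) \<Rightarrow> 'n \<Rightarrow> 'n \<Rightarrow> 'n list \<Rightarrow>\<^sub>0 complex"
  where "q_commutator q i j = tgen i * tgen j - pm_scale (q i j) (tgen j * tgen i)"


section \<open>The algebra \<open>S\<^sub>q(V) \<rtimes> G\<close>\<close>

definition sq_ideal :: "('n \<Rightarrow> 'n \<Rightarrow> complex) \<Rightarrow> ('n list \<Rightarrow>\<^sub>0 complex) set"
  where "sq_ideal q = Idl\<^bsub>tensor_alg\<^esub> {q_commutator q i j | i j. True}"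

definition sq_alg :: "('n \<Rightarrow> 'n \<Rightarrow> complex) \<Rightarrow> (complex, ('n list \<Rightarrow>\<^sub>0 complex) set) module"
  where "sq_alg q = quot_alg tensor_alg (sq_ideal q)"

definition sq_skew ::
    "(complex \<Rightarrow> 'v::ab_group_add \<Rightarrow> 'v) \<Rightarrow> ('n::finite \<Rightarrow> 'v) \<Rightarrow> ('g::monoid_mult \<Rightarrow> 'v \<Rightarrow> 'v) \<Rightarrow>
     ('n \<Rightarrow> 'n \<Rightarrow> complex) \<Rightarrow> (complex, 'g \<Rightarrow> ('n list \<Rightarrow>\<^sub>0 complex) set) module"
  where "sq_skew sV v act q = skew_group_alg (sq_alg q) (\<lambda>g X. tensor_act sV v act g ` X)"

definition sq_skew_comp ::
    "('n \<Rightarrow> 'n \<Rightarrow> complex) \<Rightarrow> nat \<Rightarrow> ('g \<Rightarrow> ('n list \<Rightarrow>\<^sub>0 complex) set) set"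
  where "sq_skew_comp q m =
    {f. \<forall>g. f g \<in> (\<lambda>p. sq_ideal q +>\<^bsub>tensor_alg\<^esub> p) ` tensor_comp m}"


section \<open>Quantum Drinfeld Hecke algebras\<close>

definition tensor_skew ::
    "(complex \<Rightarrow> 'v::ab_group_add \<Rightarrow> 'v) \<Rightarrow> ('n::finite \<Rightarrow> 'v) \<Rightarrow> ('g::monoid_mult \<Rightarrow> 'v \<Rightarrow> 'v) \<Rightarrow>
     (complex, 'g \<Rightarrow> 'n list \<Rightarrow>\<^sub>0 complex) module"
  where "tensor_skew sV v act = skew_group_alg tensor_alg (tensor_act sV v act)"

definition tensor_in_skew :: "('n list \<Rightarrow>\<^sub>0 complex) \<Rightarrow> ('g::monoid_mult \<Rightarrow> 'n list \<Rightarrow>\<^sub>0 complex)"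
  where "tensor_in_skew p = (\<lambda>g. if g = 1 then p else 0)"

text \<open>The group algebra is \<^typ>\<open>'g \<Rightarrow>\<^sub>0 complex\<close>; only its linear structure and its inclusion
  into \<open>T(V) \<rtimes> G\<close> are needed.\<close>

definition group_alg_in_skew :: "('g \<Rightarrow>\<^sub>0 complex) \<Rightarrow> ('g \<Rightarrow> 'n list \<Rightarrow>\<^sub>0 complex)"
  where "group_alg_in_skew r = (\<lambda>g. Poly_Mapping.single [] (Poly_Mapping.lookup r g))"

definition hecke_ideal ::
    "(complex \<Rightarrow> 'v::ab_group_add \<Rightarrow> 'v) \<Rightarrow> ('n::finite \<Rightarrow> 'v) \<Rightarrow> ('g::monoid_mult \<Rightarrow> 'v \<Rightarrow> 'v) \<Rightarrow>
     ('n \<Rightarrow> 'n \<Rightarrow> complex) \<Rightarrow> ('v \<Rightarrow> 'v \<Rightarrow> 'g \<Rightarrow>\<^sub>0 complex) \<Rightarrow> ('g \<Rightarrow> 'n list \<Rightarrow>\<^sub>0 complex) set"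
  where "hecke_ideal sV v act q \<kappa> =
    Idl\<^bsub>tensor_skew sV v act\<^esub>
      {tensor_in_skew (q_commutator q i j) - group_alg_in_skew (\<kappa> (v i) (v j)) | i j. True}"

definition hecke_alg ::
    "(complex \<Rightarrow> 'v::ab_group_add \<Rightarrow> 'v) \<Rightarrow> ('n::finite \<Rightarrow> 'v) \<Rightarrow> ('g::monoid_mult \<Rightarrow> 'v \<Rightarrow> 'v) \<Rightarrow>
     ('n \<Rightarrow> 'n \<Rightarrow> complex) \<Rightarrow> ('v \<Rightarrow> 'v \<Rightarrow> 'g \<Rightarrow>\<^sub>0 complex) \<Rightarrow>
     (complex, ('g \<Rightarrow> 'n list \<Rightarrow>\<^sub>0 complex) set) module"
  where "hecke_alg sV v act q \<kappa> = quot_alg (tensor_skew sV v act) (hecke_ideal sV v act q \<kappa>)"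

definition hecke_filt ::
    "(complex \<Rightarrow> 'v::ab_group_add \<Rightarrow> 'v) \<Rightarrow> ('n::finite \<Rightarrow> 'v) \<Rightarrow> ('g::monoid_mult \<Rightarrow> 'v \<Rightarrow> 'v) \<Rightarrow>
     ('n \<Rightarrow> 'n \<Rightarrow> complex) \<Rightarrow> ('v \<Rightarrow> 'v \<Rightarrow> 'g \<Rightarrow>\<^sub>0 complex) \<Rightarrow>
     nat \<Rightarrow> ('g \<Rightarrow> 'n list \<Rightarrow>\<^sub>0 complex) set set"
  where "hecke_filt sV v act q \<kappa> m =
    (\<lambda>f. hecke_ideal sV v act q \<kappa> +>\<^bsub>tensor_skew sV v act\<^esub> f) ` {f. \<forall>g. f g \<in> tensor_filt m}"

definition is_quantum_drinfeld_hecke ::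
    "(complex \<Rightarrow> 'v::ab_group_add \<Rightarrow> 'v) \<Rightarrow> ('n::finite \<Rightarrow> 'v) \<Rightarrow> ('g::monoid_mult \<Rightarrow> 'v \<Rightarrow> 'v) \<Rightarrow>
     ('n \<Rightarrow> 'n \<Rightarrow> complex) \<Rightarrow> ('v \<Rightarrow> 'v \<Rightarrow> 'g \<Rightarrow>\<^sub>0 complex) \<Rightarrow> bool"
  where "is_quantum_drinfeld_hecke sV v act q \<kappa> \<longleftrightarrow>
    graded_alg_isomorphic
      (assoc_graded (hecke_alg sV v act q \<kappa>) (hecke_filt sV v act q \<kappa>))
      (assoc_graded_comp (hecke_alg sV v act q \<kappa>) (hecke_filt sV v act q \<kappa>))
      (sq_skew sV v act q)
      (sq_skew_comp q)"


section \<open>Spaces of maps \<open>V \<times> V \<rightarrow> \<complex>G\<close>\<close>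

definition kappa_admissible ::
    "(complex \<Rightarrow> 'v::ab_group_add \<Rightarrow> 'v) \<Rightarrow> ('n \<Rightarrow> 'v) \<Rightarrow>
     ('n \<Rightarrow> 'n \<Rightarrow> complex) \<Rightarrow> ('v \<Rightarrow> 'v \<Rightarrow> 'g \<Rightarrow>\<^sub>0 complex) \<Rightarrow> bool"
  where "kappa_admissible sV v q \<kappa> \<longleftrightarrow>
    (\<forall>x. Vector_Spaces.linear sV pm_scale (\<kappa> x)) \<and>
    (\<forall>y. Vector_Spaces.linear sV pm_scale (\<lambda>x. \<kappa> x y)) \<and>
    (\<forall>i j. \<kappa> (v i) (v j) = pm_scale (- q i j) (\<kappa> (v j) (v i)))"

definition qdh_maps ::
    "(complex \<Rightarrow> 'v::ab_group_add \<Rightarrow> 'v) \<Rightarrow> ('n::finite \<Rightarrow> 'v) \<Rightarrow> ('g::monoid_mult \<Rightarrow> 'v \<Rightarrow> 'v) \<Rightarrow>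
     ('n \<Rightarrow> 'n \<Rightarrow> complex) \<Rightarrow> ('v \<Rightarrow> 'v \<Rightarrow> 'g \<Rightarrow>\<^sub>0 complex) set"
  where "qdh_maps sV v act q =
    {\<kappa>. kappa_admissible sV v q \<kappa> \<and> is_quantum_drinfeld_hecke sV v act q \<kappa>}"

text \<open>
  The bilinear map with value \<open>c i j\<close> at \<open>(v i, v j)\<close> for \<open>i \<noteq> j\<close> and \<open>0\<close> at \<open>(v i, v i)\<close>; the latter
  value is forced by \<^const>\<open>kappa_admissible\<close> as \<open>q i i = 1\<close>.
\<close>

definition kappa_of ::
    "(complex \<Rightarrow> 'v::ab_group_add \<Rightarrow> 'v) \<Rightarrow> ('n::finite \<Rightarrow> 'v) \<Rightarrow>
     ('n \<Rightarrow> 'n \<Rightarrow> 'g \<Rightarrow>\<^sub>0 complex) \<Rightarrow> 'v \<Rightarrow> 'v \<Rightarrow> 'g \<Rightarrow>\<^sub>0 complex"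
  where "kappa_of sV v c x y =
    (\<Sum>i\<in>UNIV. \<Sum>j\<in>UNIV - {i}. pm_scale (coord sV v x i * coord sV v y j) (c i j))"

definition kappa_scale ::
    "complex \<Rightarrow> ('v \<Rightarrow> 'v \<Rightarrow> 'g \<Rightarrow>\<^sub>0 complex) \<Rightarrow> ('v \<Rightarrow> 'v \<Rightarrow> 'g \<Rightarrow>\<^sub>0 complex)"
  where "kappa_scale c \<kappa> = (\<lambda>x y. pm_scale c (\<kappa> x y))"

lemma lookup_pm_scale [simp]:
  "Poly_Mapping.lookup (pm_scale c p) k = c * Poly_Mapping.lookup p k"
  by (simp add: pm_scale_def Poly_Mapping.map.rep_eq when_def)

global_interpretation kappa_space: vector_space kappa_scale
  by standard
    (auto simp: kappa_scale_def fun_eq_iff poly_mapping_eq_iff lookup_add algebra_simps)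


section \<open>Permutations in cycle notation\<close>

definition cyc :: "'n list \<Rightarrow> 'n perm"
  where "cyc is = Perm (cycle_of_list is)"

abbreviation gelt :: "'g \<Rightarrow> 'g \<Rightarrow>\<^sub>0 complex"
  where "gelt g \<equiv> Poly_Mapping.single g 1"

end

theory Submission
  imports Defs "HOL-Library.Countable"
begin

text \<open>
  Write \<open>K i j\<close> for the value of \<open>\<kappa>\<close> at \<open>(v\<^sub>i, v\<^sub>j)\<close>, so that the relations of the algebra are
  \<open>v\<^sub>i v\<^sub>j + v\<^sub>j v\<^sub>i = K i j\<close> for \<open>i \<noteq> j\<close>. The theorem follows from a criterion for the PBW
  property and from the solution of the linear equations in that criterion.

  The criterion (locale \<open>pbw_coeffs\<close>) asks for two identities: \<open>g (K i j) g\<^sup>-\<^sup>1 = K (g i) (g j)\<close>,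
  and the vanishing of the sum of \<open>[K i j, v\<^sub>k]\<close> over the cyclic permutations of three different
  indices, a Jacobi identity for anticommutators. They are necessary because the difference of a
  conjugated relation and the relation for the moved indices has degree 0, the sum of the
  commutators of the relations with generators has degree 1, both lie in the ideal of relations,
  and an isomorphism of graded algebras forces the ideal to contain no nonzero element of degree
  at most 1: the graded pieces in degrees 0 and 1 are finite-dimensional, so that the canonical
  map onto them, which is always surjective, has to be injective (\<open>pbw_property_low\<close>,
  \<open>pbw_property_pbw_coeffs\<close>).

  They are sufficient by the method that is usual for universal enveloping algebras. The vector
  space with basis \<open>g x\<^sup>a\<close>, where \<open>x\<^sup>a\<close> runs through the ordered monomials, is made into a
  module: \<open>v\<^sub>k\<close> is put in front of a monomial if it does not come after its first letter \<open>m\<close>, and is moved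
  past \<open>m\<close> by the relation otherwise. That the relations hold on this module (\<open>gen_act_relation\<close>)
  is proved by induction on the degree, with the Jacobi identity as the critical step. The part
  of highest degree of the action of a tensor on 1 is its normal form in the algebra \<open>S\<^sub>q(V)\<close>, so
  a homogeneous element that is congruent to one of lower degree modulo the relations vanishes in
  \<open>S\<^sub>q(V) \<rtimes> G\<close> (\<open>rel_ideal_leading_term\<close>). Hence the maps of \<open>T(V) \<rtimes> G\<close> onto \<open>S\<^sub>q(V) \<rtimes> G\<close> and
  onto the associated graded algebra have the same kernel (\<open>graded_isomorphic\<close>).

  For the classification, let \<open>g\<close> occur in \<open>K i j\<close> with a nonzero coefficient. Comparing
  coefficients in the Jacobi identity shows that each letter outside \<open>{i, j}\<close> that \<open>g\<close> moves is
  mapped into \<open>{i, j}\<close> and is the image of \<open>i\<close> or \<open>j\<close>. So \<open>g\<close> is \<open>1\<close>, \<open>(ij)\<close>, \<open>(ik)\<close>, \<open>(jk)\<close>,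
  \<open>(ik)(jl)\<close>, \<open>(ijk)\<close> or \<open>(ikj)\<close>, or a 4-cycle, which a further coefficient excludes. By
  equivariance the coefficients are constant on each of the five types, as the symmetric group is
  transitive on tuples of different letters; each type does satisfy the identities; and four
  letters suffice to see that the five solutions are linearly independent (\<open>pbw_coeffs_iff\<close>).
\<close>

section \<open>Linear combinations\<close>

abbreviation (input) coef :: "('k \<Rightarrow>\<^sub>0 complex) \<Rightarrow> 'k \<Rightarrow> complex" where "coef \<equiv> Poly_Mapping.lookup"

abbreviation (input) supp :: "('k \<Rightarrow>\<^sub>0 complex) \<Rightarrow> 'k set" where "supp \<equiv> Poly_Mapping.keys"

abbreviation (input) mon :: "'k \<Rightarrow> complex \<Rightarrow> 'k \<Rightarrow>\<^sub>0 complex" where "mon \<equiv> Poly_Mapping.single"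

lemma pm_scale_add: "pm_scale c (p + q) = pm_scale c p + pm_scale c q"
  by (rule poly_mapping_eqI) (simp add: lookup_add algebra_simps)

lemma pm_scale_diff: "pm_scale c (p - q) = pm_scale c p - pm_scale c q"
  by (rule poly_mapping_eqI) (simp add: lookup_minus algebra_simps)

lemma pm_scale_add_left: "pm_scale (c + d) p = pm_scale c p + pm_scale d p"
  by (rule poly_mapping_eqI) (simp add: lookup_add algebra_simps)

lemma pm_scale_pm_scale [simp]: "pm_scale c (pm_scale d p) = pm_scale (c * d) p"
  by (rule poly_mapping_eqI) simp

lemma pm_scale_zero [simp]: "pm_scale 0 p = 0" "pm_scale c 0 = 0"
  by (rule poly_mapping_eqI, simp)+

lemma pm_scale_one [simp]: "pm_scale 1 p = p"
  by (rule poly_mapping_eqI) simp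

lemma pm_scale_uminus: "pm_scale (- c) p = - pm_scale c p" "pm_scale c (- p) = - pm_scale c p"
  by (rule poly_mapping_eqI, simp)+

lemma pm_scale_single [simp]: "pm_scale c (mon k d) = mon k (c * d)"
  by (rule poly_mapping_eqI) (simp add: lookup_single when_def)

lemma pm_scale_sum: "pm_scale c (sum f A) = (\<Sum>x\<in>A. pm_scale c (f x))"
  by (rule poly_mapping_eqI) (simp add: lookup_sum sum_distrib_left)

lemma keys_pm_scale: "supp (pm_scale c p) \<subseteq> supp p"
  by (auto simp: in_keys_iff)

lemma keys_minus_subset: "supp (p - q :: 'k \<Rightarrow>\<^sub>0 complex) \<subseteq> supp p \<union> supp q"
  by (auto simp: in_keys_iff lookup_minus)

lemma keys_sum_subset: "supp (sum f A :: 'k \<Rightarrow>\<^sub>0 complex) \<subseteq> (\<Union>x\<in>A. supp (f x))"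
  by (auto simp: in_keys_iff lookup_sum) (meson sum.neutral)

lemma pm_scale_eq_mult: "pm_scale c p = mon 0 c * p"
  for p :: "'k::monoid_add \<Rightarrow>\<^sub>0 complex"
  by (simp add: pm_scale_def mult_map_scale_conv_mult)

lemma pm_scale_mult_left: "pm_scale c p * q = pm_scale c (p * q)"
  for p :: "'k::monoid_add \<Rightarrow>\<^sub>0 complex"
  by (simp add: pm_scale_eq_mult mult.assoc)

text \<open>
  The linear map with values \<open>\<phi>\<close> on the basis vectors. Elements of the tensor algebra and of the
  module below are both formal linear combinations, and nearly all maps on them are of this form.
\<close>

definition lin :: "('k \<Rightarrow> 'm \<Rightarrow>\<^sub>0 complex) \<Rightarrow> ('k \<Rightarrow>\<^sub>0 complex) \<Rightarrow> ('m \<Rightarrow>\<^sub>0 complex)"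
  where "lin \<phi> p = (\<Sum>x\<in>supp p. pm_scale (coef p x) (\<phi> x))"

lemma lin_superset:
  assumes "finite A" "supp p \<subseteq> A"
  shows "lin \<phi> p = (\<Sum>x\<in>A. pm_scale (coef p x) (\<phi> x))"
  unfolding lin_def by (rule sum.mono_neutral_left) (use assms in \<open>auto simp: in_keys_iff\<close>)

lemma lin_add: "lin \<phi> (p + q) = lin \<phi> p + lin \<phi> q"
proof -
  let ?A = "supp p \<union> supp q"
  have "lin \<phi> (p + q) = (\<Sum>x\<in>?A. pm_scale (coef (p + q) x) (\<phi> x))"
    by (rule lin_superset) (use keys_add[of p q] in auto)
  also have "\<dots> = (\<Sum>x\<in>?A. pm_scale (coef p x) (\<phi> x)) + (\<Sum>x\<in>?A. pm_scale (coef q x) (\<phi> x))"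
    by (simp add: lookup_add pm_scale_add_left sum.distrib)
  also have "\<dots> = lin \<phi> p + lin \<phi> q"
    by (simp add: lin_superset[of ?A])
  finally show ?thesis .
qed

lemma lin_scale: "lin \<phi> (pm_scale c p) = pm_scale c (lin \<phi> p)"
proof -
  have "lin \<phi> (pm_scale c p) = (\<Sum>x\<in>supp p. pm_scale (coef (pm_scale c p) x) (\<phi> x))"
    by (rule lin_superset) (use keys_pm_scale[of c p] in auto)
  then show ?thesis by (simp add: lin_def pm_scale_sum)
qed

lemma lin_zero [simp]: "lin \<phi> 0 = 0"
  by (simp add: lin_def)

lemma lin_single [simp]: "lin \<phi> (mon k c) = pm_scale c (\<phi> k)"
  by (simp add: lin_def)

lemma lin_uminus: "lin \<phi> (- p) = - lin \<phi> p"
  by (metis add.right_inverse add_eq_0_iff lin_add lin_zero)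

lemma lin_diff: "lin \<phi> (p - q) = lin \<phi> p - lin \<phi> q"
  by (metis lin_add diff_add_cancel add_diff_cancel)

lemma lin_sum: "lin \<phi> (sum f A) = (\<Sum>x\<in>A. lin \<phi> (f x))"
  by (induction A rule: infinite_finite_induct) (simp_all add: lin_add)

lemma lin_cong: "(\<And>x. x \<in> supp p \<Longrightarrow> \<phi> x = \<psi> x) \<Longrightarrow> lin \<phi> p = lin \<psi> p"
  by (simp add: lin_def)

lemma lin_fun_add: "lin (\<lambda>x. \<phi> x + \<psi> x) p = lin \<phi> p + lin \<psi> p"
  by (simp add: lin_def pm_scale_add sum.distrib)

lemma lin_fun_diff: "lin (\<lambda>x. \<phi> x - \<psi> x) p = lin \<phi> p - lin \<psi> p"
  by (simp add: lin_def pm_scale_diff sum_subtractf)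

lemma lin_id: "lin (\<lambda>x. mon x 1) p = p"
  by (rule poly_mapping_eqI) (simp add: lin_def lookup_sum lookup_single when_def in_keys_iff)

lemma lin_lin: "lin \<phi> (lin \<psi> p) = lin (\<lambda>x. lin \<phi> (\<psi> x)) p"
  unfolding lin_def[of \<psi>] by (simp add: lin_sum lin_scale) (simp add: lin_def)

lemma lin_swap: "lin (\<lambda>x. lin (\<phi> x) q) p = lin (\<lambda>y. lin (\<lambda>x. \<phi> x y) p) q"
  unfolding lin_def by (simp add: pm_scale_sum mult.commute) (rule sum.swap)

lemma keys_lin: "supp (lin \<phi> p) \<subseteq> (\<Union>x\<in>supp p. supp (\<phi> x))"
  unfolding lin_def by (rule order_trans[OF keys_sum_subset]) (use keys_pm_scale in fast)

lemma pm_induct [case_names zero single add]: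
  fixes p :: "'k \<Rightarrow>\<^sub>0 complex"
  assumes "supp p \<subseteq> S" and "P 0"
    and "\<And>k c. k \<in> S \<Longrightarrow> P (mon k c)"
    and "\<And>p q. P p \<Longrightarrow> P q \<Longrightarrow> P (p + q)"
  shows "P p"
proof -
  have "P (\<Sum>x\<in>A. mon x (coef p x))" if "finite A" "A \<subseteq> supp p" for A
    using that by (induction rule: finite_induct) (use assms in auto)
  from this[of "supp p"] show ?thesis
    using lin_id[of p] by (simp add: lin_def)
qed

lemma pm_scale_mult_right: "p * pm_scale c q = pm_scale c (p * q)"
  for p :: "'k::monoid_add \<Rightarrow>\<^sub>0 complex"
proof -
  have "p * mon 0 c = mon 0 c * p"
    by (induction p rule: pm_induct[OF subset_UNIV])
      (simp_all add: mult_single algebra_simps)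
  then show ?thesis
    by (simp add: pm_scale_eq_mult flip: mult.assoc)
qed

lemma lin_times_right: "q * lin \<phi> p = lin (\<lambda>x. q * \<phi> x) p"
  for \<phi> :: "'k \<Rightarrow> 'm::monoid_add \<Rightarrow>\<^sub>0 complex"
  by (simp add: lin_def sum_distrib_left pm_scale_mult_right)

section \<open>Multiplication on the expected basis\<close>

abbreviation (input) ap :: "'a perm \<Rightarrow> 'a \<Rightarrow> 'a" where "ap \<equiv> Perm.apply"

lemma perm_apply_inverse [simp]: "ap (inverse g) (ap g i) = i" "ap g (ap (inverse g) i) = i"
  by (simp_all add: apply_sequence)

text \<open>
  The key \<open>(g, a)\<close> stands for the product of the group element \<open>g\<close> and the monomial with the
  letters \<open>a\<close>, where \<open>a\<close> is sorted. With the group element on the left, the group acts on keys by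
  multiplication, and a generator \<open>v\<^sub>i\<close> passes \<open>g\<close> by becoming the generator with index \<open>g\<^sup>-\<^sup>1
  i\<close>. The order on the letters is an arbitrary enumeration of the index type.
\<close>

type_synonym 'n pbw = "('n perm \<times> 'n list) \<Rightarrow>\<^sub>0 complex"

abbreviation index_le :: "'n::finite \<Rightarrow> 'n \<Rightarrow> bool" where "index_le i j \<equiv> to_nat i \<le> to_nat j"

abbreviation pbw_basis :: "'n perm \<Rightarrow> 'n list \<Rightarrow> 'n pbw" where "pbw_basis g a \<equiv> mon (g, a) 1"

definition perm_mult :: "'n perm \<Rightarrow> 'n pbw \<Rightarrow> 'n pbw"
  where "perm_mult h = lin (\<lambda>(g, a). pbw_basis (h * g) a)"

definition embed :: "('n list \<Rightarrow>\<^sub>0 complex) \<Rightarrow> 'n pbw"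
  where "embed = lin (pbw_basis 1)"

text \<open>
  The normal form of \<open>v\<^sub>k x\<^sup>a\<close> in \<open>S\<^sub>q(V)\<close>: the letter moves to its place and changes the sign at
  each letter that it passes.
\<close>

primrec leading :: "'n::finite \<Rightarrow> 'n list \<Rightarrow> ('n list \<Rightarrow>\<^sub>0 complex)" where
  "leading k [] = tgen k"
| "leading k (m # a) = (if index_le k m then mon (k # m # a) 1 else - (tgen m * leading k a))"

lemma perm_mult_pbw_basis [simp]: "perm_mult h (mon (g, a) c) = mon (h * g, a) c"
  by (simp add: perm_mult_def)

lemma perm_mult_lin: "perm_mult h (lin \<phi> p) = lin (\<lambda>x. perm_mult h (\<phi> x)) p"
  by (simp add: perm_mult_def lin_lin)

lemma perm_mult_mult: "perm_mult (h * h') p = perm_mult h (perm_mult h' p)"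
  by (simp add: perm_mult_def lin_lin mult.assoc case_prod_unfold)

lemma perm_mult_one [simp]: "perm_mult 1 p = p"
  by (simp add: perm_mult_def lin_id case_prod_unfold)
lemmas perm_mult_add = lin_add[of "\<lambda>(g, a). pbw_basis (h * g) a" for h, folded perm_mult_def]
lemmas perm_mult_diff = lin_diff[of "\<lambda>(g, a). pbw_basis (h * g) a" for h, folded perm_mult_def]
lemmas perm_mult_scale = lin_scale[of "\<lambda>(g, a). pbw_basis (h * g) a" for h, folded perm_mult_def]

lemma keys_perm_mult: "supp (perm_mult h p) \<subseteq> (\<lambda>(g, a). (h * g, a)) ` supp p"
  unfolding perm_mult_def by (rule order_trans[OF keys_lin]) (auto split: prod.splits)

lemma keys_embed: "supp (embed p) \<subseteq> Pair 1 ` supp p"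
  unfolding embed_def using keys_lin[of "pbw_basis 1" p] by auto

abbreviation index_sorted :: "'n::finite list \<Rightarrow> bool" where "index_sorted \<equiv> sorted_wrt index_le"

lemma keys_tgen_mult: "supp (tgen m * p) \<subseteq> Cons m ` supp p"
  using keys_mult[of "tgen m" p] by (auto simp: tgen_def plus_list_def)

lemma keys_leading: "c \<in> supp (leading k a) \<Longrightarrow> length c = Suc (length a) \<and> set c = insert k (set a) \<and>
    (index_sorted a \<longrightarrow> index_sorted c)"
proof (induction a arbitrary: c)
  case Nil then show ?case by (simp add: tgen_def split: if_splits)
next
  case (Cons m a)
  show ?case
  proof (cases "index_le k m")
    case True
    then show ?thesis using Cons.prems by (force split: if_splits)
  next
    case False
    then have "c \<in> supp (tgen m * leading k a)"
      using Cons.prems by (simp add: in_keys_iff)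
    then obtain d where d: "d \<in> supp (leading k a)" "c = m # d"
      using keys_tgen_mult[of m "leading k a"] by auto
    with Cons.IH[OF d(1)] False show ?thesis by auto
  qed
qed

locale hecke_coeffs =
  fixes K :: "'n::finite \<Rightarrow> 'n \<Rightarrow> 'n perm \<Rightarrow>\<^sub>0 complex"
begin

definition coeff_mult :: "'n \<Rightarrow> 'n \<Rightarrow> 'n pbw \<Rightarrow> 'n pbw"
  where "coeff_mult i j p = lin (\<lambda>h. perm_mult h p) (K i j)"

text \<open>
  The terms of lower degree in \<open>v\<^sub>k x\<^sup>a\<close>. If \<open>k\<close> comes after the first letter \<open>m\<close>, the relation
  gives \<open>v\<^sub>k v\<^sub>m x\<^sup>a = K k m x\<^sup>a - v\<^sub>m (v\<^sub>k x\<^sup>a)\<close>. In the last product the leading part of \<open>v\<^sub>k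
  x\<^sup>a\<close> consists of letters after \<open>m\<close> and only gets the prefix \<open>m\<close>, so it contributes nothing of
  lower degree; the other terms \<open>g x\<^sup>b\<close> of \<open>v\<^sub>k x\<^sup>a\<close> are those of \<open>lower k a\<close>, and \<open>v\<^sub>m\<close> acts on
  them by recursion. The bound on the length in the sum makes the recursion well-founded; all
  terms satisfy it by \<open>lower_sorted_below\<close>.
\<close>

function lower :: "'n \<Rightarrow> 'n list \<Rightarrow> 'n pbw" where
  "lower k [] = 0"
| "lower k (m # a) = (if index_le k m then 0 else coeff_mult k m (pbw_basis 1 a) -
     (\<Sum>x\<in>{x \<in> supp (lower k a). length (snd x) \<le> length a}.
        pm_scale (coef (lower k a) x)
          (perm_mult (fst x) (embed (leading (ap (inverse (fst x)) m) (snd x))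
              + lower (ap (inverse (fst x)) m) (snd x)))))"
  by pat_completeness auto
termination by (relation "measure (\<lambda>(k, a). length a)") auto

definition gen_word :: "'n \<Rightarrow> 'n list \<Rightarrow> 'n pbw" where "gen_word k a = embed (leading k a) + lower k a"

definition gen_act :: "'n \<Rightarrow> 'n pbw \<Rightarrow> 'n pbw"
  where "gen_act i = lin (\<lambda>(g, a). perm_mult g (gen_word (ap (inverse g) i) a))"

lemma gen_act_pbw_basis: "gen_act i (pbw_basis g a) = perm_mult g (gen_word (ap (inverse g) i) a)"
  by (simp add: gen_act_def)

lemma gen_act_lin: "gen_act i (lin \<phi> p) = lin (\<lambda>x. gen_act i (\<phi> x)) p"
  by (simp add: gen_act_def lin_lin)
lemmas gen_act_add = lin_add[of "\<lambda>(g, a). perm_mult g (gen_word (ap (inverse g) i) a)"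
    for i, folded gen_act_def]
lemmas gen_act_diff = lin_diff[of "\<lambda>(g, a). perm_mult g (gen_word (ap (inverse g) i) a)"
    for i, folded gen_act_def]

lemma gen_act_perm_mult: "gen_act i (perm_mult h p) = perm_mult h (gen_act (ap (inverse h) i) p)"
proof -
  have "gen_act i (perm_mult h p) = lin (\<lambda>x. gen_act i (pbw_basis (h * fst x) (snd x))) p"
    by (simp add: perm_mult_def gen_act_lin case_prod_unfold)
  also have "\<dots> = lin (\<lambda>x. perm_mult h (gen_act (ap (inverse h) i) (pbw_basis (fst x) (snd x)))) p"
    by (rule lin_cong) (auto simp: gen_act_pbw_basis perm_mult_mult apply_times)
  also have "\<dots> = perm_mult h (gen_act (ap (inverse h) i) p)"
    by (simp add: perm_mult_lin[symmetric] gen_act_lin[symmetric] lin_id)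
  finally show ?thesis .
qed

lemma lower_unfold: "lower k (m # a) = (if index_le k m then 0 else coeff_mult k m (pbw_basis 1 a) -
     (\<Sum>x\<in>{x \<in> supp (lower k a). length (snd x) \<le> length a}.
        pm_scale (coef (lower k a) x) (perm_mult (fst x) (gen_word (ap (inverse (fst x)) m) (snd x)))))"
  by (simp add: gen_word_def)

declare lower.simps(2) [simp del]

text \<open>
  The span of the \<open>g x\<^sup>a\<close> with sorted \<open>a\<close> of degree less than \<open>d\<close>.
\<close>

definition sorted_below :: "nat \<Rightarrow> 'n pbw set"
  where "sorted_below d = {p. \<forall>x\<in>supp p. length (snd x) < d \<and> index_sorted (snd x)}"

lemma sorted_below_closed:
  "0 \<in> sorted_below d" "p \<in> sorted_below d \<Longrightarrow> q \<in> sorted_below d \<Longrightarrow> p + q \<in> sorted_below d"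
      "p \<in> sorted_below d \<Longrightarrow> q \<in> sorted_below d \<Longrightarrow> p - q \<in> sorted_below d"
  "p \<in> sorted_below d \<Longrightarrow> pm_scale c p \<in> sorted_below d" "p \<in> sorted_below d \<Longrightarrow> perm_mult h p \<in> sorted_below d"
  "(\<And>x. x \<in> S \<Longrightarrow> f x \<in> sorted_below d) \<Longrightarrow> sum f S \<in> sorted_below d"
  "(\<And>x. x \<in> supp r \<Longrightarrow> \<phi> x \<in> sorted_below d) \<Longrightarrow> lin \<phi> r \<in> sorted_below d"
  unfolding sorted_below_def
  subgoal by simp
  subgoal using keys_add[of p q] by blast
  subgoal using keys_minus_subset[of p q] by blast
  subgoal using keys_pm_scale[of c p] by blast
  subgoal using keys_perm_mult[of h p] by fastforce
  subgoal using keys_sum_subset[of f S] by blast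
  subgoal using keys_lin[of \<phi> r] by blast
  done

lemma sorted_below_mono: "p \<in> sorted_below d \<Longrightarrow> d \<le> e \<Longrightarrow> p \<in> sorted_below e"
  by (fastforce simp: sorted_below_def)

lemma coeff_mult_sorted_below: "p \<in> sorted_below d \<Longrightarrow> coeff_mult i j p \<in> sorted_below d"
  unfolding coeff_mult_def by (intro sorted_below_closed)

lemma pbw_basis_sorted_below: "index_sorted a \<Longrightarrow> length a < d \<Longrightarrow> pbw_basis g a \<in> sorted_below d"
  by (simp add: sorted_below_def)

lemma embed_leading_sorted_below: "index_sorted a \<Longrightarrow> Suc (length a) < d \<Longrightarrow> embed (leading k a) \<in> sorted_below d"
  using keys_embed[of "leading k a"] keys_leading[of _ k a] by (fastforce simp: sorted_below_def)

lemma lower_sorted_below: "index_sorted a \<Longrightarrow> lower k a \<in> sorted_below (length a)"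
proof (induction "length a" arbitrary: k a rule: less_induct)
  case less
  show ?case
  proof (cases a)
    case Nil then show ?thesis by (simp add: sorted_below_closed)
  next
    case (Cons m b)
    with less.prems have sb: "index_sorted b" by simp
    have Bb: "lower k b \<in> sorted_below (length b)"
      using less.hyps[of b] Cons sb by simp
    show ?thesis unfolding Cons lower_unfold
    proof (cases "index_le k m", simp_all only: if_True if_False, goal_cases)
      case 1 show ?case by (rule sorted_below_closed)
    next
      case 2 show ?case
    proof (intro sorted_below_closed)
      show "coeff_mult k m (pbw_basis 1 b) \<in> sorted_below (length (m # b))"
        by (intro coeff_mult_sorted_below pbw_basis_sorted_below) (use sb in auto)
    next
      fix x assume "x \<in> {x \<in> supp (lower k b). length (snd x) \<le> length b}"
      then have x: "length (snd x) < length b" "index_sorted (snd x)"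
        using Bb by (auto simp: sorted_below_def)
      have "lower i (snd x) \<in> sorted_below (length (m # b))" for i
        by (rule sorted_below_mono[OF less.hyps]) (use x Cons in auto)
      then show "gen_word (ap (inverse (fst x)) m) (snd x) \<in> sorted_below (length (m # b))"
        unfolding gen_word_def using x
        by (intro sorted_below_closed(2) embed_leading_sorted_below) auto
    qed
    qed
  qed
qed

lemma gen_word_sorted_below: "index_sorted a \<Longrightarrow> gen_word k a \<in> sorted_below (Suc (Suc (length a)))"
  unfolding gen_word_def by (intro sorted_below_closed(2) embed_leading_sorted_below sorted_below_mono[OF
      lower_sorted_below]) auto

lemma gen_act_sorted_below:
  assumes "p \<in> sorted_below d" shows "gen_act i p \<in> sorted_below (Suc d)"
  unfolding gen_act_def
proof (rule sorted_below_closed(7))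
  fix x assume x: "x \<in> supp p"
  obtain g a where ga: "x = (g, a)" by (cases x)
  have "length a < d" "index_sorted a"
    using assms x ga by (auto simp: sorted_below_def)
  then have "gen_word k a \<in> sorted_below (Suc d)" for k
    by (intro sorted_below_mono[OF gen_word_sorted_below]) auto
  then show "(case x of (g, a) \<Rightarrow> perm_mult g (gen_word (ap (inverse g) i) a)) \<in> sorted_below (Suc d)"
    by (simp add: ga sorted_below_closed)
qed

lemma gen_word_Cons_le: "index_le k m \<Longrightarrow> gen_word k (m # a) = pbw_basis 1 (k # m # a)"
  by (simp add: gen_word_def lower_unfold embed_def)

lemma gen_word_min: "\<forall>x\<in>set a. index_le k x \<Longrightarrow> gen_word k a = pbw_basis 1 (k # a)"
  by (cases a) (auto simp: gen_word_Cons_le, simp add: gen_word_def embed_def tgen_def)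

lemma gen_act_embed_min:
  assumes "\<And>c. c \<in> supp p \<Longrightarrow> \<forall>x\<in>set c. index_le m x"
  shows "gen_act m (embed p) = embed (tgen m * p)"
proof -
  have "gen_act m (embed p) = lin (\<lambda>c. gen_act m (pbw_basis 1 c)) p"
    by (simp add: embed_def gen_act_lin)
  also have "\<dots> = lin (\<lambda>c. pbw_basis 1 (m # c)) p"
    by (rule lin_cong) (simp add: gen_act_pbw_basis gen_word_min assms)
  also have "\<dots> = embed (tgen m * lin (\<lambda>c. mon c 1) p)"
    by (simp add: lin_times_right embed_def lin_lin) (simp add: tgen_def mult_single plus_list_def)
  finally show ?thesis by (simp add: lin_id)
qed

text \<open>
  The relation that motivates the recursion of \<open>lower\<close>, now for the whole action of \<open>v\<^sub>m\<close>: this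
  needs that the leading part of \<open>v\<^sub>k x\<^sup>a\<close> is a combination of words with no letter before \<open>m\<close>.
\<close>

lemma gen_word_Cons:
  assumes "index_sorted (m # a)" "\<not> index_le k m"
  shows "gen_word k (m # a) = coeff_mult k m (pbw_basis 1 a) - gen_act m (gen_word k a)"
proof -
  have "gen_act m (embed (leading k a)) = embed (tgen m * leading k a)"
    by (rule gen_act_embed_min) (use assms in \<open>auto dest!: keys_leading\<close>)
  moreover have "gen_act m (lower k a) = (\<Sum>x\<in>{x \<in> supp (lower k a). length (snd x) \<le> length a}.
        pm_scale (coef (lower k a) x) (perm_mult (fst x) (gen_word (ap (inverse (fst x)) m) (snd x))))"
    unfolding gen_act_def lin_def using lower_sorted_below[of a k] assms
    by (intro sum.cong) (auto simp: sorted_below_def)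
  ultimately show ?thesis using assms
    by (simp add: gen_word_def[of k] lower_unfold gen_act_add) (simp add: embed_def lin_uminus)
qed

end

lemma finite_perms: "finite (UNIV :: 'n::finite perm set)"
  by (rule finite_imageD[of ap]) (auto intro!: inj_onI perm_eqI)

lemma lin_UNIV: "lin \<phi> p = (\<Sum>g\<in>UNIV. pm_scale (coef p g) (\<phi> g))"
  for p :: "'n::finite perm \<Rightarrow>\<^sub>0 complex"
  by (rule lin_superset[OF finite_perms subset_UNIV])

lemma perm_cancel [simp]: "g * (inverse g * h) = h" "inverse g * (g * h) = h" for g h :: "'a perm"
  by (rule perm_eqI, simp add: apply_times)+

lemma pm_scale_diff_left: "pm_scale (c - d) p = pm_scale c p - pm_scale d p"
  by (rule poly_mapping_eqI) (simp add: lookup_minus algebra_simps)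

lemma sorted_below_lin:
  fixes p :: "'n::finite pbw" and E E' :: "'n pbw \<Rightarrow> 'b \<Rightarrow>\<^sub>0 complex"
  assumes "p \<in> hecke_coeffs.sorted_below d"
    and "\<And>g a. index_sorted a \<Longrightarrow> length a < d \<Longrightarrow> E (pbw_basis g a) = E' (pbw_basis g a)"
    and linear: "\<And>\<phi> (r :: 'n pbw). E (lin \<phi> r) = lin (\<lambda>x. E (\<phi> x)) r"
      "\<And>\<phi> (r :: 'n pbw). E' (lin \<phi> r) = lin (\<lambda>x. E' (\<phi> x)) r"
  shows "E p = E' p"
proof -
  have "E (lin (\<lambda>x. mon x 1) p) = E' (lin (\<lambda>x. mon x 1) p)"
    unfolding linear by (rule lin_cong) (use assms(1,2) in \<open>auto simp: hecke_coeffs.sorted_below_def\<close>)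
  then show ?thesis by (simp add: lin_id)
qed

text \<open>
  The two identities that characterise the PBW property. Equivariance says that conjugation by
  \<open>g\<close> maps \<open>K i j\<close> to the coefficients for the moved indices. The assumption \<open>jacobi\<close> is the
  coefficient of \<open>v\<^sub>x g\<close> in the sum of \<open>[K i j, v\<^sub>k]\<close> over the cyclic permutations of \<open>i\<close>, \<open>j\<close>,
  \<open>k\<close>, as \<open>g v\<^sub>k - v\<^sub>k g\<close> is the product of \<open>g v\<^sub>k g\<^sup>-\<^sup>1 - v\<^sub>k\<close> and \<open>g\<close>.
\<close>

locale pbw_coeffs = hecke_coeffs K for K :: "'n::finite \<Rightarrow> 'n \<Rightarrow> 'n perm \<Rightarrow>\<^sub>0 complex" +
  assumes diag: "K i i = 0"
    and sym: "K i j = K j i"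
    and equivariant: "coef (K (ap g i) (ap g j)) (g * h * inverse g) = coef (K i j) h"
    and jacobi: "i \<noteq> j \<Longrightarrow> j \<noteq> k \<Longrightarrow> i \<noteq> k \<Longrightarrow>
      coef (K i j) g * (of_bool (ap g k = x) - of_bool (k = x)) +
      coef (K j k) g * (of_bool (ap g i = x) - of_bool (i = x)) +
      coef (K k i) g * (of_bool (ap g j = x) - of_bool (j = x)) = 0"
begin

lemma coeff_mult_UNIV: "coeff_mult i j p = (\<Sum>h\<in>UNIV. pm_scale (coef (K i j) h) (perm_mult h p))"
  by (simp add: coeff_mult_def lin_UNIV)

lemma coeff_mult_lin: "coeff_mult i j (lin \<phi> p) = lin (\<lambda>x. coeff_mult i j (\<phi> x)) p"
  unfolding coeff_mult_def perm_mult_lin by (rule lin_swap)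

lemma coeff_mult_perm_mult: "coeff_mult i j (perm_mult g p) =
    perm_mult g (coeff_mult (ap (inverse g) i) (ap (inverse g) j) p)"
proof -
  let ?i = "ap (inverse g) i" and ?j = "ap (inverse g) j"
  have "coeff_mult i j (perm_mult g p) = (\<Sum>h\<in>UNIV. pm_scale (coef (K i j) (g * h * inverse g)) (perm_mult
      (g * h * inverse g) (perm_mult g p)))"
    unfolding coeff_mult_UNIV
    by (rule sum.reindex_bij_witness[of _ "\<lambda>h. g * h * inverse g" "\<lambda>h. inverse g * h * g"]) (auto simp:
        mult.assoc)
  also have "\<dots> = (\<Sum>h\<in>UNIV. pm_scale (coef (K ?i ?j) h) (perm_mult (g * h) p))"
    using equivariant[of g ?i ?j] by (simp add: mult.assoc flip: perm_mult_mult)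
  also have "\<dots> = perm_mult g (coeff_mult ?i ?j p)"
    by (simp add: coeff_mult_def lin_UNIV perm_mult_lin perm_mult_mult flip: perm_mult_scale)
      (simp add: perm_mult_lin perm_mult_scale flip: lin_UNIV)
  finally show ?thesis .
qed

text \<open>
  The coefficients of the basis vectors vanish, so the identity holds with any family of vectors
  in place of the basis; \<open>g\<^sup>-\<^sup>1\<close> appears because the group elements are collected on the left.
\<close>

lemma jacobi_fun:
  assumes "i \<noteq> j" "j \<noteq> k" "i \<noteq> k"
  shows "pm_scale (coef (K i j) g) (F (ap (inverse g) k) - F k) +
         pm_scale (coef (K j k) g) (F (ap (inverse g) i) - F i) +
         pm_scale (coef (K k i) g) (F (ap (inverse g) j) - F j) = 0" (is "?S = 0")
proof -
  have F: "F l = (\<Sum>y\<in>UNIV. pm_scale (of_bool (l = y)) (F y))" for l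
    by (simp add: of_bool_def if_distrib[of "\<lambda>c. pm_scale c _"] cong: if_cong)
  have D: "F (ap (inverse g) l) - F l =
      (\<Sum>y\<in>UNIV. pm_scale (- (of_bool (ap g l = ap g y) - of_bool (l = ap g y))) (F y))" for l
  proof -
    have *: "ap (inverse g) l = y \<longleftrightarrow> l = ap g y" for y by auto
    show ?thesis
      by (subst (1 2) F) (simp add: * apply_inj pm_scale_diff pm_scale_uminus
          flip: sum_subtractf pm_scale_diff_left)
  qed
  have "?S = (\<Sum>y\<in>UNIV. pm_scale (-(
      coef (K i j) g * (of_bool (ap g k = ap g y) - of_bool (k = ap g y)) +
      coef (K j k) g * (of_bool (ap g i = ap g y) - of_bool (i = ap g y)) +
      coef (K k i) g * (of_bool (ap g j = ap g y) - of_bool (j = ap g y)))) (F y))"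
    unfolding D pm_scale_sum
    by (simp only: pm_scale_pm_scale pm_scale_add_left[symmetric] sum.distrib[symmetric])
      (simp add: algebra_simps)
  also have "\<dots> = 0" by (simp add: jacobi[OF assms])
  finally show ?thesis .
qed

lemma jacobi_commutator:
  assumes "i \<noteq> j" "j \<noteq> k" "i \<noteq> k"
  shows "(gen_act k (coeff_mult i j p) - coeff_mult i j (gen_act k p)) + (gen_act i (coeff_mult j k p)
      - coeff_mult j k (gen_act i p)) + (gen_act j (coeff_mult k i p) - coeff_mult k i (gen_act j p)) = 0"
proof -
  have c: "gen_act k (coeff_mult i j p) - coeff_mult i j (gen_act k p) =
      (\<Sum>h\<in>UNIV. perm_mult h (pm_scale (coef (K i j) h) (gen_act (ap (inverse h) k) p - gen_act k p)))" for i j k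
    unfolding coeff_mult_def gen_act_lin unfolding lin_UNIV by (simp add:
        gen_act_perm_mult perm_mult_scale perm_mult_diff pm_scale_diff sum_subtractf)
  show ?thesis
    unfolding c using jacobi_fun[OF assms, of _ "\<lambda>l. gen_act l p"]
    by (simp add: perm_mult_def[symmetric] flip: sum.distrib perm_mult_add) (simp add: perm_mult_def)
qed

text \<open>
  Below all letters of \<open>a\<close> the generator \<open>v\<^sub>m\<close> is only written in front, and then the relation
  holds by the definition of the action of \<open>v\<^sub>i\<close>.
\<close>

lemma straighten_min:
  assumes "index_sorted a" "\<forall>x\<in>set a. index_le m x" "\<not> index_le i m"
  shows "gen_act i (gen_act m (pbw_basis 1 a)) + gen_act m (gen_act i (pbw_basis 1 a)) =
      coeff_mult i m (pbw_basis 1 a)"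
proof -
  have "gen_word m a = pbw_basis 1 (m # a)" by (rule gen_word_min) (use assms in auto)
  moreover have "gen_word i (m # a) = coeff_mult i m (pbw_basis 1 a) - gen_act m (gen_word i a)"
    by (rule gen_word_Cons) (use assms in auto)
  ultimately show ?thesis by (simp add: gen_act_pbw_basis perm.inverse_neutral)
qed

text \<open>
  Induction on the degree. By equivariance \<open>g = 1\<close> may be assumed, and by symmetry that \<open>i\<close> comes
  after \<open>j\<close>. If \<open>j\<close> is not after the letters of \<open>a\<close>, the relation is \<open>straighten_min\<close>. Otherwise
  \<open>a\<close> begins with a letter \<open>m\<close> before both, and \<open>v\<^sub>i v\<^sub>j v\<^sub>m x\<^sup>b\<close> is rewritten by moving \<open>v\<^sub>m\<close> to
  the left through \<open>v\<^sub>j\<close> and \<open>v\<^sub>i\<close>. Adding the same with \<open>i\<close> and \<open>j\<close> exchanged, the quadratic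
  terms combine to \<open>v\<^sub>m K i j x\<^sup>b\<close> by induction, and what remains is the sum of the three
  commutators of the Jacobi identity.
\<close>

lemma gen_act_relation_pbw_basis:
  assumes "index_sorted a" "i \<noteq> j"
  shows "gen_act i (gen_act j (pbw_basis g a)) + gen_act j (gen_act i (pbw_basis g a)) =
      coeff_mult i j (pbw_basis g a)"
  using assms
proof (induction "length a" arbitrary: a i j g rule: less_induct)
  case less
  have IHM: "gen_act i (gen_act j p) + gen_act j (gen_act i p) = coeff_mult i j p" if "i \<noteq> j"
      "p \<in> sorted_below (length a)" for i j p
    using that(2)
    by (rule sorted_below_lin) (use less.hyps that(1) in \<open>auto simp: gen_act_lin lin_fun_add coeff_mult_lin\<close>)
  have main: "gen_act i (gen_act j (pbw_basis 1 a)) + gen_act j (gen_act i (pbw_basis 1 a)) =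
      coeff_mult i j (pbw_basis 1 a)" if "\<not> index_le i j" for i j
  proof (cases "\<forall>x\<in>set a. index_le j x")
    case True
    then show ?thesis using straighten_min less.prems that by blast
  next
    case False
    then obtain m b where a: "a = m # b" by (cases a) auto
    have sb: "index_sorted b" "\<forall>x\<in>set b. index_le m x" using less.prems a by auto
    have mj: "\<not> index_le j m" using False sb a by force
    then have mi: "\<not> index_le i m" using that by auto
    have ne: "i \<noteq> j" "m \<noteq> j" "i \<noteq> m" using that mj mi by auto
    \<comment> \<open>The element \<open>v\<^sub>j x\<^sup>b\<close> has the same degree as \<open>a\<close>, so the induction hypothesis covers only
      its lower terms; on its leading part \<open>v\<^sub>m\<close> is only written in front.\<close>
    have Vm: "gen_act i (gen_act m q) = coeff_mult i m q - gen_act m (gen_act i q)"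
      if "q = gen_word j b" "i \<noteq> m" "\<not> index_le i m" "\<not> index_le j m" for i j q
    proof -
      have "gen_act i (gen_act m (embed (leading j b))) + gen_act m (gen_act i (embed (leading j b))) =
          coeff_mult i m (embed (leading j b))"
      proof -
        have "lin (\<lambda>c. gen_act i (gen_act m (pbw_basis 1 c))
            + gen_act m (gen_act i (pbw_basis 1 c))) (leading j b) =
            lin (\<lambda>c. coeff_mult i m (pbw_basis 1 c)) (leading j b)"
          by (rule lin_cong, rule straighten_min) (use that sb in \<open>auto dest!: keys_leading\<close>)
        then show ?thesis by (simp add: embed_def gen_act_lin coeff_mult_lin lin_fun_add)
      qed
      moreover have "gen_act i (gen_act m (lower j b)) + gen_act m (gen_act i (lower j b)) =
          coeff_mult i m (lower j b)"
        by (rule IHM) (use that a in \<open>auto intro!: sorted_below_mono[OF lower_sorted_below] sb\<close>)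
      moreover have "coeff_mult i m (p + q) = coeff_mult i m p + coeff_mult i m q" for p q
        unfolding coeff_mult_def by (simp add: perm_mult_add lin_fun_add)
      ultimately show ?thesis using that(1)
        by (simp add: gen_word_def gen_act_add algebra_simps)
    qed
    have *: "gen_act i (gen_act j (pbw_basis 1 a)) = gen_act i (coeff_mult j m (pbw_basis 1 b))
        - coeff_mult i m (gen_act j (pbw_basis 1 b)) + gen_act m (gen_act i (gen_act j (pbw_basis 1 b)))"
      if "i \<noteq> m" "\<not> index_le i m" "\<not> index_le j m" for i j
    proof -
      have "gen_act j (pbw_basis 1 a) = coeff_mult j m (pbw_basis 1 b) - gen_act m (gen_word j b)"
        using gen_word_Cons[of m b j] less.prems that a by (simp add: gen_act_pbw_basis)
      then show ?thesis using Vm[of "gen_word j b" j i] that by (simp add: gen_act_diff gen_act_pbw_basis)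
    qed
    have "gen_act i (gen_act j (pbw_basis 1 b)) + gen_act j (gen_act i (pbw_basis 1 b)) =
        coeff_mult i j (pbw_basis 1 b)"
      by (rule less.hyps) (use a sb ne in auto)
    then have e: "gen_act m (gen_act i (gen_act j (pbw_basis 1 b)))
        + gen_act m (gen_act j (gen_act i (pbw_basis 1 b))) = gen_act m (coeff_mult i j (pbw_basis 1 b))"
      by (simp flip: gen_act_add)
    have "gen_act m (pbw_basis 1 b) = pbw_basis 1 a"
      by (simp add: gen_act_pbw_basis gen_word_min sb a)
    then have "coeff_mult i j (pbw_basis 1 a) = coeff_mult i j (gen_act m (pbw_basis 1 b))" by simp
    moreover have "coeff_mult i m = coeff_mult m i" "coeff_mult j m = coeff_mult m j" by (simp_all add:
        coeff_mult_def fun_eq_iff sym[of _ m])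
    ultimately have "gen_act i (gen_act j (pbw_basis 1 a)) + gen_act j (gen_act i (pbw_basis 1 a))
        - coeff_mult i j (pbw_basis 1 a) =
        (gen_act m (coeff_mult i j (pbw_basis 1 b)) - coeff_mult i j (gen_act m (pbw_basis 1 b))) +
        (gen_act i (coeff_mult j m (pbw_basis 1 b)) - coeff_mult j m (gen_act i (pbw_basis 1 b))) +
        (gen_act j (coeff_mult m i (pbw_basis 1 b)) - coeff_mult m i (gen_act j (pbw_basis 1 b)))"
      using ne mi mj by (simp add: *[of i j] *[of j i] e[symmetric])
    also have "\<dots> = 0" using jacobi_commutator[of i j m "pbw_basis 1 b"] ne by auto
    finally show ?thesis by simp
  qed
  have main': "gen_act i (gen_act j (pbw_basis 1 a)) + gen_act j (gen_act i (pbw_basis 1 a)) =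
      coeff_mult i j (pbw_basis 1 a)" if "i \<noteq> j" for i j
  proof (cases "index_le i j")
    case True
    then have "\<not> index_le j i" using that inj_to_nat by (auto simp: inj_eq)
    from main[OF this] show ?thesis by (simp add: add.commute coeff_mult_def sym[of i])
  qed (rule main)
  have g: "pbw_basis g a = perm_mult g (pbw_basis 1 a)" by simp
  show ?case
    unfolding g gen_act_perm_mult coeff_mult_perm_mult perm_mult_add[symmetric]
    by (subst main') (use less.prems in \<open>auto simp: apply_inj\<close>)
qed

lemma gen_act_relation:
  assumes "p \<in> sorted_below d" "i \<noteq> j"
  shows "gen_act i (gen_act j p) + gen_act j (gen_act i p) = coeff_mult i j p"
  using assms(1) by (rule sorted_below_lin) (auto simp:
      gen_act_relation_pbw_basis assms gen_act_lin lin_fun_add coeff_mult_lin)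
end

section \<open>The skew group algebra of the tensor algebra\<close>

lemma sum_fun_apply: "(sum f A :: 'a \<Rightarrow> 'b::comm_monoid_add) x = (\<Sum>i\<in>A. f i x)"
  by (induction A rule: infinite_finite_induct) auto

definition perm_act :: "'n perm \<Rightarrow> ('n list \<Rightarrow>\<^sub>0 complex) \<Rightarrow> ('n list \<Rightarrow>\<^sub>0 complex)"
  where "perm_act g = lin (\<lambda>w. mon (map (ap g) w) 1)"
lemmas perm_act_add = lin_add[of "\<lambda>w. mon (map (ap g) w) 1" for g, folded perm_act_def]
lemmas perm_act_diff = lin_diff[of "\<lambda>w. mon (map (ap g) w) 1" for g, folded perm_act_def]
lemmas perm_act_scale = lin_scale[of "\<lambda>w. mon (map (ap g) w) 1" for g, folded perm_act_def]
lemmas perm_act_sum = lin_sum[of "\<lambda>w. mon (map (ap g) w) 1" for g, folded perm_act_def]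
lemmas perm_act_uminus = lin_uminus[of "\<lambda>w. mon (map (ap g) w) 1" for g, folded perm_act_def]

lemma perm_act_zero [simp]: "perm_act g 0 = 0" by (simp add: perm_act_def)

lemma perm_act_single [simp]: "perm_act g (mon w c) = mon (map (ap g) w) c"
  by (simp add: perm_act_def)

lemma perm_act_one [simp]: "perm_act 1 p = p" by (simp add: perm_act_def lin_id)

lemma perm_act_perm_act: "perm_act g (perm_act h p) = perm_act (g * h) p"
  by (simp add: perm_act_def lin_lin apply_times)

lemma perm_act_inverse [simp]: "perm_act g (perm_act (inverse g) p) = p"
    "perm_act (inverse g) (perm_act g p) = p"
  by (simp_all add: perm_act_perm_act)

lemma perm_act_mult: "perm_act g (p * q) = perm_act g p * perm_act g q"
proof (induction p rule: pm_induct[OF subset_UNIV])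
  case (2 w c)
  show ?case
    by (induction q rule: pm_induct[OF subset_UNIV])
      (simp_all add: perm_act_add distrib_left mult_single plus_list_def)
qed (simp_all add: perm_act_add distrib_right)

lemma keys_perm_act: "supp (perm_act g p) \<subseteq> map (ap g) ` supp p"
  unfolding perm_act_def by (rule order_trans[OF keys_lin]) auto

lemma perm_act_tgen: "perm_act g (tgen i) = tgen (ap g i)" by (simp add: tgen_def)

lemma tensor_alg_simps [simp]: "carrier tensor_alg = UNIV" "mult tensor_alg = (*)" "one tensor_alg = 1"
  "zero tensor_alg = 0" "add tensor_alg = (+)" "smult tensor_alg = pm_scale"
  by (simp_all add: tensor_alg_def)

lemma tensor_alg_ring: "ring (tensor_alg :: (complex, 'n list \<Rightarrow>\<^sub>0 complex) module)"
proof (rule ringI)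
  show "abelian_group (tensor_alg :: (complex, 'n list \<Rightarrow>\<^sub>0 complex) module)"
    by (rule abelian_groupI) (auto simp: add.assoc add.commute intro: exI[of _ "- x" for x])
  show "Group.monoid (tensor_alg :: (complex, 'n list \<Rightarrow>\<^sub>0 complex) module)"
    by (rule Group.monoid.intro) (auto simp: mult.assoc)
qed (auto simp: algebra_simps)

lemma finsum_tensor_alg: "finsum (tensor_alg :: (complex, 'n list \<Rightarrow>\<^sub>0 complex) module) f A = sum f A"
proof -
  interpret ring "tensor_alg :: (complex, 'n list \<Rightarrow>\<^sub>0 complex) module" by (rule tensor_alg_ring)
  show ?thesis
    by (induction A rule: infinite_finite_induct) (simp_all add: finsum_infinite finsum_insert)
qed

definition skew_mult :: "('n::finite perm \<Rightarrow> 'n list \<Rightarrow>\<^sub>0 complex) \<Rightarrow> ('n perm \<Rightarrow> 'n list \<Rightarrow>\<^sub>0 complex) \<Rightarrow> ('n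
    perm \<Rightarrow> 'n list \<Rightarrow>\<^sub>0 complex)"
  where "skew_mult f f' x = (\<Sum>g\<in>UNIV. f g * perm_act g (f' (inverse g * x)))"

abbreviation skew :: "(complex, 'n::finite perm \<Rightarrow> 'n list \<Rightarrow>\<^sub>0 complex) module"
  where "skew \<equiv> skew_group_alg tensor_alg perm_act"

lemma sum_pairs_factor: "(\<Sum>(g, h)\<in>{(g, h). g * h = x}. \<phi> g h) = (\<Sum>g\<in>UNIV. \<phi> g (inverse g * x))"
  for x :: "'n::finite perm"
  by (rule sum.reindex_bij_witness[of _ "\<lambda>g. (g, inverse g * x)" fst]) auto

lemma skew_simps [simp]: "carrier skew = UNIV" "mult skew = skew_mult" "one skew = (\<lambda>x. if x = 1 then 1 else 0)"
  "zero skew = 0" "add skew = (+)" "smult skew = (\<lambda>c f x. pm_scale c (f x))"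
  by (auto simp: skew_group_alg_def fun_eq_iff skew_mult_def finsum_tensor_alg sum_pairs_factor[of
      "\<lambda>g h. f g * perm_act g (f' h)" for f f'])

lemma skew_mult_distrib: "skew_mult (f + f') h = skew_mult f h + skew_mult f' h"
    "skew_mult h (f + f') = skew_mult h f + skew_mult h f'"
  by (auto simp: fun_eq_iff skew_mult_def algebra_simps perm_act_add sum.distrib)

lemma perm_sum_shift: "(\<Sum>x\<in>UNIV. \<phi> x) = (\<Sum>x\<in>UNIV. \<phi> (g * x))" for g :: "'n::finite perm"
  by (rule sum.reindex_bij_witness[of _ "\<lambda>x. g * x" "\<lambda>x. inverse g * x"]) auto

lemma skew_mult_assoc: "skew_mult (skew_mult f f') f'' = skew_mult f (skew_mult f' f'')"
  for f :: "'n::finite perm \<Rightarrow> 'n list \<Rightarrow>\<^sub>0 complex"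
proof
  fix x
  have "skew_mult (skew_mult f f') f'' x = (\<Sum>g\<in>UNIV. \<Sum>a\<in>UNIV. f a * perm_act a (f' (inverse a * g)) *
      perm_act g (f'' (inverse g * x)))"
    by (simp add: skew_mult_def sum_distrib_right)
  also have "\<dots> = (\<Sum>a\<in>UNIV. \<Sum>g\<in>UNIV. f a * perm_act a (f' (inverse a * g)) * perm_act g (f'' (inverse g * x)))"
    by (rule sum.swap)
  also have "\<dots> = (\<Sum>a\<in>UNIV. \<Sum>b\<in>UNIV. f a * perm_act a (f' b * perm_act b (f'' (inverse b * (inverse a * x)))))"
  proof (rule sum.cong[OF refl])
    fix a :: "'n perm"
    show "(\<Sum>g\<in>UNIV. f a * perm_act a (f' (inverse a * g)) * perm_act g (f'' (inverse g * x))) =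
      (\<Sum>b\<in>UNIV. f a * perm_act a (f' b * perm_act b (f'' (inverse b * (inverse a * x)))))"
      by (subst perm_sum_shift[of _ a]) (simp add: perm_act_mult perm_act_perm_act mult.assoc)
  qed
  also have "\<dots> = skew_mult f (skew_mult f' f'') x"
    by (simp add: skew_mult_def sum_distrib_left perm_act_sum)
  finally show "skew_mult (skew_mult f f') f'' x = skew_mult f (skew_mult f' f'') x" .
qed

lemma skew_mult_in_skew: "skew_mult (tensor_in_skew p) f = (\<lambda>x. p * f x)" for f :: "'n::finite perm \<Rightarrow> _"
proof
  fix x
  have "skew_mult (tensor_in_skew p) f x = (\<Sum>g\<in>(UNIV :: 'n perm set). if g = 1 then p * f x else 0)"
    unfolding skew_mult_def by (rule sum.cong) (auto simp: tensor_in_skew_def)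
  then show "skew_mult (tensor_in_skew p) f x = p * f x" by (simp add: finite_perms)
qed

lemma skew_mult_right_in_skew: "skew_mult f (tensor_in_skew p) = (\<lambda>x. f x * perm_act x p)" for f ::
    "'n::finite perm \<Rightarrow> _"
proof
  fix x
  have "inverse g * x = 1 \<longleftrightarrow> g = x" for g :: "'n perm"
  proof
    assume "inverse g * x = 1"
    then have "g * (inverse g * x) = g" by simp
    then show "g = x" by simp
  qed simp
  then have "skew_mult f (tensor_in_skew p) x = (\<Sum>g\<in>UNIV. if g = x then f x * perm_act x p else 0)"
    unfolding skew_mult_def by (intro sum.cong) (auto simp: tensor_in_skew_def)
  then show "skew_mult f (tensor_in_skew p) x = f x * perm_act x p" by (simp add: finite_perms)
qed

lemma skew_one: "(\<lambda>x. if x = 1 then 1 else 0) = tensor_in_skew 1"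
  by (simp add: tensor_in_skew_def fun_eq_iff)

text \<open>
  Associativity is the reindexing of the sum over factorisations of a group element, as the group
  acts by algebra automorphisms.
\<close>

lemma skew_ring: "ring (skew :: (complex, 'n::finite perm \<Rightarrow> 'n list \<Rightarrow>\<^sub>0 complex) module)"
proof (rule ringI)
  show "abelian_group (skew :: (complex, 'n perm \<Rightarrow> 'n list \<Rightarrow>\<^sub>0 complex) module)"
    by (rule abelian_groupI) (auto simp: add.assoc add.commute intro: exI[of _ "- x" for x])
  have "perm_act x 1 = 1" for x :: "'n perm" by (simp add: zero_list_def flip: single_one)
  then show "Group.monoid (skew :: (complex, 'n perm \<Rightarrow> 'n list \<Rightarrow>\<^sub>0 complex) module)"
    by (intro Group.monoid.intro) (simp_all add: skew_mult_assoc skew_one skew_mult_in_skew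
        skew_mult_right_in_skew)
qed (auto simp: skew_mult_distrib)

definition sign_q :: "'n \<Rightarrow> 'n \<Rightarrow> complex" where "sign_q i j = (if i = j then 1 else - 1)"

lemma sq_ideal_ideal: "ideal (sq_ideal q) tensor_alg"
  unfolding sq_ideal_def by (rule ring.genideal_ideal[OF tensor_alg_ring]) simp

lemma ideal_neg:
  fixes R :: "('a::ab_group_add, 'm) ring_scheme"
  assumes "ideal I R" "add R = (+)" "zero R = 0" "carrier R = UNIV" "p \<in> I" shows "- p \<in> I"
proof -
  interpret ideal I R by fact
  have "- p = \<ominus>\<^bsub>R\<^esub> p" using assms by (intro minus_equality[symmetric]) auto
  then show ?thesis using a_inv_closed assms(5) by simp
qed

lemma sq_ideal_closed:
  "0 \<in> sq_ideal q" "p \<in> sq_ideal q \<Longrightarrow> p' \<in> sq_ideal q \<Longrightarrow> p + p' \<in> sq_ideal q"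
  "p \<in> sq_ideal q \<Longrightarrow> s * p \<in> sq_ideal q" "p \<in> sq_ideal q \<Longrightarrow> p * s \<in> sq_ideal q"
  "p \<in> sq_ideal q \<Longrightarrow> - p \<in> sq_ideal q" "q_commutator q i j \<in> sq_ideal q"
  "p \<in> sq_ideal q \<Longrightarrow> pm_scale c p \<in> sq_ideal q"
  "p \<in> sq_ideal q \<Longrightarrow> p' \<in> sq_ideal q \<Longrightarrow> p - p' \<in> sq_ideal q"
proof -
  interpret ideal "sq_ideal q" tensor_alg by (rule sq_ideal_ideal)
  show "0 \<in> sq_ideal q" using additive_subgroup.zero_closed[OF is_additive_subgroup] by simp
  show add: "p \<in> sq_ideal q \<Longrightarrow> p' \<in> sq_ideal q \<Longrightarrow> p + p' \<in> sq_ideal q" for p p'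
      using additive_subgroup.a_closed[OF is_additive_subgroup, of p p'] by simp
  show left: "p \<in> sq_ideal q \<Longrightarrow> s * p \<in> sq_ideal q" for p s using I_l_closed[of p s] by simp
  show "p \<in> sq_ideal q \<Longrightarrow> p * s \<in> sq_ideal q" using I_r_closed[of p s] by simp
  show "q_commutator q i j \<in> sq_ideal q"
    unfolding sq_ideal_def by (rule subsetD[OF ring.genideal_self[OF tensor_alg_ring]]) auto
  show "p \<in> sq_ideal q \<Longrightarrow> pm_scale c p \<in> sq_ideal q" by (simp add: pm_scale_eq_mult left)
  show neg: "p \<in> sq_ideal q \<Longrightarrow> - p \<in> sq_ideal q" for p
    by (rule ideal_neg[OF sq_ideal_ideal]) auto
  show "p \<in> sq_ideal q \<Longrightarrow> p' \<in> sq_ideal q \<Longrightarrow> p - p' \<in> sq_ideal q"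
    using add[of p "- p'"] neg by simp
qed

lemma sq_ideal_sum: "(\<And>x. x \<in> S \<Longrightarrow> f x \<in> sq_ideal q) \<Longrightarrow> sum f S \<in> sq_ideal q"
  by (induction S rule: infinite_finite_induct) (auto simp: sq_ideal_closed)

lemma sq_ideal_lin: "(\<And>x. x \<in> supp p \<Longrightarrow> f x \<in> sq_ideal q) \<Longrightarrow> lin f p \<in> sq_ideal q"
  unfolding lin_def by (intro sq_ideal_sum sq_ideal_closed)

lemma sq_ideal_minimal:
  assumes "\<And>i j. P (q_commutator q i j)" "P 0" "\<And>p p'. P p \<Longrightarrow> P p' \<Longrightarrow> P (p + p')"
    "\<And>p. P p \<Longrightarrow> P (- p)" "\<And>s p. P p \<Longrightarrow> P (s * p)" "\<And>s p. P p \<Longrightarrow> P (p * s)"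
    and "p \<in> sq_ideal q"
  shows "P p"
proof -
  have "ideal {p. P p} tensor_alg"
  proof (intro idealI[OF tensor_alg_ring] subgroup.intro)
    fix x assume "x \<in> {p. P p}"
    moreover have "inv\<^bsub>add_monoid tensor_alg\<^esub> x = - x"
      by (rule comm_monoid.comm_inv_char) (use tensor_alg_ring[THEN ring.is_abelian_group] in \<open>auto simp:
          abelian_group_def abelian_monoid_def\<close>)
    ultimately show "inv\<^bsub>add_monoid tensor_alg\<^esub> x \<in> {p. P p}" using assms by simp
  qed (use assms in auto)
  then have "sq_ideal q \<subseteq> {p. P p}" unfolding sq_ideal_def
    by (rule ring.genideal_minimal[OF tensor_alg_ring]) (use assms(1) in auto)
  then show ?thesis using assms(7) by blast
qed

definition rel_ideal :: "('n::finite \<Rightarrow> 'n \<Rightarrow> 'n perm \<Rightarrow>\<^sub>0 complex) \<Rightarrow> ('n perm \<Rightarrow> 'n list \<Rightarrow>\<^sub>0 complex) set"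
  where "rel_ideal K = Idl\<^bsub>skew\<^esub> {tensor_in_skew (q_commutator sign_q i j)
      - group_alg_in_skew (K i j) | i j. True}"

lemma rel_ideal_ideal: "ideal (rel_ideal K) skew"
  unfolding rel_ideal_def by (rule ring.genideal_ideal[OF skew_ring]) simp

lemma rel_ideal_closed:
  "0 \<in> rel_ideal K" "p \<in> rel_ideal K \<Longrightarrow> p' \<in> rel_ideal K \<Longrightarrow> p + p' \<in> rel_ideal K"
  "p \<in> rel_ideal K \<Longrightarrow> skew_mult s p \<in> rel_ideal K" "p \<in> rel_ideal K \<Longrightarrow> skew_mult p s \<in> rel_ideal K"
  "p \<in> rel_ideal K \<Longrightarrow> - p \<in> rel_ideal K" "tensor_in_skew (q_commutator sign_q i j)
      - group_alg_in_skew (K i j) \<in> rel_ideal K"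
  "p \<in> rel_ideal K \<Longrightarrow> p' \<in> rel_ideal K \<Longrightarrow> p - p' \<in> rel_ideal K"
proof -
  interpret ideal "rel_ideal K" skew by (rule rel_ideal_ideal)
  show "0 \<in> rel_ideal K" using additive_subgroup.zero_closed[OF is_additive_subgroup] by simp
  show add: "p \<in> rel_ideal K \<Longrightarrow> p' \<in> rel_ideal K \<Longrightarrow> p + p' \<in> rel_ideal K" for p p'
      using additive_subgroup.a_closed[OF is_additive_subgroup, of p p'] by simp
  show left: "p \<in> rel_ideal K \<Longrightarrow> skew_mult s p \<in> rel_ideal K" for p s using I_l_closed[of p s] by simp
  show "p \<in> rel_ideal K \<Longrightarrow> skew_mult p s \<in> rel_ideal K" using I_r_closed[of p s] by simp
  show "tensor_in_skew (q_commutator sign_q i j) - group_alg_in_skew (K i j) \<in> rel_ideal K"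
    unfolding rel_ideal_def by (rule subsetD[OF ring.genideal_self[OF skew_ring]]) auto
  show neg: "p \<in> rel_ideal K \<Longrightarrow> - p \<in> rel_ideal K" for p
    by (rule ideal_neg[OF rel_ideal_ideal]) auto
  show "p \<in> rel_ideal K \<Longrightarrow> p' \<in> rel_ideal K \<Longrightarrow> p - p' \<in> rel_ideal K"
    using add[of p "- p'"] neg by simp
qed

lemma rel_ideal_minimal:
  assumes "\<And>i j. P (tensor_in_skew (q_commutator sign_q i j) - group_alg_in_skew (K i j))" "P 0"
      "\<And>p p'. P p \<Longrightarrow> P p' \<Longrightarrow> P (p + p')"
    "\<And>p. P p \<Longrightarrow> P (- p)" "\<And>s p. P p \<Longrightarrow> P (skew_mult s p)" "\<And>s p. P p \<Longrightarrow> P (skew_mult p s)"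
    and "p \<in> rel_ideal K"
  shows "P p"
proof -
  have "ideal {p. P p} skew"
  proof (intro idealI[OF skew_ring] subgroup.intro)
    fix x assume "x \<in> {p. P p}"
    moreover have "inv\<^bsub>add_monoid skew\<^esub> x = - x"
      by (rule comm_monoid.comm_inv_char) (use skew_ring[THEN ring.is_abelian_group] in \<open>auto simp:
          abelian_group_def abelian_monoid_def\<close>)
    ultimately show "inv\<^bsub>add_monoid skew\<^esub> x \<in> {p. P p}" using assms by simp
  qed (use assms in auto)
  then have "rel_ideal K \<subseteq> {p. P p}" unfolding rel_ideal_def
    by (rule ring.genideal_minimal[OF skew_ring]) (use assms(1) in auto)
  then show ?thesis using assms(7) by blast
qed

lemma perm_act_q_commutator: "perm_act g (q_commutator sign_q i j) = q_commutator sign_q (ap g i) (ap g j)"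
  by (simp add: q_commutator_def perm_act_diff perm_act_mult perm_act_scale perm_act_tgen sign_q_def apply_inj)

text \<open>
  The defining relations are permuted, as \<open>sign_q\<close> depends only on whether the indices are equal.
\<close>

lemma perm_act_sq_ideal: "p \<in> sq_ideal sign_q \<Longrightarrow> perm_act g p \<in> sq_ideal sign_q"
  by (rule sq_ideal_minimal[where P = "\<lambda>p. perm_act g p \<in> sq_ideal sign_q"])
    (auto simp: perm_act_q_commutator sq_ideal_closed perm_act_add perm_act_mult perm_act_uminus)

section \<open>A representation that kills the relations\<close>

definition tensor_below :: "nat \<Rightarrow> ('n list \<Rightarrow>\<^sub>0 complex) set"
  where "tensor_below m = {p. \<forall>w\<in>supp p. length w < m}"

text \<open>
  The normal form in \<open>S\<^sub>q(V)\<close>: the letters of a word are put in place one after the other, from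
  the last to the first.
\<close>

definition normal_form :: "('n::finite list \<Rightarrow>\<^sub>0 complex) \<Rightarrow> ('n list \<Rightarrow>\<^sub>0 complex)"
  where "normal_form = lin (\<lambda>w. foldr (\<lambda>i. lin (leading i)) w (mon [] 1))"

lemma word_Cons: "mon (i # w) c = tgen i * mon w c"
  by (simp add: tgen_def mult_single plus_list_def)

lemma leading_cong_mult: "leading k a - mon (k # a) 1 \<in> sq_ideal sign_q"
proof (induction a)
  case Nil then show ?case by (simp add: tgen_def sq_ideal_closed)
next
  case (Cons m a)
  show ?case
  proof (cases "index_le k m")
    case True then show ?thesis by (simp add: sq_ideal_closed)
  next
    case False
    then have "leading k (m # a) - mon (k # m # a) 1 =
      - (tgen m * (leading k a - mon (k # a) 1)) - q_commutator sign_q m k * mon a 1"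
      by (auto simp: q_commutator_def sign_q_def word_Cons pm_scale_uminus algebra_simps)
    then show ?thesis using Cons by (simp add: sq_ideal_closed)
  qed
qed

text \<open>
  Each step of the straightening exchanges neighbouring letters by a relation of \<open>S\<^sub>q(V)\<close>.
\<close>

lemma normal_form_cong: "normal_form s - s \<in> sq_ideal sign_q"
proof -
  have front: "lin (leading i) p - tgen i * p \<in> sq_ideal sign_q" for i :: 'a and p
  proof -
    have "tgen i * p = lin (\<lambda>a. mon (i # a) 1) p"
      by (simp add: word_Cons lin_id flip: lin_times_right)
    then show ?thesis
      by (simp add: sq_ideal_lin leading_cong_mult flip: lin_fun_diff)
  qed
  have "foldr (\<lambda>i. lin (leading i)) w (mon [] 1) - mon w 1 \<in> sq_ideal sign_q" for w :: "'a list"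
  proof (induction w)
    case (Cons i w)
    let ?p = "foldr (\<lambda>i. lin (leading i)) w (mon [] 1)"
    have "(lin (leading i) ?p - tgen i * ?p) + tgen i * (?p - mon w 1) \<in> sq_ideal sign_q"
      by (intro sq_ideal_closed front Cons)
    then show ?case by (simp add: word_Cons algebra_simps)
  qed (simp add: sq_ideal_closed)
  then have "lin (\<lambda>w. foldr (\<lambda>i. lin (leading i)) w (mon [] 1) - mon w 1) s \<in> sq_ideal sign_q"
    by (intro sq_ideal_lin)
  then show ?thesis by (simp add: normal_form_def lin_fun_diff lin_id)
qed

lemma keys_foldr_leading: "c \<in> supp (foldr (\<lambda>i. lin (leading i)) w (mon [] 1)) \<Longrightarrow> length c = length w \<and>
    index_sorted c"
proof (induction w arbitrary: c)
  case (Cons i w)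
  from Cons.prems obtain d where "d \<in> supp (foldr (\<lambda>i. lin (leading i)) w (mon [] 1))" "c \<in> supp (leading i d)"
    using keys_lin[of "leading i"] by fastforce
  with Cons.IH[of d] keys_leading[of c i d] show ?case by auto
qed simp

lemma keys_normal_form: "s \<in> tensor_comp m \<Longrightarrow> c \<in> supp (normal_form s) \<Longrightarrow> length c = m"
  unfolding normal_form_def tensor_comp_def using keys_lin keys_foldr_leading by fastforce

context hecke_coeffs
begin

definition word_act :: "'n list \<Rightarrow> 'n pbw \<Rightarrow> 'n pbw" where "word_act w p = foldr gen_act w p"

definition tensor_rep :: "('n list \<Rightarrow>\<^sub>0 complex) \<Rightarrow> 'n pbw \<Rightarrow> 'n pbw" where
    "tensor_rep s p = lin (\<lambda>w. word_act w p) s"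

definition skew_rep :: "('n perm \<Rightarrow> 'n list \<Rightarrow>\<^sub>0 complex) \<Rightarrow> 'n pbw \<Rightarrow> 'n pbw"
  where "skew_rep f p = (\<Sum>g\<in>UNIV. tensor_rep (f g) (perm_mult g p))"

lemma word_act_lin: "word_act w (lin \<phi> p) = lin (\<lambda>x. word_act w (\<phi> x)) p"
  unfolding word_act_def by (induction w arbitrary: \<phi>) (simp_all add: gen_act_lin)

lemma word_act_append: "word_act (w @ u) p = word_act w (word_act u p)"
  by (simp add: word_act_def)

lemma tensor_rep_add: "tensor_rep (s + t) p = tensor_rep s p + tensor_rep t p" by (simp add:
    tensor_rep_def lin_add)

lemma tensor_rep_diff: "tensor_rep (s - t) p = tensor_rep s p - tensor_rep t p" by (simp add:
    tensor_rep_def lin_diff)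

lemma tensor_rep_zero: "tensor_rep 0 p = 0" by (simp add: tensor_rep_def)

lemma tensor_rep_sum: "tensor_rep (sum f S) p = (\<Sum>x\<in>S. tensor_rep (f x) p)" by (simp add:
    tensor_rep_def lin_sum)

lemma tensor_rep_single: "tensor_rep (mon w c) p = pm_scale c (word_act w p)" by (simp add: tensor_rep_def)

lemma tensor_rep_scale: "tensor_rep (pm_scale c s) p = pm_scale c (tensor_rep s p)" by (simp add:
    tensor_rep_def lin_scale)

lemma tensor_rep_lin: "tensor_rep s (lin \<phi> p) = lin (\<lambda>x. tensor_rep s (\<phi> x)) p"
  unfolding tensor_rep_def word_act_lin by (rule lin_swap)

lemma tensor_rep_add_right: "tensor_rep s (p + p') = tensor_rep s p + tensor_rep s p'"
  using tensor_rep_lin[of s "\<lambda>x. if x then p else p'" "mon True 1 + mon False 1"]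
  by (simp add: lin_add)

lemma tensor_rep_zero_right: "tensor_rep s 0 = 0"
  using tensor_rep_lin[of s "\<lambda>x. 0" 0] by simp

lemma tensor_rep_sum_right: "tensor_rep s (sum f S) = (\<Sum>x\<in>S. tensor_rep s (f x))"
  by (induction S rule: infinite_finite_induct) (simp_all add: tensor_rep_zero_right tensor_rep_add_right)

lemma tensor_rep_mult: "tensor_rep (s * t) p = tensor_rep s (tensor_rep t p)"
proof (induction s rule: pm_induct[OF subset_UNIV])
  case (2 w c)
  show ?case
  proof (induction t rule: pm_induct[OF subset_UNIV])
    case (2 u d)
    have "word_act w (pm_scale d (word_act u p)) = pm_scale d (word_act w (word_act u p))"
      using word_act_lin[of w "\<lambda>x. word_act u p" "mon () d"] by simp
    then show ?case
      by (simp add: mult_single tensor_rep_single plus_list_def word_act_append)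
  qed (simp_all add: tensor_rep_zero tensor_rep_zero_right distrib_left tensor_rep_add tensor_rep_add_right)
qed (simp_all add: tensor_rep_zero distrib_right tensor_rep_add)

lemma word_act_perm_mult: "word_act (map (ap g) w) (perm_mult g p) = perm_mult g (word_act w p)"
  unfolding word_act_def by (induction w) (simp_all add: gen_act_perm_mult)

lemma tensor_rep_perm_act: "tensor_rep (perm_act g t) (perm_mult g p) = perm_mult g (tensor_rep t p)"
  by (simp add: tensor_rep_def perm_act_def lin_lin perm_mult_lin word_act_perm_mult)

text \<open>
  The action is multiplicative because moving \<open>g\<close> past \<open>v\<^sub>i\<close> changes the index in the module as
  in the skew group algebra (\<open>gen_act_perm_mult\<close>).
\<close>

lemma skew_rep_mult: "skew_rep (skew_mult f f') p = skew_rep f (skew_rep f' p)"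
proof -
  have "skew_rep (skew_mult f f') p = (\<Sum>x\<in>UNIV. \<Sum>g\<in>UNIV. tensor_rep (f g) (tensor_rep (perm_act g (f'
      (inverse g * x))) (perm_mult x p)))"
    by (simp add: skew_rep_def skew_mult_def tensor_rep_sum tensor_rep_mult)
  also have "\<dots> = (\<Sum>g\<in>UNIV. \<Sum>x\<in>UNIV. tensor_rep (f g) (tensor_rep (perm_act g (f' (inverse g * x)))
      (perm_mult x p)))"
    by (rule sum.swap)
  also have "\<dots> = (\<Sum>g\<in>UNIV. \<Sum>h\<in>UNIV. tensor_rep (f g) (perm_mult g (tensor_rep (f' h) (perm_mult h p))))"
  proof (rule sum.cong[OF refl])
    fix g :: "'n perm"
    show "(\<Sum>x\<in>UNIV. tensor_rep (f g) (tensor_rep (perm_act g (f' (inverse g * x))) (perm_mult x p))) =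
      (\<Sum>h\<in>UNIV. tensor_rep (f g) (perm_mult g (tensor_rep (f' h) (perm_mult h p))))"
      by (subst perm_sum_shift[of _ g]) (simp add: perm_mult_mult tensor_rep_perm_act)
  qed
  also have "\<dots> = skew_rep f (skew_rep f' p)"
    by (simp add: skew_rep_def tensor_rep_sum_right perm_mult_def lin_sum)
  finally show ?thesis .
qed

lemma skew_rep_add: "skew_rep (f + f') p = skew_rep f p + skew_rep f' p"
  by (simp add: skew_rep_def tensor_rep_add sum.distrib)

lemma skew_rep_uminus: "skew_rep (- f) p = - skew_rep f p"
  by (simp add: skew_rep_def tensor_rep_def lin_uminus sum_negf)

lemma word_act_sorted_below: "p \<in> sorted_below d \<Longrightarrow> word_act w p \<in> sorted_below (length w + d)"
  unfolding word_act_def by (induction w) (auto intro: gen_act_sorted_below)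

lemma tensor_rep_sorted_below:
  assumes "p \<in> sorted_below d" "\<And>w. w \<in> supp s \<Longrightarrow> length w \<le> n"
  shows "tensor_rep s p \<in> sorted_below (n + d)"
  unfolding tensor_rep_def by (intro sorted_below_closed(7) sorted_below_mono[OF word_act_sorted_below[OF
      assms(1)]]) (use assms(2) in auto)

lemma skew_rep_sorted_below: "p \<in> sorted_below d \<Longrightarrow> \<exists>e. skew_rep f p \<in> sorted_below e"
proof -
  assume p: "p \<in> sorted_below d"
  let ?n = "Max (insert 0 (length ` (\<Union>g\<in>UNIV. supp (f g))))"
  have "skew_rep f p \<in> sorted_below (?n + d)" unfolding skew_rep_def
    by (intro sorted_below_closed(6) tensor_rep_sorted_below sorted_below_closed(5) p Max_ge) (auto simp:
        finite_perms)
  then show ?thesis by blast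
qed

text \<open>
  The terms of \<open>lower\<close> have lower degree, so only the recursion of the normal form in \<open>S\<^sub>q(V)\<close>
  survives in the highest degree.
\<close>

lemma word_act_symbol: "word_act w (pbw_basis 1 []) - embed (foldr (\<lambda>i. lin (leading i)) w (mon [] 1)) \<in>
    sorted_below (length w)"
proof (induction w)
  case (Cons i w)
  let ?c = "foldr (\<lambda>i. lin (leading i)) w (mon [] 1)" and ?v = "word_act w (pbw_basis 1 [])"
  have "gen_act i (embed ?c) = embed (lin (leading i) ?c) + lin (lower i) ?c"
    by (simp add: embed_def gen_act_lin gen_act_pbw_basis gen_word_def lin_lin perm.inverse_neutral lin_fun_add)
  then have "word_act (i # w) (pbw_basis 1 []) - embed (lin (leading i) ?c) = gen_act i (?v - embed ?c)
      + lin (lower i) ?c"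
    by (simp add: gen_act_diff word_act_def)
  moreover have "lin (lower i) ?c \<in> sorted_below (length (i # w))"
    by (intro sorted_below_closed(7) sorted_below_mono[OF lower_sorted_below]) (auto dest: keys_foldr_leading)
  ultimately show ?case using gen_act_sorted_below[OF Cons, of i] by (simp add: sorted_below_closed)
qed (simp add: word_act_def embed_def sorted_below_closed)

lemma tensor_rep_symbol:
  assumes "s \<in> tensor_comp m" shows "tensor_rep s (pbw_basis 1 []) - embed (normal_form s) \<in> sorted_below m"
proof -
  have "tensor_rep s (pbw_basis 1 []) - embed (normal_form s) = lin (\<lambda>w. word_act w (pbw_basis 1 [])
      - embed (foldr (\<lambda>i. lin (leading i)) w (mon [] 1))) s"
    by (simp add: tensor_rep_def normal_form_def embed_def lin_lin lin_fun_diff)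
  also have "\<dots> \<in> sorted_below m"
    by (rule sorted_below_closed(7)) (use assms word_act_symbol in \<open>fastforce simp: tensor_comp_def\<close>)
  finally show ?thesis .
qed

lemma lookup_embed: "coef (embed p) (g, a) = (if g = 1 then coef p a else 0)"
  by (induction p rule: pm_induct[OF subset_UNIV])
    (auto simp: embed_def lin_add lookup_add lookup_single when_def)

lemma lookup_perm_mult: "coef (perm_mult h p) (g, a) = coef p (inverse h * g, a)"
proof (induction p rule: pm_induct[OF subset_UNIV])
  case (2 k c)
  obtain g' b where k: "k = (g', b)" by (cases k)
  have "h * g' = g \<longleftrightarrow> g' = inverse h * g" by auto
  then show ?case by (auto simp: k lookup_single when_def)
qed (auto simp: perm_mult_add lookup_add, simp add: perm_mult_def)
end

context pbw_coeffs
begin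

text \<open>
  The elements that act as zero form an ideal, and it contains the relations by
  \<open>gen_act_relation\<close>.
\<close>

lemma skew_rep_rel_ideal:
  assumes "f \<in> rel_ideal K" "p \<in> sorted_below d" shows "skew_rep f p = 0"
proof -
  have "\<forall>d. \<forall>p\<in>sorted_below d. skew_rep f p = 0"
    using assms(1)
  proof (rule rel_ideal_minimal[where P = "\<lambda>f. \<forall>d. \<forall>p\<in>sorted_below d. skew_rep f p = 0", rotated -1])
    fix i j
    have gen: "skew_rep (tensor_in_skew (q_commutator sign_q i j) - group_alg_in_skew (K i j)) p =
        (gen_act i (gen_act j p) - pm_scale (sign_q i j) (gen_act j (gen_act i p))) - coeff_mult i j p" for p
    proof -
      have "tensor_rep (tensor_in_skew s g - group_alg_in_skew r g) (perm_mult g p) =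
        (if g = 1 then tensor_rep s p else 0) - pm_scale (coef r g) (perm_mult g p)" for s r and g :: "'n perm"
        by (auto simp: tensor_in_skew_def group_alg_in_skew_def tensor_rep_diff tensor_rep_zero
            tensor_rep_single word_act_def)
      then have "skew_rep (tensor_in_skew s - group_alg_in_skew r) p = tensor_rep s p
          - lin (\<lambda>g. perm_mult g p) r" for s r
        by (simp add: skew_rep_def sum_subtractf finite_perms lin_UNIV)
      then show ?thesis
        by (simp add: q_commutator_def tensor_rep_diff tensor_rep_scale tensor_rep_mult coeff_mult_def)
            (simp add: tgen_def tensor_rep_single word_act_def)
    qed
    show "\<forall>d. \<forall>p\<in>sorted_below d. skew_rep (tensor_in_skew (q_commutator sign_q i j)
        - group_alg_in_skew (K i j)) p = 0"
      unfolding gen using gen_act_relation[of _ _ i j] diag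
      by (auto simp: sign_q_def pm_scale_uminus coeff_mult_def)
  next
    show "\<forall>d. \<forall>p\<in>sorted_below d. skew_rep 0 p = 0" by (simp add: skew_rep_def tensor_rep_zero)
  next
    fix f s assume "\<forall>d. \<forall>p\<in>sorted_below d. skew_rep f p = 0"
    then show "\<forall>d. \<forall>p\<in>sorted_below d. skew_rep (skew_mult s f) p = 0"
        "\<forall>d. \<forall>p\<in>sorted_below d. skew_rep (skew_mult f s) p = 0"
      using skew_rep_sorted_below[of _ _ s]
      by (auto simp: skew_rep_mult) (simp add: skew_rep_def tensor_rep_zero_right perm_mult_def, metis)
  qed (simp_all add: skew_rep_add skew_rep_uminus)
  then show ?thesis using assms by blast
qed

text \<open>
  Apply the action of \<open>f + t\<close>, which is zero, to 1. In degree \<open>m\<close> the result is the sum of the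
  \<open>g\<close> times the normal forms of \<open>g\<^sup>-\<^sup>1\<close> applied to \<open>f g\<close>, and the terms for different \<open>g\<close> have
  different keys, so all of these normal forms vanish.
\<close>

theorem rel_ideal_leading_term:
  assumes "\<And>g. f g \<in> tensor_comp m" "\<And>g. t g \<in> tensor_below m" "f + t \<in> rel_ideal K"
  shows "f g \<in> sq_ideal sign_q"
proof -
  have b: "pbw_basis 1 [] \<in> sorted_below 1" by (simp add: sorted_below_def)
  let ?f = "\<lambda>g. perm_act (inverse g) (f g)"
  have len: "?f h \<in> tensor_comp m" for h
    using assms(1)[of h] keys_perm_act[of "inverse h" "f h"] by (auto simp: tensor_comp_def)
  have *: "tensor_rep s (pbw_basis h []) = perm_mult h (tensor_rep (perm_act (inverse h) s) (pbw_basis 1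
      []))" for s h
    using tensor_rep_perm_act[of h "perm_act (inverse h) s" "pbw_basis 1 []"] by simp
  have "skew_rep (f + t) (pbw_basis 1 []) = 0" by (rule skew_rep_rel_ideal[OF assms(3) b])
  then have "0 = (\<Sum>h\<in>UNIV. perm_mult h (tensor_rep (?f h) (pbw_basis 1 [])))
      + (\<Sum>h\<in>UNIV. tensor_rep (t h) (pbw_basis h []))"
    unfolding skew_rep_add by (simp add: skew_rep_def *[of "f h" h for h])
  also have "(\<Sum>h\<in>UNIV. perm_mult h (tensor_rep (?f h) (pbw_basis 1 []))) =
      (\<Sum>h\<in>UNIV. perm_mult h (tensor_rep (?f h) (pbw_basis 1 []) - embed (normal_form (?f h))))
      + (\<Sum>h\<in>UNIV. perm_mult h (embed (normal_form (?f h))))"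
    by (simp add: perm_mult_diff sum_subtractf)
  finally have "- (\<Sum>h\<in>UNIV. perm_mult h (embed (normal_form (?f h)))) =
      (\<Sum>h\<in>UNIV. perm_mult h (tensor_rep (?f h) (pbw_basis 1 []) - embed (normal_form (?f h))))
      + (\<Sum>h\<in>UNIV. tensor_rep (t h) (pbw_basis h []))"
    by (simp add: minus_unique algebra_simps)
  moreover have "tensor_rep (t h) (pbw_basis h []) \<in> sorted_below m" for h
  proof (cases "m = 0")
    case True
    then have "t h = 0" using assms(2)[of h] by (auto simp: tensor_below_def intro: poly_mapping_eqI simp:
        in_keys_iff)
    then show ?thesis by (simp add: tensor_rep_zero sorted_below_closed)
  next
    case False
    have "tensor_rep (t h) (pbw_basis h []) \<in> sorted_below ((m - 1) + 1)"
      by (rule tensor_rep_sorted_below) (use assms(2)[of h] in \<open>auto simp: tensor_below_def sorted_below_def\<close>)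
    then show ?thesis using False by simp
  qed
  ultimately have low: "- (\<Sum>h\<in>UNIV. perm_mult h (embed (normal_form (?f h)))) \<in> sorted_below m"
    by (auto intro!: sorted_below_closed tensor_rep_symbol[OF len])
  have "coef (normal_form (?f g)) a = 0" for a
  proof (cases "length a = m")
    case True
    have "coef (\<Sum>h\<in>UNIV. perm_mult h (embed (normal_form (?f h)))) (g, a) = 
       (\<Sum>h\<in>UNIV. if h = g then coef (normal_form (?f g)) a else 0)"
    proof -
      have "inverse h * g = 1 \<longleftrightarrow> h = g" for h
      proof
        assume "inverse h * g = 1"
        then have "h * (inverse h * g) = h" by simp
        then show "h = g" by simp
      qed simp
      then show ?thesis
        unfolding lookup_sum lookup_perm_mult lookup_embed by (intro sum.cong) auto
    qed
    moreover have "(g, a) \<notin> supp (- (\<Sum>h\<in>UNIV. perm_mult h (embed (normal_form (?f h)))))"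
      using low True by (auto simp: sorted_below_def)
    ultimately show ?thesis by (simp add: in_keys_iff finite_perms)
  next
    case False
    then show ?thesis using keys_normal_form[OF len, of a g] by (auto simp: in_keys_iff)
  qed
  then have "normal_form (?f g) = 0" by (simp add: poly_mapping_eqI)
  then have "?f g \<in> sq_ideal sign_q" using normal_form_cong[of "?f g"] sq_ideal_closed(5)[of "- ?f g"] by simp
  from perm_act_sq_ideal[OF this, of g] show ?thesis by simp
qed
end

section \<open>Quotients of graded algebras and their associated graded algebras\<close>

lemma UN_const: "S \<noteq> {} \<Longrightarrow> (\<And>a. a \<in> S \<Longrightarrow> f a = D) \<Longrightarrow> (\<Union>a\<in>S. f a) = D"
  by auto

text \<open>
  Algebras whose carrier is a whole type with its own addition, such as the tensor algebra and
  its skew group algebra. The last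
  assumption makes ideals invariant under scalars.
\<close>

locale full_ring = ring R for R :: "(complex, 'a::ab_group_add) module" +
  assumes carrier_R [simp]: "carrier R = UNIV" and add_R [simp]: "add R = (+)" and zero_R [simp]: "zero R = 0"
    and smult_R: "smult R c x = smult R c (one R) \<otimes>\<^bsub>R\<^esub> x"
begin

lemma smult_add: "smult R c (x + y) = smult R c x + smult R c y"
  using r_distr[of x y "smult R c (one R)"] by (simp flip: smult_R)

lemma mult_zero [simp]: "x \<otimes>\<^bsub>R\<^esub> 0 = 0" "0 \<otimes>\<^bsub>R\<^esub> x = 0"
  using r_null[of x] l_null[of x] by simp_all

lemma mult_distrib: "(x + y) \<otimes>\<^bsub>R\<^esub> z = x \<otimes>\<^bsub>R\<^esub> z + y \<otimes>\<^bsub>R\<^esub> z" "z \<otimes>\<^bsub>R\<^esub> (x + y) = z \<otimes>\<^bsub>R\<^esub> x + z \<otimes>\<^bsub>R\<^esub> y"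
  using l_distr[of x y z] r_distr[of x y z] by simp_all

lemma smult_zero [simp]: "smult R c 0 = 0"
  using smult_add[of c 0 0] by simp

lemma smult_minus: "smult R c (- x) = - smult R c x"
  using smult_add[of c x "- x"] by (simp add: eq_neg_iff_add_eq_0 add.commute)

lemma smult_diff: "smult R c (x - y) = smult R c x - smult R c y"
  using smult_add[of c x "- y"] by (simp add: smult_minus)
end

text \<open>
  The ideal is a parameter with an assumption rather than an imported locale, so that several
  ideals can be interpreted side by side.
\<close>

locale full_ring_ideal = full_ring R for R :: "(complex, 'a::ab_group_add) module" +
  fixes I :: "'a set"
  assumes I_ideal: "ideal I R"
begin

abbreviation \<pi> :: "'a \<Rightarrow> 'a set" where "\<pi> x \<equiv> I +>\<^bsub>R\<^esub> x"

abbreviation H where "H \<equiv> quot_alg R I"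

lemma I_closed: "0 \<in> I" "x \<in> I \<Longrightarrow> y \<in> I \<Longrightarrow> x + y \<in> I" "x \<in> I \<Longrightarrow> - x \<in> I" "x \<in> I \<Longrightarrow> y \<in> I \<Longrightarrow> x - y \<in> I"
  "x \<in> I \<Longrightarrow> smult R c x \<in> I"
proof -
  interpret ideal I R by (rule I_ideal)
  show "0 \<in> I" using additive_subgroup.zero_closed[OF is_additive_subgroup] by simp
  show add: "x \<in> I \<Longrightarrow> y \<in> I \<Longrightarrow> x + y \<in> I" for x y
    using additive_subgroup.a_closed[OF is_additive_subgroup, of x y] by simp
  show neg: "x \<in> I \<Longrightarrow> - x \<in> I" for x
    by (rule ideal_neg[OF I_ideal]) auto
  show "x \<in> I \<Longrightarrow> y \<in> I \<Longrightarrow> x - y \<in> I" using add[of x "- y"] neg by simp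
  show "x \<in> I \<Longrightarrow> smult R c x \<in> I" by (subst smult_R) (simp add: I_l_closed)
qed

lemma mem_coset: "y \<in> \<pi> x \<longleftrightarrow> y - x \<in> I"
proof -
  have "y \<in> \<pi> x \<longleftrightarrow> (\<exists>i\<in>I. y = i + x)" by (auto simp: a_r_coset_def r_coset_def)
  then show ?thesis by (metis diff_add_cancel add_diff_cancel)
qed

lemma coset_eq_iff: "\<pi> x = \<pi> y \<longleftrightarrow> x - y \<in> I"
proof
  assume "\<pi> x = \<pi> y"
  moreover have "x \<in> \<pi> x" by (simp add: mem_coset I_closed)
  ultimately show "x - y \<in> I" by (simp add: mem_coset)
next
  assume xy: "x - y \<in> I"
  have "z - x \<in> I \<longleftrightarrow> z - y \<in> I" for z
    using I_closed(2)[OF _ xy, of "z - x"] I_closed(4)[OF _ xy, of "z - y"] by auto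
  then show "\<pi> x = \<pi> y" by (auto simp: mem_coset)
qed

lemma zero_coset: "\<pi> 0 = I" by (auto simp: mem_coset)

lemma quot_carrier: "carrier H = range \<pi>"
  by (auto simp: quot_alg_def FactRing_def A_RCOSETS_def RCOSETS_def a_r_coset_def)

lemma quot_add [simp]: "\<pi> x \<oplus>\<^bsub>H\<^esub> \<pi> y = \<pi> (x + y)"
  using abelian_subgroup.a_rcos_sum[OF abelian_subgroupI3[OF ideal.axioms(1)[OF I_ideal]
      is_abelian_group], of x y] by (simp add: quot_alg_def FactRing_def)

lemma quot_mult [simp]: "\<pi> x \<otimes>\<^bsub>H\<^esub> \<pi> y = \<pi> (x \<otimes>\<^bsub>R\<^esub> y)"
  using ideal.rcoset_mult_add[OF I_ideal, of x y] by (simp add: quot_alg_def FactRing_def)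

lemma quot_one: "one H = \<pi> (one R)" by (simp add: quot_alg_def FactRing_def)

lemma quot_zero: "zero H = \<pi> 0" by (simp add: quot_alg_def FactRing_def zero_coset)

lemma quot_smult [simp]: "smult H c (\<pi> x) = \<pi> (smult R c x)"
proof -
  have "\<pi> (smult R c y) = \<pi> (smult R c x)" if "y \<in> \<pi> x" for y
    using that by (simp add: mem_coset coset_eq_iff I_closed flip: smult_diff)
  moreover have "x \<in> \<pi> x" by (simp add: mem_coset I_closed)
  ultimately have "(\<Union>y\<in>\<pi> x. \<pi> (smult R c y)) = \<pi> (smult R c x)"
    by (intro UN_const) blast+
  then show ?thesis by (simp add: quot_alg_def)
qed

lemma quot_ring: "ring H"
proof (rule ringI)
  show "abelian_group H"
    by (rule abelian_groupI)
      (auto simp: quot_carrier quot_zero algebra_simps, metis add.right_inverse)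
  show "Group.monoid H"
    by (rule Group.monoid.intro) (use m_assoc in \<open>auto simp: quot_carrier quot_one\<close>)
qed (auto simp: quot_carrier mult_distrib)

lemma quot_finsum: "finsum H (\<lambda>i. \<pi> (f i)) S = \<pi> (sum f S)"
proof -
  interpret H: ring H by (rule quot_ring)
  show ?thesis
    by (induction S rule: infinite_finite_induct) (auto simp:
        H.finsum_infinite H.finsum_insert quot_zero quot_carrier)
qed
end

text \<open>
  The grading is given by the projections \<open>P m\<close> to the homogeneous parts. The ideal
  is in general not homogeneous, so that the quotient is only filtered.
\<close>

locale graded_full_ring = full_ring_ideal R I for R :: "(complex, 'a::ab_group_add) module" and I +
  fixes P :: "nat \<Rightarrow> 'a \<Rightarrow> 'a"
  assumes P_add: "P m (x + y) = P m x + P m y"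
    and P_P: "P m (P k x) = (if m = k then P m x else 0)"
    and P_finite: "finite {m. P m x \<noteq> 0}"
    and P_sum: "(\<Sum>m\<in>{m. P m x \<noteq> 0}. P m x) = x"
    and P_mult: "P m (x \<otimes>\<^bsub>R\<^esub> y) = (\<Sum>i\<le>m. P i x \<otimes>\<^bsub>R\<^esub> P (m - i) y)"
    and P_one: "P m (one R) = (if m = 0 then one R else 0)"
    and P_smult: "P m (smult R c x) = smult R c (P m x)"
begin

definition low :: "nat \<Rightarrow> 'a set" where "low m = {x. \<forall>k\<ge>m. P k x = 0}"

text \<open>
  The classes of the filtered algebra: \<open>filt m\<close> is the image of the elements of degree at most
  \<open>m\<close>, and \<open>gr_coset m x\<close> is the class of \<open>x\<close> modulo \<open>filt (m - 1)\<close>, as a set of cosets of the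
  ideal.
\<close>

definition filt :: "nat \<Rightarrow> 'a set set" where "filt m = \<pi> ` low (Suc m)"

definition gr_coset :: "nat \<Rightarrow> 'a \<Rightarrow> 'a set set" where "gr_coset m x = {\<pi> (t + x) | t. t \<in> low m}"

text \<open>
  The map to the associated graded algebra that takes the class of each homogeneous part. It is a
  surjective homomorphism of graded algebras for every ideal (\<open>\<psi>_mult\<close>, \<open>\<psi>_range\<close>); only its
  kernel (\<open>\<psi>_eq_iff\<close>) depends on more than the grading.
\<close>

definition \<psi> :: "'a \<Rightarrow> nat \<Rightarrow> 'a set set" where "\<psi> x m = gr_coset m (P m x)"

abbreviation gr where "gr \<equiv> assoc_graded H filt"

lemma P_zero [simp]: "P m 0 = 0" using P_add[of m 0 0] by simp

lemma P_uminus: "P m (- x) = - P m x"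
  using P_add[of m x "- x"] by (simp add: eq_neg_iff_add_eq_0 add.commute)

lemma P_diff: "P m (x - y) = P m x - P m y"
  using P_add[of m x "- y"] by (simp add: P_uminus)

lemma P_sums: "P m (sum f S) = (\<Sum>i\<in>S. P m (f i))"
  by (induction S rule: infinite_finite_induct) (simp_all add: P_add)

lemma low_closed: "0 \<in> low m" "x \<in> low m \<Longrightarrow> y \<in> low m \<Longrightarrow> x + y \<in> low m" "x \<in> low m \<Longrightarrow> - x \<in> low m"
  "x \<in> low m \<Longrightarrow> y \<in> low m \<Longrightarrow> x - y \<in> low m" "x \<in> low m \<Longrightarrow> smult R c x \<in> low m"
  "(\<And>i. i \<in> S \<Longrightarrow> f i \<in> low m) \<Longrightarrow> sum f S \<in> low m"
  by (auto simp: low_def P_add P_diff P_uminus P_smult P_sums)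

lemma low_0: "low 0 = {0}"
proof -
  have "x = 0" if "\<forall>k. P k x = 0" for x
    using P_sum[of x] that by simp
  then show ?thesis by (auto simp: low_def)
qed

lemma P_low: "P m x \<in> low (Suc m)" "x \<in> low (Suc m) \<Longrightarrow> x - P m x \<in> low m"
  by (auto simp: low_def P_P P_diff)

lemma low_mult:
  assumes "x \<in> low i" "y \<in> low j" "i + j \<le> Suc m" shows "x \<otimes>\<^bsub>R\<^esub> y \<in> low m"
  unfolding low_def
proof (intro CollectI allI impI)
  fix k assume "m \<le> k"
  then have "P a x = 0 \<or> P (k - a) y = 0" if "a \<le> k" for a
    using assms that by (cases "a < i") (auto simp: low_def)
  then have "P a x \<otimes>\<^bsub>R\<^esub> P (k - a) y = 0" if "a \<le> k" for a
    using that by fastforce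
  then show "P k (x \<otimes>\<^bsub>R\<^esub> y) = 0" by (simp add: P_mult)
qed

lemma filt_prev_filt: "filt_prev H filt m = \<pi> ` low m"
  by (cases m) (auto simp: filt_prev_def filt_def low_0 quot_zero)

lemma filt_coset: "filt_prev H filt m +>\<^bsub>H\<^esub> \<pi> x = gr_coset m x"
proof -
  have "S +>\<^bsub>H\<^esub> a = (\<lambda>h. h \<oplus>\<^bsub>H\<^esub> a) ` S" for S a
    by (auto simp: a_r_coset_def r_coset_def)
  then have "filt_prev H filt m +>\<^bsub>H\<^esub> \<pi> x = (\<lambda>t. \<pi> (t + x)) ` low m"
    by (simp add: filt_prev_filt image_image)
  then show ?thesis by (auto simp: gr_coset_def)
qed

lemma filt_prev_gr_coset: "filt_prev H filt m = gr_coset m 0"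
  by (auto simp: filt_prev_filt gr_coset_def)

lemma gr_coset_eq_iff: "gr_coset m x = gr_coset m y \<longleftrightarrow> (\<exists>t\<in>low m. x - y + t \<in> I)"
proof
  assume "gr_coset m x = gr_coset m y"
  moreover have "\<pi> x \<in> gr_coset m x" unfolding gr_coset_def using low_closed(1) by force
  ultimately obtain t where "t \<in> low m" "\<pi> x = \<pi> (t + y)" by (auto simp: gr_coset_def)
  then show "\<exists>t\<in>low m. x - y + t \<in> I"
    by (intro bexI[of _ "- t"]) (auto simp: coset_eq_iff low_closed algebra_simps)
next
  assume "\<exists>t\<in>low m. x - y + t \<in> I"
  then obtain t where t: "t \<in> low m" "x - y + t \<in> I" by blast
  have "\<pi> (s + x) = \<pi> ((s - t) + y)" "\<pi> (s + y) = \<pi> ((s + t) + x)" for s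
    using t(2) I_closed(3)[OF t(2)] by (auto simp: coset_eq_iff algebra_simps)
  moreover have "s - t \<in> low m" "s + t \<in> low m" if "s \<in> low m" for s
    using that t low_closed by auto
  ultimately show "gr_coset m x = gr_coset m y" unfolding gr_coset_def by blast
qed

lemma gr_coset_eqI: "x - y \<in> low m \<Longrightarrow> gr_coset m x = gr_coset m y"
  unfolding gr_coset_eq_iff using low_closed(3)[of "x - y" m]
  by (intro bexI[of _ "- (x - y)"]) (auto simp: I_closed)

lemma gr_coset_add: "gr_coset m x <+>\<^bsub>H\<^esub> gr_coset m y = gr_coset m (x + y)"
proof
  show "gr_coset m x <+>\<^bsub>H\<^esub> gr_coset m y \<subseteq> gr_coset m (x + y)"
  proof
    fix X assume "X \<in> gr_coset m x <+>\<^bsub>H\<^esub> gr_coset m y"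
    then obtain s t where "s \<in> low m" "t \<in> low m" "X = \<pi> (s + x) \<oplus>\<^bsub>H\<^esub> \<pi> (t + y)"
      by (auto simp: set_add_def set_mult_def gr_coset_def)
    then show "X \<in> gr_coset m (x + y)"
      by (auto simp: gr_coset_def algebra_simps intro!: exI[of _ "s + t"] low_closed)
  qed
  show "gr_coset m (x + y) \<subseteq> gr_coset m x <+>\<^bsub>H\<^esub> gr_coset m y"
  proof
    fix X assume "X \<in> gr_coset m (x + y)"
    then obtain t where t: "t \<in> low m" "X = \<pi> (t + x + y)" by (auto simp: gr_coset_def algebra_simps)
    then have "X = \<pi> (t + x) \<oplus>\<^bsub>H\<^esub> \<pi> (0 + y)" by (simp add: algebra_simps)
    then show "X \<in> gr_coset m x <+>\<^bsub>H\<^esub> gr_coset m y"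
      using t low_closed(1) unfolding set_add_def set_mult_def gr_coset_def by fastforce
  qed
qed

lemma \<psi>_add: "\<psi> (x + y) = add gr (\<psi> x) (\<psi> y)"
  by (auto simp: \<psi>_def P_add gr_coset_add assoc_graded_def)

lemma \<psi>_smult: "\<psi> (smult R c x) = smult gr c (\<psi> x)"
proof
  fix m
  have "filt_prev H filt m +>\<^bsub>H\<^esub> smult H c a = gr_coset m (smult R c (P m x))" if a:
      "a \<in> gr_coset m (P m x)" for a
  proof -
    obtain t where "t \<in> low m" "a = \<pi> (t + P m x)" using a by (auto simp: gr_coset_def)
    then show ?thesis by (simp add: filt_coset) (rule gr_coset_eqI, simp add: smult_add low_closed)
  qed
  moreover have "gr_coset m (P m x) \<noteq> {}" using low_closed(1) by (auto simp: gr_coset_def)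
  ultimately have "(\<Union>a\<in>gr_coset m (P m x). filt_prev H filt m +>\<^bsub>H\<^esub> smult H c a) =
      gr_coset m (smult R c (P m x))"
    by (intro UN_const)
  then show "\<psi> (smult R c x) m = smult gr c (\<psi> x) m"
    by (simp add: \<psi>_def P_smult assoc_graded_def)
qed

lemma \<psi>_one: "\<psi> (one R) = one gr"
  by (auto simp: \<psi>_def P_one assoc_graded_def fun_eq_iff filt_coset quot_one quot_zero)

lemma \<psi>_choice: "a \<in> Pi UNIV (\<psi> x) \<Longrightarrow> \<exists>t. (\<forall>i. t i \<in> low i) \<and> a = (\<lambda>i. \<pi> (t i + P i x))"
proof -
  assume "a \<in> Pi UNIV (\<psi> x)"
  then have "\<forall>i. \<exists>t. t \<in> low i \<and> a i = \<pi> (t + P i x)" by (auto simp: \<psi>_def gr_coset_def Pi_iff)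
  then show ?thesis by (metis ext)
qed

text \<open>
  The product in the associated graded algebra is a union over all representatives. Replacing a
  representative of degree \<open>i\<close> by another changes it by an element of degree less than \<open>i\<close>, hence
  the product in degree \<open>m\<close> by an element of degree less than \<open>m\<close>, so all members of the union
  are the same class.
\<close>

lemma \<psi>_mult: "\<psi> (x \<otimes>\<^bsub>R\<^esub> y) = \<psi> x \<otimes>\<^bsub>gr\<^esub> \<psi> y"
proof
  fix m
  let ?D = "gr_coset m (P m (x \<otimes>\<^bsub>R\<^esub> y))"
  have "filt_prev H filt m +>\<^bsub>H\<^esub> (\<Oplus>\<^bsub>H\<^esub>i\<in>{..m}. a i \<otimes>\<^bsub>H\<^esub> b (m - i)) = ?D"
    if ab: "a \<in> Pi UNIV (\<psi> x)" "b \<in> Pi UNIV (\<psi> y)" for a b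
  proof -
    obtain t where t: "\<And>i. t i \<in> low i" "a = (\<lambda>i. \<pi> (t i + P i x))" using \<psi>_choice[OF ab(1)] by blast
    obtain s where s: "\<And>i. s i \<in> low i" "b = (\<lambda>i. \<pi> (s i + P i y))" using \<psi>_choice[OF ab(2)] by blast
    have "filt_prev H filt m +>\<^bsub>H\<^esub> (\<Oplus>\<^bsub>H\<^esub>i\<in>{..m}. a i \<otimes>\<^bsub>H\<^esub> b (m - i)) =
        gr_coset m (\<Sum>i\<le>m. (t i + P i x) \<otimes>\<^bsub>R\<^esub> (s (m - i) + P (m - i) y))"
      by (simp add: t(2) s(2) quot_finsum filt_coset)
    also have "\<dots> = ?D"
    proof (rule gr_coset_eqI)
      have "(\<Sum>i\<le>m. (t i + P i x) \<otimes>\<^bsub>R\<^esub> (s (m - i) + P (m - i) y)) - P m (x \<otimes>\<^bsub>R\<^esub> y) =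
        (\<Sum>i\<le>m. t i \<otimes>\<^bsub>R\<^esub> s (m - i) + t i \<otimes>\<^bsub>R\<^esub> P (m - i) y + P i x \<otimes>\<^bsub>R\<^esub> s (m - i))"
        by (simp add: P_mult mult_distrib sum.distrib algebra_simps)
      also have "\<dots> \<in> low m"
      proof (intro low_closed(6) low_closed(2))
        fix i assume "i \<in> {..m}"
        then show "t i \<otimes>\<^bsub>R\<^esub> s (m - i) \<in> low m" "t i \<otimes>\<^bsub>R\<^esub> P (m - i) y \<in> low m" "P i x \<otimes>\<^bsub>R\<^esub> s (m - i) \<in> low m"
          by (auto intro: low_mult t s P_low)
      qed
      finally show "(\<Sum>i\<le>m. (t i + P i x) \<otimes>\<^bsub>R\<^esub> (s (m - i) + P (m - i) y)) - P m (x \<otimes>\<^bsub>R\<^esub> y) \<in> low m" .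
    qed
    finally show ?thesis .
  qed
  moreover have "Pi UNIV (\<psi> z) \<noteq> {}" for z
  proof -
    have "(\<lambda>i. \<pi> (0 + P i z)) \<in> Pi UNIV (\<psi> z)"
      using low_closed(1) unfolding \<psi>_def gr_coset_def by blast
    then show ?thesis by (metis empty_iff)
  qed
  ultimately have "(\<Union>a\<in>Pi UNIV (\<psi> x). \<Union>b\<in>Pi UNIV (\<psi> y). filt_prev H filt m +>\<^bsub>H\<^esub> (\<Oplus>\<^bsub>H\<^esub>i\<in>{..m}. a i \<otimes>\<^bsub>H\<^esub> b
      (m - i))) = ?D"
    by (intro UN_const)
  then show "\<psi> (x \<otimes>\<^bsub>R\<^esub> y) m = (\<psi> x \<otimes>\<^bsub>gr\<^esub> \<psi> y) m"
    by (simp add: \<psi>_def assoc_graded_def)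
qed

lemma \<psi>_carrier: "\<psi> x \<in> carrier gr"
proof -
  have "{m. \<psi> x m \<noteq> filt_prev H filt m} \<subseteq> {m. P m x \<noteq> 0}"
    by (auto simp: \<psi>_def filt_prev_gr_coset)
  then have "finite {m. \<psi> x m \<noteq> filt_prev H filt m}" using P_finite finite_subset by blast
  moreover have "\<psi> x m \<in> (\<lambda>a. filt_prev H filt m +>\<^bsub>H\<^esub> a) ` filt m" for m
    using P_low(1)[of m x] by (auto simp: \<psi>_def filt_def filt_coset[symmetric])
  ultimately show ?thesis by (simp add: assoc_graded_def)
qed

text \<open>
  Homogeneous representatives of the finitely many nonzero components are added up.
\<close>

lemma gr_lift:
  assumes "X \<in> carrier gr"
  obtains x where "\<psi> x = X" "\<And>m. X m = filt_prev H filt m \<Longrightarrow> P m x = 0"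
proof -
  have "\<forall>m. \<exists>u\<in>low (Suc m). X m = gr_coset m u" and fin: "finite {m. X m \<noteq> filt_prev H filt m}"
    using assms by (auto simp: assoc_graded_def filt_def image_iff filt_coset)
  then obtain u where u: "\<And>m. u m \<in> low (Suc m)" "\<And>m. X m = gr_coset m (u m)" by metis
  define x where "x = (\<Sum>m\<in>{m. X m \<noteq> filt_prev H filt m}. P m (u m))"
  have Px: "P k x = (if X k \<noteq> filt_prev H filt k then P k (u k) else 0)" for k
    unfolding x_def P_sums by (simp add: P_P sum.delta'[OF fin])
  have "\<psi> x k = X k" for k
  proof (cases "X k = filt_prev H filt k")
    case True then show ?thesis by (simp add: \<psi>_def Px filt_prev_gr_coset)
  next
    case False
    have "P k (u k) - u k \<in> low k" using low_closed(3)[OF P_low(2)[OF u(1)[of k]]] by simp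
    then show ?thesis using False by (simp add: \<psi>_def Px u(2)[of k] gr_coset_eqI)
  qed
  then show thesis using Px by (intro that[of x]) auto
qed

lemma \<psi>_range: "range \<psi> = carrier gr"
  using \<psi>_carrier gr_lift by (metis image_subsetI rangeI subsetI subset_antisym UNIV_I)

lemma \<psi>_comp: "\<psi> ` {x. \<forall>k. k \<noteq> m \<longrightarrow> P k x = 0} = assoc_graded_comp H filt m"
proof
  show "\<psi> ` {x. \<forall>k. k \<noteq> m \<longrightarrow> P k x = 0} \<subseteq> assoc_graded_comp H filt m"
    using \<psi>_carrier by (auto simp: assoc_graded_comp_def \<psi>_def filt_prev_gr_coset)
  show "assoc_graded_comp H filt m \<subseteq> \<psi> ` {x. \<forall>k. k \<noteq> m \<longrightarrow> P k x = 0}"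
  proof
    fix X assume X: "X \<in> assoc_graded_comp H filt m"
    then obtain x where "\<psi> x = X" "\<And>m. X m = filt_prev H filt m \<Longrightarrow> P m x = 0"
      by (metis (no_types, lifting) assoc_graded_comp_def gr_lift mem_Collect_eq)
    with X show "X \<in> \<psi> ` {x. \<forall>k. k \<noteq> m \<longrightarrow> P k x = 0}"
      by (auto simp: assoc_graded_comp_def)
  qed
qed

lemma \<psi>_eq_iff: "\<psi> x = \<psi> y \<longleftrightarrow> (\<forall>m. \<exists>t\<in>low m. P m (x - y) + t \<in> I)"
  by (auto simp: fun_eq_iff \<psi>_def gr_coset_eq_iff P_diff)

end

lemma graded_iso_of_common_kernel:
  assumes psi: "range \<psi> = carrier A" "\<And>x y. \<psi> (m x y) = mult A (\<psi> x) (\<psi> y)"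
      "\<And>x y. \<psi> (x + y) = add A (\<psi> x) (\<psi> y)"
      "\<psi> u = one A" "\<And>c x. \<psi> (s c x) = smult A c (\<psi> x)" "\<And>k. \<psi> ` D k = Ac k"
    and theta: "range \<theta> = carrier B" "\<And>x y. \<theta> (m x y) = mult B (\<theta> x) (\<theta> y)"
        "\<And>x y. \<theta> (x + y) = add B (\<theta> x) (\<theta> y)"
      "\<theta> u = one B" "\<And>c x. \<theta> (s c x) = smult B c (\<theta> x)" "\<And>k. \<theta> ` D k = Bc k"
    and ker: "\<And>x y. \<psi> x = \<psi> y \<longleftrightarrow> \<theta> x = \<theta> y"
  shows "graded_alg_isomorphic A Ac B Bc"
proof -
  define \<phi> where "\<phi> X = \<theta> (inv_into UNIV \<psi> X)" for X
  have \<phi>: "\<phi> (\<psi> x) = \<theta> x" for x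
    unfolding \<phi>_def by (subst ker[symmetric]) (rule f_inv_into_f, simp)
  have "\<phi> \<in> ring_iso A B"
  proof (rule ring_iso_memI)
    show "bij_betw \<phi> (carrier A) (carrier B)"
      unfolding bij_betw_def psi(1)[symmetric] theta(1)[symmetric]
      by (auto simp: inj_on_def \<phi> ker image_iff)
  qed (auto simp: psi(1)[symmetric] theta(1)[symmetric] \<phi> theta(2-4) simp flip: psi(2-4))
  moreover have "\<phi> ` Ac k = Bc k" for k
    unfolding psi(6)[symmetric] theta(6)[symmetric] by (auto simp: \<phi> image_iff)
  ultimately show ?thesis unfolding graded_alg_isomorphic_def
    by (intro bexI[of _ \<phi>]) (auto simp: psi(1)[symmetric] \<phi> theta(5) simp flip: psi(5))
qed

section \<open>The identities imply the PBW property\<close>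

definition hom_part :: "nat \<Rightarrow> ('n list \<Rightarrow>\<^sub>0 complex) \<Rightarrow> ('n list \<Rightarrow>\<^sub>0 complex)"
  where "hom_part m = lin (\<lambda>w. if length w = m then mon w 1 else 0)"

definition skew_part :: "nat \<Rightarrow> ('n perm \<Rightarrow> 'n list \<Rightarrow>\<^sub>0 complex) \<Rightarrow> ('n perm \<Rightarrow> 'n list \<Rightarrow>\<^sub>0 complex)"
  where "skew_part m f = (\<lambda>g. hom_part m (f g))"

lemma lookup_hom_part: "coef (hom_part m p) w = (if length w = m then coef p w else 0)"
  by (induction p rule: pm_induct[OF subset_UNIV])
    (auto simp: hom_part_def lin_add lookup_add lookup_single when_def)

lemma hom_part_simps [simp]: "hom_part m (p + q) = hom_part m p + hom_part m q"
    "hom_part m (p - q) = hom_part m p - hom_part m q"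
  "hom_part m (pm_scale c p) = pm_scale c (hom_part m p)"
      "hom_part m (hom_part k p) = (if m = k then hom_part m p else 0)" "hom_part m 0 = 0"
  "hom_part m (sum f S) = (\<Sum>x\<in>S. hom_part m (f x))" "hom_part m (mon w c) = (if length w =
      m then mon w c else 0)"
  by (rule poly_mapping_eqI, simp add: lookup_hom_part lookup_add lookup_minus lookup_sum lookup_single
      when_def; auto)+

lemma hom_part_mult: "hom_part m (p * q) = (\<Sum>i\<le>m. hom_part i p * hom_part (m - i) q)"
proof (induction p rule: pm_induct[OF subset_UNIV])
  case (2 w c)
  show ?case
  proof (induction q rule: pm_induct[OF subset_UNIV])
    case (2 u d)
    have "(\<Sum>i\<le>m. hom_part i (mon w c) * hom_part (m - i) (mon u d)) =
      (\<Sum>i\<le>m. if i = length w then hom_part m (mon (w @ u) (c * d)) else 0)"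
      by (rule sum.cong) (auto simp: mult_single plus_list_def)
    then show ?case by (auto simp: mult_single plus_list_def)
  qed (simp_all add: distrib_left sum.distrib)
qed (simp_all add: distrib_right sum.distrib)

lemma hom_part_perm_act: "hom_part m (perm_act g p) = perm_act g (hom_part m p)"
  by (induction p rule: pm_induct[OF subset_UNIV]) (simp_all add: perm_act_add)

lemma hom_part_eq_zero: "hom_part m p = 0" if "m \<notin> length ` supp p"
  using that by (intro poly_mapping_eqI) (auto simp: lookup_hom_part in_keys_iff image_iff)

interpretation T: full_ring tensor_alg
  by (intro full_ring.intro tensor_alg_ring full_ring_axioms.intro) (simp_all add: pm_scale_mult_left)

interpretation sq: full_ring_ideal tensor_alg "sq_ideal q"
  by (intro full_ring_ideal.intro full_ring_ideal_axioms.intro T.full_ring_axioms sq_ideal_ideal)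

interpretation skew: full_ring "skew :: (complex, 'n::finite perm \<Rightarrow> 'n list \<Rightarrow>\<^sub>0 complex) module"
proof (intro full_ring.intro skew_ring full_ring_axioms.intro)
  fix c and f :: "'n perm \<Rightarrow> 'n list \<Rightarrow>\<^sub>0 complex"
  have "(\<lambda>x :: 'n perm. pm_scale c (if x = 1 then 1 else 0 ::
      'n list \<Rightarrow>\<^sub>0 complex)) = tensor_in_skew (pm_scale c 1)"
    by (auto simp: tensor_in_skew_def)
  then show "c \<odot>\<^bsub>skew\<^esub> f = (c \<odot>\<^bsub>skew\<^esub> \<one>\<^bsub>skew\<^esub>) \<otimes>\<^bsub>skew\<^esub> f"
    by (simp add: skew_mult_in_skew pm_scale_mult_left)
qed simp_all

interpretation skew: graded_full_ring "skew :: (complex, 'n::finite perm \<Rightarrow> 'n list \<Rightarrow>\<^sub>0 complex) module"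
    "rel_ideal K" skew_part
  for K :: "'n::finite \<Rightarrow> 'n \<Rightarrow> 'n perm \<Rightarrow>\<^sub>0 complex"
proof (intro graded_full_ring.intro full_ring_ideal.intro full_ring_ideal_axioms.intro
    skew.full_ring_axioms rel_ideal_ideal graded_full_ring_axioms.intro)
  fix m k and x y :: "'n perm \<Rightarrow> 'n list \<Rightarrow>\<^sub>0 complex" and c
  show "skew_part m (x + y) = skew_part m x + skew_part m y" by (simp add: skew_part_def fun_eq_iff)
  show "skew_part m (skew_part k x) = (if m = k then skew_part m x else 0)" by (simp add:
      skew_part_def fun_eq_iff)
  have "{m. skew_part m x \<noteq> 0} \<subseteq> (\<Union>g\<in>UNIV. length ` supp (x g))"
    using hom_part_eq_zero by (fastforce simp: skew_part_def fun_eq_iff)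
  then show fin: "finite {m. skew_part m x \<noteq> 0}"
    by (rule finite_subset) (simp add: finite_perms)
  show "(\<Sum>m\<in>{m. skew_part m x \<noteq> 0}. skew_part m x) = x"
  proof
    fix g
    show "(\<Sum>m\<in>{m. skew_part m x \<noteq> 0}. skew_part m x) g = x g"
    proof (rule poly_mapping_eqI)
      fix w
      have "coef ((\<Sum>m\<in>{m. skew_part m x \<noteq> 0}. skew_part m x) g) w =
        (\<Sum>m\<in>{m. skew_part m x \<noteq> 0}. if m = length w then coef (x g) w else 0)"
        by (auto simp: sum_fun_apply lookup_sum skew_part_def lookup_hom_part intro!: sum.cong)
      also have "\<dots> = coef (x g) w"
      proof (cases "skew_part (length w) x = 0")
        case True
        then have "coef (skew_part (length w) x g) w = 0" by simp
        then show ?thesis by (simp add: fin lookup_hom_part skew_part_def[of "length w"] sum.neutral)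
      qed (simp add: fin)
      finally show "coef ((\<Sum>m\<in>{m. skew_part m x \<noteq> 0}. skew_part m x) g) w = coef (x g) w" .
    qed
  qed
  show "skew_part m (x \<otimes>\<^bsub>skew\<^esub> y) = (\<Sum>i\<le>m. skew_part i x \<otimes>\<^bsub>skew\<^esub> skew_part (m - i) y)"
    by (simp add: skew_part_def fun_eq_iff skew_mult_def sum_fun_apply hom_part_mult hom_part_perm_act)
        (intro allI sum.swap)
  show "skew_part m \<one>\<^bsub>skew\<^esub> = (if m = 0 then \<one>\<^bsub>skew\<^esub> else 0)"
    by (auto simp: skew_part_def fun_eq_iff zero_list_def simp flip: single_one)
  show "skew_part m (c \<odot>\<^bsub>skew\<^esub> x) = c \<odot>\<^bsub>skew\<^esub> skew_part m x" by (simp add: skew_part_def fun_eq_iff)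
qed

lemma tensor_below_iff: "p \<in> tensor_below m \<longleftrightarrow> (\<forall>k\<ge>m. hom_part k p = 0)"
proof
  assume "p \<in> tensor_below m" then show "\<forall>k\<ge>m. hom_part k p = 0"
    by (auto simp: tensor_below_def intro!: hom_part_eq_zero)
next
  assume a: "\<forall>k\<ge>m. hom_part k p = 0"
  show "p \<in> tensor_below m" unfolding tensor_below_def
  proof (intro CollectI ballI, rule ccontr)
    fix w assume "w \<in> supp p" "\<not> length w < m"
    moreover from this a have "coef (hom_part (length w) p) w = 0" by simp
    ultimately show False by (simp add: lookup_hom_part in_keys_iff)
  qed
qed

lemma comp_iff: "p \<in> tensor_comp m \<longleftrightarrow> (\<forall>k. k \<noteq> m \<longrightarrow> hom_part k p = 0)"
proof
  assume "p \<in> tensor_comp m" then show "\<forall>k. k \<noteq> m \<longrightarrow> hom_part k p = 0"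
    by (auto simp: tensor_comp_def intro!: hom_part_eq_zero)
next
  assume a: "\<forall>k. k \<noteq> m \<longrightarrow> hom_part k p = 0"
  show "p \<in> tensor_comp m" unfolding tensor_comp_def
  proof (intro CollectI ballI, rule ccontr)
    fix w assume "w \<in> supp p" "length w \<noteq> m"
    moreover from this a have "coef (hom_part (length w) p) w = 0" by simp
    ultimately show False by (simp add: lookup_hom_part in_keys_iff)
  qed
qed

lemma skew_low: "f \<in> skew.low m \<longleftrightarrow> (\<forall>g. f g \<in> tensor_below m)"
  by (auto simp: skew.low_def tensor_below_iff skew_part_def fun_eq_iff)

lemma skew_comp: "(\<forall>k. k \<noteq> m \<longrightarrow> skew_part k f = 0) \<longleftrightarrow> (\<forall>g. f g \<in> tensor_comp m)"
  by (auto simp: comp_iff skew_part_def fun_eq_iff)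

lemma hecke_filt:
  fixes K :: "'n::finite \<Rightarrow> 'n \<Rightarrow> 'n perm \<Rightarrow>\<^sub>0 complex"
  shows "(\<lambda>f. rel_ideal K +>\<^bsub>skew\<^esub> f) ` {f. \<forall>g. f g \<in> tensor_filt m} = skew.filt K m"
proof -
  have "tensor_filt m = (tensor_below (Suc m) :: ('n list \<Rightarrow>\<^sub>0 complex) set)"
    unfolding tensor_filt_def tensor_below_def by (simp add: less_Suc_eq_le)
  then have "{f. \<forall>g :: 'n perm. f g \<in> (tensor_filt m :: ('n list \<Rightarrow>\<^sub>0 complex) set)} = skew.low (Suc m)"
    by (simp add: set_eq_iff skew_low)
  then show ?thesis by (simp add: skew.filt_def)
qed

definition to_sq_skew :: "('n::finite perm \<Rightarrow> 'n list \<Rightarrow>\<^sub>0 complex) \<Rightarrow> 'n perm \<Rightarrow> ('n list \<Rightarrow>\<^sub>0 complex) set"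
  where "to_sq_skew f = (\<lambda>g. sq_ideal sign_q +>\<^bsub>tensor_alg\<^esub> f g)"

abbreviation qskew :: "(complex, 'n::finite perm \<Rightarrow> ('n list \<Rightarrow>\<^sub>0 complex) set) module"
  where "qskew \<equiv> skew_group_alg (sq_alg sign_q) (\<lambda>g X. perm_act g ` X)"

lemma perm_act_coset: "perm_act g ` (sq_ideal sign_q +>\<^bsub>tensor_alg\<^esub> p) =
    sq_ideal sign_q +>\<^bsub>tensor_alg\<^esub> perm_act g p"
proof (intro equalityI subsetI)
  fix y assume "y \<in> perm_act g ` (sq_ideal sign_q +>\<^bsub>tensor_alg\<^esub> p)"
  then show "y \<in> sq_ideal sign_q +>\<^bsub>tensor_alg\<^esub> perm_act g p"
    using perm_act_sq_ideal by (auto simp: sq.mem_coset simp flip: perm_act_diff)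
next
  fix y assume "y \<in> sq_ideal sign_q +>\<^bsub>tensor_alg\<^esub> perm_act g p"
  then have "perm_act (inverse g) (y - perm_act g p) \<in> sq_ideal sign_q"
    by (simp add: sq.mem_coset perm_act_sq_ideal)
  then show "y \<in> perm_act g ` (sq_ideal sign_q +>\<^bsub>tensor_alg\<^esub> p)"
    by (intro image_eqI[of _ _ "perm_act (inverse g) y"]) (simp_all add: sq.mem_coset perm_act_diff)
qed

lemma to_sq_skew_props:
  fixes f f' :: "'a::finite perm \<Rightarrow> 'a list \<Rightarrow>\<^sub>0 complex"
  shows
  "range to_sq_skew = carrier (qskew :: (complex, 'a perm \<Rightarrow> ('a list \<Rightarrow>\<^sub>0 complex) set) module)"
      "to_sq_skew (skew_mult f f') = to_sq_skew f \<otimes>\<^bsub>qskew\<^esub> to_sq_skew f'"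
      "to_sq_skew (f + f') = to_sq_skew f \<oplus>\<^bsub>qskew\<^esub> to_sq_skew f'"
  "to_sq_skew (\<lambda>x. if x = 1 then 1 else 0) = one (qskew ::
      (complex, 'a perm \<Rightarrow> ('a list \<Rightarrow>\<^sub>0 complex) set) module)"
      "to_sq_skew (\<lambda>x. pm_scale c (f x)) = smult qskew c (to_sq_skew f)"
  "to_sq_skew ` {f. \<forall>k. k \<noteq> m \<longrightarrow> skew_part k f = 0} = (sq_skew_comp sign_q m ::
      ('a perm \<Rightarrow> ('a list \<Rightarrow>\<^sub>0 complex) set) set)"
  "to_sq_skew f = to_sq_skew f' \<longleftrightarrow> (\<forall>g. f g - f' g \<in> sq_ideal sign_q)"
proof -
  have "X \<in> range to_sq_skew" if X: "X \<in> carrier qskew" for X :: "'a perm \<Rightarrow> ('a list \<Rightarrow>\<^sub>0 complex) set"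
  proof -
    from X have "\<forall>g. \<exists>p. X g = sq_ideal sign_q +>\<^bsub>tensor_alg\<^esub> p"
      by (auto simp: skew_group_alg_def sq_alg_def sq.quot_carrier)
    then obtain f where "\<And>g. X g = sq_ideal sign_q +>\<^bsub>tensor_alg\<^esub> f g" by metis
    then have "X = to_sq_skew f" by (simp add: to_sq_skew_def fun_eq_iff)
    then show ?thesis by blast
  qed
  then show "range to_sq_skew = carrier (qskew :: (complex, 'a perm \<Rightarrow> ('a list \<Rightarrow>\<^sub>0 complex) set) module)"
    by (auto simp: to_sq_skew_def skew_group_alg_def sq_alg_def sq.quot_carrier)
  show "to_sq_skew (skew_mult f f') = to_sq_skew f \<otimes>\<^bsub>qskew\<^esub> to_sq_skew f'"
  proof
    fix x :: "'a perm"
    have "(to_sq_skew f \<otimes>\<^bsub>qskew\<^esub> to_sq_skew f') x =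
       finsum (sq.H sign_q) (\<lambda>i. sq_ideal sign_q +>\<^bsub>tensor_alg\<^esub> (case i of (g,
           h) \<Rightarrow> f g * perm_act g (f' h))) {(g, h). g * h = x}"
      by (simp add: skew_group_alg_def to_sq_skew_def perm_act_coset sq_alg_def case_prod_unfold)
    also have "\<dots> = to_sq_skew (skew_mult f f') x"
      unfolding sq.quot_finsum to_sq_skew_def skew_mult_def by (simp add: sum_pairs_factor)
    finally show "to_sq_skew (skew_mult f f') x = (to_sq_skew f \<otimes>\<^bsub>qskew\<^esub> to_sq_skew f') x" ..
  qed
  show "to_sq_skew (f + f') = to_sq_skew f \<oplus>\<^bsub>qskew\<^esub> to_sq_skew f'"
    by (simp add: to_sq_skew_def skew_group_alg_def sq_alg_def)
  show "to_sq_skew (\<lambda>x. if x = 1 then 1 else 0) = one (qskew ::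
      (complex, 'a perm \<Rightarrow> ('a list \<Rightarrow>\<^sub>0 complex) set) module)"
    by (rule ext) (simp add: to_sq_skew_def skew_group_alg_def sq_alg_def sq.quot_one sq.quot_zero)
  show "to_sq_skew (\<lambda>x. pm_scale c (f x)) = smult qskew c (to_sq_skew f)"
    using sq.quot_smult by (simp add: to_sq_skew_def skew_group_alg_def sq_alg_def)
  show "to_sq_skew ` {f. \<forall>k. k \<noteq> m \<longrightarrow> skew_part k f = 0} = (sq_skew_comp sign_q m ::
      ('a perm \<Rightarrow> ('a list \<Rightarrow>\<^sub>0 complex) set) set)"
    unfolding skew_comp
  proof
    show "to_sq_skew ` {f. \<forall>g. f g \<in> tensor_comp m} \<subseteq> (sq_skew_comp sign_q m ::
        ('a perm \<Rightarrow> ('a list \<Rightarrow>\<^sub>0 complex) set) set)"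
      by (auto simp: to_sq_skew_def sq_skew_comp_def)
    show "(sq_skew_comp sign_q m :: ('a perm \<Rightarrow> ('a list \<Rightarrow>\<^sub>0 complex) set) set) \<subseteq> to_sq_skew ` {f. \<forall>g. f g
        \<in> tensor_comp m}"
    proof
      fix X :: "'a perm \<Rightarrow> ('a list \<Rightarrow>\<^sub>0 complex) set" assume "X \<in> sq_skew_comp sign_q m"
      then have "\<forall>g. \<exists>p\<in>tensor_comp m. X g = sq_ideal sign_q +>\<^bsub>tensor_alg\<^esub> p"
        by (auto simp: sq_skew_comp_def)
      then obtain f where "\<And>g. f g \<in> tensor_comp m" "\<And>g. X g = sq_ideal sign_q +>\<^bsub>tensor_alg\<^esub> f g" by metis
      then have "X = to_sq_skew f" "f \<in> {f. \<forall>g. f g \<in> tensor_comp m}" by (simp_all add: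
          to_sq_skew_def fun_eq_iff)
      then show "X \<in> to_sq_skew ` {f. \<forall>g. f g \<in> tensor_comp m}" by blast
    qed
  qed
  show "to_sq_skew f = to_sq_skew f' \<longleftrightarrow> (\<forall>g. f g - f' g \<in> sq_ideal sign_q)"
    by (simp add: to_sq_skew_def fun_eq_iff sq.coset_eq_iff)
qed

definition group_elt :: "'n perm \<Rightarrow> 'n perm \<Rightarrow> 'n list \<Rightarrow>\<^sub>0 complex" where "group_elt g = (\<lambda>x.
    if x = g then 1 else 0)"

lemma tensor_in_skew_mult: "skew_mult (tensor_in_skew p) (tensor_in_skew q) = (tensor_in_skew (p * q) ::
    'n::finite perm \<Rightarrow> _)"
  unfolding skew_mult_in_skew by (auto simp: tensor_in_skew_def)

lemma tensor_in_skew_linear: "tensor_in_skew (p + q) = tensor_in_skew p + tensor_in_skew q"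
  "tensor_in_skew (- p) = - tensor_in_skew p"  "tensor_in_skew 0 = 0"
  by (auto simp: tensor_in_skew_def fun_eq_iff)

lemma tensor_in_skew_sum: "tensor_in_skew (sum f S) = (\<Sum>x\<in>S. tensor_in_skew (f x))"
  by (induction S rule: infinite_finite_induct) (simp_all add: tensor_in_skew_linear)

lemma skew_part_in_skew: "skew_part m (tensor_in_skew p) = tensor_in_skew (hom_part m p)"
  by (auto simp: skew_part_def tensor_in_skew_def)

lemma hom_part_q_commutator: "hom_part m (q_commutator q i j) = (if m = 2 then q_commutator q i j else 0)"
  by (simp add: q_commutator_def tgen_def mult_single plus_list_def)

lemma group_alg_low: "group_alg_in_skew r \<in> skew.low (Suc m)"
  by (auto simp: skew.low_def skew_part_def group_alg_in_skew_def fun_eq_iff)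

lemma rel_ideal_sum: "(\<And>x. x \<in> S \<Longrightarrow> f x \<in> rel_ideal K) \<Longrightarrow> sum f S \<in> rel_ideal K"
  by (induction S rule: infinite_finite_induct) (auto simp: rel_ideal_closed)

text \<open>
  For an element of the ideal of \<open>S\<^sub>q(V)\<close>, each homogeneous part is congruent to lower degree
  modulo the relations of the Hecke algebra: this holds for \<open>v\<^sub>i v\<^sub>j + v\<^sub>j v\<^sub>i\<close>, congruent to \<open>K
  i j\<close>, and such elements form an ideal. The converse, \<open>rel_ideal_leading_term\<close>, is where the two
  identities are needed.
\<close>

lemma sq_ideal_lift:
  fixes K :: "'n::finite \<Rightarrow> 'n \<Rightarrow> 'n perm \<Rightarrow>\<^sub>0 complex"
  assumes "p \<in> sq_ideal sign_q" shows "\<forall>m. \<exists>t\<in>skew.low m. tensor_in_skew (hom_part m p) + t \<in> rel_ideal K"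
  using assms
proof (rule sq_ideal_minimal[where P = "\<lambda>p. \<forall>m. \<exists>t\<in>skew.low m. tensor_in_skew (hom_part m p)
    + t \<in> rel_ideal K", rotated -1], goal_cases)
  case (1 i j)
  show ?case
  proof
    fix m
    show "\<exists>t\<in>skew.low m. tensor_in_skew (hom_part m (q_commutator sign_q i j)) + t \<in> rel_ideal K"
    proof (cases "m = 2")
      case True
      then have "- group_alg_in_skew (K i j) \<in> skew.low m"
        using group_alg_low[of "K i j" 1] by (simp add: skew.low_closed numeral_2_eq_2)
      then show ?thesis using True rel_ideal_closed(6)[of i j K]
        by (intro bexI[of _ "- group_alg_in_skew (K i j)"]) (simp_all add: hom_part_q_commutator)
    next
      case False
      then show ?thesis
        by (intro bexI[of _ 0]) (simp_all add: hom_part_q_commutator tensor_in_skew_linear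
            rel_ideal_closed skew.low_closed)
    qed
  qed
next
  case 2 show ?case by (intro allI bexI[of _ 0]) (simp_all add:
      tensor_in_skew_linear rel_ideal_closed skew.low_closed)
next
  case (3 p p')
  show ?case
  proof
    fix m
    obtain t t' where "t \<in> skew.low m" "tensor_in_skew (hom_part m p) + t \<in> rel_ideal K" "t' \<in> skew.low m"
        "tensor_in_skew (hom_part m p') + t' \<in> rel_ideal K"
      using 3 by metis
    then have "t + t' \<in> skew.low m" "(tensor_in_skew (hom_part m p) + t) + (tensor_in_skew (hom_part m p')
        + t') \<in> rel_ideal K"
      by (blast intro: skew.low_closed rel_ideal_closed)+
    then show "\<exists>t\<in>skew.low m. tensor_in_skew (hom_part m (p + p')) + t \<in> rel_ideal K"
      by (intro bexI[of _ "t + t'"]) (simp_all add: tensor_in_skew_linear algebra_simps)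
  qed
next
  case (4 p)
  show ?case
  proof
    fix m
    obtain t where "t \<in> skew.low m" "tensor_in_skew (hom_part m p) + t \<in> rel_ideal K"
      using 4 by metis
    moreover have "hom_part m (- p) = - hom_part m p" using hom_part_simps(2)[of m 0 p] by simp
    ultimately show "\<exists>t\<in>skew.low m. tensor_in_skew (hom_part m (- p)) + t \<in> rel_ideal K"
      using rel_ideal_closed(5)[of "tensor_in_skew (hom_part m p) + t" K]
      by (intro bexI[of _ "- t"]) (simp_all add: tensor_in_skew_linear skew.low_closed)
  qed
next
  case (5 s p)
  then obtain t where t: "\<And>m. t m \<in> skew.low m" "\<And>m. tensor_in_skew (hom_part m p) + t m \<in> rel_ideal K" by metis
  show ?case
  proof
    fix m
    let ?t = "\<Sum>i\<le>m. skew_mult (tensor_in_skew (hom_part i s)) (t (m - i))"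
    have "tensor_in_skew (hom_part i s) \<in> skew.low (Suc i)" for i
      using skew.P_low(1)[of i "tensor_in_skew s"] by (simp add: skew_part_in_skew)
    then have "skew_mult (tensor_in_skew (hom_part i s)) (t (m - i)) \<in> skew.low m" if "i \<le> m" for i
      using skew.low_mult[OF _ t(1)[of "m - i"], of "tensor_in_skew (hom_part i s)" "Suc i" m] that by simp
    then have "?t \<in> skew.low m" by (intro skew.low_closed) auto
    moreover have "tensor_in_skew (hom_part m (s * p)) + ?t =
        (\<Sum>i\<le>m. skew_mult (tensor_in_skew (hom_part i s)) (tensor_in_skew (hom_part (m - i) p) + t (m - i)))"
      by (simp add: hom_part_mult tensor_in_skew_sum skew_mult_distrib sum.distrib tensor_in_skew_mult)
    moreover have "\<dots> \<in> rel_ideal K"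
      by (intro rel_ideal_sum rel_ideal_closed t)
    ultimately show "\<exists>t\<in>skew.low m. tensor_in_skew (hom_part m (s * p)) + t \<in> rel_ideal K"
      by (intro bexI[of _ ?t]) simp_all
  qed
next
  case (6 s p)
  then obtain t where t: "\<And>m. t m \<in> skew.low m" "\<And>m. tensor_in_skew (hom_part m p) + t m \<in> rel_ideal K" by metis
  show ?case
  proof
    fix m
    let ?t = "\<Sum>i\<le>m. skew_mult (t i) (tensor_in_skew (hom_part (m - i) s))"
    have "tensor_in_skew (hom_part i s) \<in> skew.low (Suc i)" for i
      using skew.P_low(1)[of i "tensor_in_skew s"] by (simp add: skew_part_in_skew)
    then have "skew_mult (t i) (tensor_in_skew (hom_part (m - i) s)) \<in> skew.low m" if "i \<le> m" for i
      using skew.low_mult[OF t(1)[of i], of "tensor_in_skew (hom_part (m - i) s)" "Suc (m - i)" m] that by simp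
    then have "?t \<in> skew.low m" by (intro skew.low_closed) auto
    moreover have "tensor_in_skew (hom_part m (p * s)) + ?t =
        (\<Sum>i\<le>m. skew_mult (tensor_in_skew (hom_part i p) + t i) (tensor_in_skew (hom_part (m - i) s)))"
      by (simp add: hom_part_mult tensor_in_skew_sum skew_mult_distrib sum.distrib tensor_in_skew_mult)
    moreover have "\<dots> \<in> rel_ideal K"
      by (intro rel_ideal_sum rel_ideal_closed t)
    ultimately show "\<exists>t\<in>skew.low m. tensor_in_skew (hom_part m (p * s)) + t \<in> rel_ideal K"
      by (intro bexI[of _ ?t]) simp_all
  qed
qed

text \<open>
  The property of being a quantum Drinfeld Hecke algebra in terms of the values of \<open>\<kappa>\<close> on the
  basis, without the space \<open>V\<close>.
\<close>

definition has_pbw_property :: "('n::finite \<Rightarrow> 'n \<Rightarrow> 'n perm \<Rightarrow>\<^sub>0 complex) \<Rightarrow> bool"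
  where "has_pbw_property K \<longleftrightarrow> graded_alg_isomorphic
    (assoc_graded (quot_alg skew (rel_ideal K)) (skew.filt K)) (assoc_graded_comp (quot_alg skew
        (rel_ideal K)) (skew.filt K))
    (qskew :: (complex, 'n perm \<Rightarrow> ('n list \<Rightarrow>\<^sub>0 complex) set) module) (sq_skew_comp sign_q)"

lemma skew_mult_group_elt: "skew_mult f (group_elt h) x = f (x * inverse h)"
    "skew_mult (group_elt g) f x = perm_act g (f (inverse g * x))"
proof -
  have "inverse g * x = h \<longleftrightarrow> g = x * inverse h" for g
  proof
    assume "inverse g * x = h"
    then have "g * (inverse g * x) * inverse h = g * h * inverse h" by simp
    then show "g = x * inverse h" by (simp add: mult.assoc)
  qed (simp add: mult.assoc)
  moreover have "perm_act y 1 = 1" for y :: "'a perm" by (simp add: zero_list_def flip: single_one)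
  ultimately have "skew_mult f (group_elt h) x = (\<Sum>g\<in>UNIV. if g = x * inverse h then f (x * inverse h) else 0)"
    unfolding skew_mult_def group_elt_def by (intro sum.cong) auto
  then show "skew_mult f (group_elt h) x = f (x * inverse h)" by (simp add: finite_perms)
  have "skew_mult (group_elt g) f x = (\<Sum>y\<in>UNIV. if y = g then perm_act g (f (inverse g * x)) else 0)"
    unfolding skew_mult_def group_elt_def by (intro sum.cong) auto
  then show "skew_mult (group_elt g) f x = perm_act g (f (inverse g * x))" by (simp add: finite_perms)
qed

lemma group_elt_decomp: "f = (\<Sum>g\<in>UNIV. skew_mult (tensor_in_skew (f g)) (group_elt g))"
proof
  fix x
  have "(\<Sum>g\<in>UNIV. skew_mult (tensor_in_skew (f g)) (group_elt g)) x = (\<Sum>g\<in>UNIV. if g = x then f x else 0)"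
    unfolding sum_fun_apply by (intro sum.cong) (auto simp: skew_mult_in_skew group_elt_def)
  then show "f x = (\<Sum>g\<in>UNIV. skew_mult (tensor_in_skew (f g)) (group_elt g)) x" by (simp add: finite_perms)
qed

lemma group_elt_low: "group_elt g \<in> skew.low 1"
proof -
  have "hom_part k (1 :: 'a list \<Rightarrow>\<^sub>0 complex) = 0" if "k \<ge> 1" for k
    using that by (simp add: zero_list_def flip: single_one)
  then show ?thesis by (auto simp: skew.low_def skew_part_def group_elt_def fun_eq_iff)
qed

text \<open>
  The maps to the associated graded algebra and to \<open>S\<^sub>q(V) \<rtimes> G\<close> have the same kernel, by
  \<open>rel_ideal_leading_term\<close> in one direction and \<open>sq_ideal_lift\<close> in the other.
\<close>

theorem (in pbw_coeffs) graded_isomorphic: "has_pbw_property K"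
  unfolding has_pbw_property_def
proof (rule graded_iso_of_common_kernel[where \<psi> = "skew.\<psi> K" and \<theta> = to_sq_skew and m = skew_mult and u =
    "\<lambda>x. if x = 1 then 1 else 0"
      and s = "\<lambda>c f x. pm_scale c (f x)" and D = "\<lambda>m. {f. \<forall>k. k \<noteq> m \<longrightarrow> skew_part k f = 0}"])
  fix f f' :: "'n perm \<Rightarrow> 'n list \<Rightarrow>\<^sub>0 complex" and c and k
  show "range (skew.\<psi> K) = carrier (skew.gr K)" by (rule skew.\<psi>_range)
  show "skew.\<psi> K (skew_mult f f') = skew.\<psi> K f \<otimes>\<^bsub>skew.gr K\<^esub> skew.\<psi> K f'"
    using skew.\<psi>_mult[of K f f'] by simp
  show "skew.\<psi> K (f + f') = skew.\<psi> K f \<oplus>\<^bsub>skew.gr K\<^esub> skew.\<psi> K f'" by (rule skew.\<psi>_add)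
  show "skew.\<psi> K (\<lambda>x. if x = 1 then 1 else 0) = one (skew.gr K)" using skew.\<psi>_one[of K] by simp
  show "skew.\<psi> K (\<lambda>x. pm_scale c (f x)) = smult (skew.gr K) c (skew.\<psi> K f)"
    using skew.\<psi>_smult[of K c f] by simp
  show "skew.\<psi> K ` {f. \<forall>l. l \<noteq> k \<longrightarrow> skew_part l f = 0} = assoc_graded_comp (skew.H K) (skew.filt K) k"
    by (rule skew.\<psi>_comp)
  let ?d = "f - f'"
  have comp: "skew_part m ?d g \<in> tensor_comp m" for m g
    by (simp add: comp_iff skew_part_def)
  show "skew.\<psi> K f = skew.\<psi> K f' \<longleftrightarrow> to_sq_skew f = to_sq_skew f'"
    unfolding skew.\<psi>_eq_iff to_sq_skew_props(7)
  proof (intro iffI allI)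
    fix g assume a: "\<forall>m. \<exists>t\<in>skew.low m. skew_part m ?d + t \<in> rel_ideal K"
    have "skew_part m ?d g \<in> sq_ideal sign_q" for m
    proof -
      obtain t where "t \<in> skew.low m" "skew_part m ?d + t \<in> rel_ideal K" using a by blast
      then show ?thesis by (intro rel_ideal_leading_term[OF comp _ _]) (simp_all add: skew_low)
    qed
    then have "(\<Sum>m\<in>{m. skew_part m ?d \<noteq> 0}. skew_part m ?d g) \<in> sq_ideal sign_q" by (intro sq_ideal_sum)
    then show "f g - f' g \<in> sq_ideal sign_q"
      using arg_cong[OF skew.P_sum[of ?d], of "\<lambda>f. f g"] by (simp add: sum_fun_apply)
  next
    fix m assume "\<forall>g. f g - f' g \<in> sq_ideal sign_q"
    then have "\<forall>g. \<exists>t\<in>skew.low m. tensor_in_skew (hom_part m (?d g)) + t \<in> rel_ideal K"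
      using sq_ideal_lift by fastforce
    then obtain t where t: "\<And>g. t g \<in> skew.low m" "\<And>g. tensor_in_skew (hom_part m (?d g)) + t g \<in> rel_ideal K"
      by metis
    have "skew_mult (t g) (group_elt g) \<in> skew.low m" for g
      using skew.low_mult[OF t(1) group_elt_low, of m] by simp
    then have "(\<Sum>g\<in>UNIV. skew_mult (t g) (group_elt g)) \<in> skew.low m" by (intro skew.low_closed)
    moreover have "skew_part m ?d + (\<Sum>g\<in>UNIV. skew_mult (t g) (group_elt g)) =
        (\<Sum>g\<in>UNIV. skew_mult (tensor_in_skew (hom_part m (?d g)) + t g) (group_elt g))"
      by (subst group_elt_decomp[of "skew_part m ?d"]) (simp add: skew_mult_distrib sum.distrib skew_part_def)
    moreover have "\<dots> \<in> rel_ideal K" by (intro rel_ideal_sum rel_ideal_closed t)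
    ultimately show "\<exists>t\<in>skew.low m. skew_part m ?d + t \<in> rel_ideal K" by (metis (no_types))
  qed
qed (rule to_sq_skew_props)+

section \<open>Necessity of the identities\<close>

text \<open>
  The subspace \<open>X\<close> is finite-dimensional but the ambient space is not, and \<open>L\<close> is linear only on
  \<open>X\<close>. The image of a basis of \<open>X\<close> spans \<open>X\<close> with at most as many vectors as the dimension, so it
  is again a basis.
\<close>

lemma (in vector_space) surjective_endo_injective:
  assumes X: "subspace X" "X = span S" "finite S"
    and L: "\<And>x y. x \<in> X \<Longrightarrow> y \<in> X \<Longrightarrow> L (x + y) = L x + L y" "\<And>c x. x \<in> X \<Longrightarrow> L (scale c x) = scale c (L x)"
    and surj: "L ` X = X" and x: "x \<in> X" "L x = 0"
  shows "x = 0"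
proof -
  have "X \<subseteq> span S" using X by simp
  obtain B where B: "B \<subseteq> X" "independent B" "X \<subseteq> span B" "card B = dim X"
    using basis_exists by blast
  then have XB: "X = span B" using X(1) span_minimal by blast
  have finB: "finite B"
    using independent_span_bound[OF X(3) B(2)] B(1) X(2) by simp
  have L0: "L 0 = 0" using L(2)[of 0 0] X(1) subspace_0 by simp
  have lin: "L (\<Sum>b\<in>T. scale (u b) b) = (\<Sum>b\<in>T. scale (u b) (L b))" if "finite T" "T \<subseteq> B" for T u
    using that
  proof (induction T rule: finite_induct)
    case (insert b T)
    have "(\<Sum>b\<in>T. scale (u b) b) \<in> X" "scale (u b) b \<in> X"
      using insert B(1) X(1) by (auto intro!: subspace_sum subspace_scale)
    then show ?case using insert B(1) by (auto simp: L)
  qed (simp add: L0)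
  have sp: "X \<subseteq> span (L ` B)"
  proof
    fix y assume "y \<in> X"
    then obtain z where z: "z \<in> X" "y = L z" using surj by blast
    then obtain u where "z = (\<Sum>b\<in>B. scale (u b) b)" using XB span_finite[OF finB] by auto
    then have "y = (\<Sum>b\<in>B. scale (u b) (L b))" using z(2) lin[OF finB order_refl] by simp
    then show "y \<in> span (L ` B)" by (simp add: span_sum span_scale span_base)
  qed
  have LB: "L ` B \<subseteq> X" using B(1) surj by blast
  have "dim X \<le> card (L ` B)" using dim_le_card[OF sp] finB by simp
  then have card: "card (L ` B) = card B" using B(4) card_image_le[OF finB, of L] by simp
  then have inj: "inj_on L B" using eq_card_imp_inj_on finB by blast
  have ind: "independent (L ` B)"
  proof
    assume "dependent (L ` B)"
    then obtain c where c: "c \<in> L ` B" "c \<in> span (L ` B - {c})" by (auto simp: dependent_def)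
    have "y \<in> span (L ` B - {c})" if "y \<in> L ` B" for y
      using that c(2) by (cases "y = c") (auto intro: span_base)
    then have "L ` B \<subseteq> span (L ` B - {c})" by blast
    then have "X \<subseteq> span (L ` B - {c})" using sp span_minimal[OF _ subspace_span] by blast
    then have "dim X \<le> card (L ` B - {c})" using dim_le_card finB by blast
    also have "\<dots> < card (L ` B)" using c(1) finB by (intro card_Diff1_less) auto
    finally show False using card B(4) by simp
  qed
  obtain u where u: "x = (\<Sum>b\<in>B. scale (u b) b)" using x(1) XB span_finite[OF finB] by auto
  then have "(\<Sum>b\<in>B. scale (u b) (L b)) = 0" using x(2) lin[OF finB order_refl] by simp
  then have "(\<Sum>c\<in>L ` B. scale (u (inv_into B L c)) c) = 0"
    by (simp add: sum.reindex[OF inj] inv_into_f_f[OF inj])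
  then have "u (inv_into B L c) = 0" if "c \<in> L ` B" for c
    using independentD[OF ind, of "L ` B" "\<lambda>c. u (inv_into B L c)"] finB that by blast
  then have "u b = 0" if "b \<in> B" for b using that by (metis image_eqI inv_into_f_f[OF inj])
  then show "x = 0" by (simp add: u)
qed

interpretation tfun: vector_space "\<lambda>c (f :: 'g \<Rightarrow> 'k \<Rightarrow>\<^sub>0 complex) x. pm_scale c (f x)"
  by standard (auto simp: fun_eq_iff pm_scale_add pm_scale_add_left)

lemma sq_ideal_degree:
  assumes "p \<in> sq_ideal sign_q" shows "\<forall>w\<in>supp p. 2 \<le> length w"
  using assms
proof (rule sq_ideal_minimal[where P = "\<lambda>p. \<forall>w\<in>supp p. 2 \<le> length w", rotated -1], goal_cases)
  case (1 i j) then show ?case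
    by (auto simp: q_commutator_def tgen_def mult_single plus_list_def in_keys_iff lookup_minus
        lookup_single when_def split: if_splits)
next
  case (3 p p') then show ?case using keys_add[of p p'] by blast
next
  case (4 p) then show ?case by (simp add: in_keys_iff)
next
  case (5 s p) then show ?case using keys_mult[of s p] by (fastforce simp: plus_list_def)
next
  case (6 s p) then show ?case using keys_mult[of p s] by (fastforce simp: plus_list_def)
qed simp_all

lemma finite_span_comp:
  fixes X :: "('n::finite perm \<Rightarrow> 'n list \<Rightarrow>\<^sub>0 complex) set"
  assumes "X = {f. \<forall>k. k \<noteq> m \<longrightarrow> skew_part k f = 0}"
  shows "tfun.subspace X" "\<exists>S. finite S \<and> X = tfun.span S"
proof -
  show sub: "tfun.subspace X"
    unfolding assms skew_comp by (rule tfun.subspaceI) (auto simp: comp_iff)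
  define E where "E = (\<lambda>(g :: 'n perm, w :: 'n list). (\<lambda>x. if x = g then mon w (1 :: complex) else 0))"
  define W where "W = {w :: 'n list. length w = m}"
  have finW: "finite W" using finite_lists_length_eq[of "UNIV :: 'n set" m] by (simp add: W_def)
  let ?S = "E ` (UNIV \<times> W)"
  have EX: "?S \<subseteq> X" unfolding assms by (auto simp: E_def W_def skew_part_def fun_eq_iff)
  have "f \<in> tfun.span ?S" if "f \<in> X" for f
  proof -
    have k: "supp (f g) \<subseteq> W" for g
      using that by (auto simp: assms skew_comp tensor_comp_def W_def)
    have "f = (\<Sum>g\<in>UNIV. \<Sum>w\<in>W. (\<lambda>x. pm_scale (coef (f g) w) (E (g, w) x)))"
    proof
      fix x
      have "(\<Sum>g\<in>UNIV. \<Sum>w\<in>W. (\<lambda>x. pm_scale (coef (f g) w) (E (g, w) x))) x =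
        (\<Sum>g\<in>UNIV. if g = x then \<Sum>w\<in>W. pm_scale (coef (f x) w) (mon w 1) else 0)"
        unfolding sum_fun_apply by (intro sum.cong) (auto simp: E_def)
      also have "\<dots> = lin (\<lambda>w. mon w 1) (f x)"
        by (simp add: finite_perms lin_superset[OF finW k])
      finally show "f x = (\<Sum>g\<in>UNIV. \<Sum>w\<in>W. (\<lambda>x. pm_scale (coef (f g) w) (E (g, w) x))) x"
        by (simp add: lin_id)
    qed
    also have "\<dots> \<in> tfun.span ?S"
      by (intro tfun.span_sum tfun.span_scale tfun.span_base) auto
    finally show ?thesis .
  qed
  then have "X = tfun.span ?S" using tfun.span_minimal[OF EX sub] by blast
  moreover have "finite ?S" using finW finite_perms by auto
  ultimately show "\<exists>S. finite S \<and> X = tfun.span S" by blast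
qed

lemma hom_part_comp: "p \<in> tensor_comp m \<Longrightarrow> hom_part m p = p"
  by (rule poly_mapping_eqI) (auto simp: lookup_hom_part tensor_comp_def in_keys_iff)

text \<open>
  Degrees 0 and 1 of \<open>T(V) \<rtimes> G\<close> and of \<open>S\<^sub>q(V) \<rtimes> G\<close> agree, as the relations of \<open>S\<^sub>q(V)\<close> have
  degree 2. So mapping to the associated graded algebra, applying the given isomorphism, and
  going back is an endomorphism of the finite-dimensional homogeneous component. It is
  surjective, hence injective, and an element \<open>f\<close> of the component that is congruent to lower
  degree is mapped to zero.
\<close>

lemma pbw_property_injective:
  fixes K :: "'a::finite \<Rightarrow> 'a \<Rightarrow> 'a perm \<Rightarrow>\<^sub>0 complex"
  assumes iso: "has_pbw_property K" and m: "m \<le> 1" and f: "\<forall>k. k \<noteq> m \<longrightarrow> skew_part k f = 0" and t: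
      "t \<in> skew.low m" "f + t \<in> rel_ideal K"
  shows "f = 0"
proof -
  let ?A = "skew.gr K" and ?X = "{f. \<forall>k. k \<noteq> m \<longrightarrow> skew_part k f = 0} :: ('a perm \<Rightarrow> 'a list \<Rightarrow>\<^sub>0 complex) set"
  obtain \<phi> where \<phi>: "\<phi> \<in> ring_iso ?A (qskew :: (complex, 'a perm \<Rightarrow> ('a list \<Rightarrow>\<^sub>0 complex) set) module)"
      "\<And>c x. x \<in> carrier ?A \<Longrightarrow> \<phi> (smult ?A c x) = smult qskew c (\<phi> x)"
    "\<phi> ` assoc_graded_comp (skew.H K) (skew.filt K) m = sq_skew_comp sign_q m"
    using iso unfolding has_pbw_property_def graded_alg_isomorphic_def by blast
  have \<phi>_add: "\<phi> (skew.\<psi> K x \<oplus>\<^bsub>?A\<^esub> skew.\<psi> K y) = \<phi> (skew.\<psi> K x) \<oplus>\<^bsub>qskew\<^esub> \<phi> (skew.\<psi> K y)" for x y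
    by (rule ring_iso_memE(3)[OF \<phi>(1)]) (rule skew.\<psi>_carrier)+
  have im: "(\<lambda>x. \<phi> (skew.\<psi> K x)) ` ?X = to_sq_skew ` ?X"
  proof -
    have "(\<lambda>x. \<phi> (skew.\<psi> K x)) ` ?X = \<phi> ` assoc_graded_comp (skew.H K) (skew.filt K) m"
      using skew.\<psi>_comp[of K m] by (simp add: image_image[symmetric])
    then show ?thesis unfolding \<phi>(3) to_sq_skew_props(6) .
  qed
  have tinj: "x = y" if "to_sq_skew x = to_sq_skew y" "x \<in> ?X" "y \<in> ?X" for x y
  proof
    fix g
    have "x g - y g \<in> sq_ideal sign_q" using that(1) by (simp add: to_sq_skew_props(7))
    moreover have "x g - y g \<in> tensor_comp m"
      using that(2,3) by (auto simp: skew_comp comp_iff)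
    ultimately have "supp (x g - y g) = {}"
      using m sq_ideal_degree[of "x g - y g"] by (fastforce simp: tensor_comp_def)
    then show "x g = y g" by simp
  qed
  define L where "L x = inv_into ?X to_sq_skew (\<phi> (skew.\<psi> K x))" for x
  have L: "L x \<in> ?X" "to_sq_skew (L x) = \<phi> (skew.\<psi> K x)" if "x \<in> ?X" for x
  proof -
    have "\<phi> (skew.\<psi> K x) \<in> to_sq_skew ` ?X" using that im by blast
    then show "L x \<in> ?X" "to_sq_skew (L x) = \<phi> (skew.\<psi> K x)"
      unfolding L_def by (rule inv_into_into, rule f_inv_into_f)
  qed
  have sub: "tfun.subspace ?X" by (rule finite_span_comp) simp
  obtain S where S: "finite S" "?X = tfun.span S" using finite_span_comp[of ?X m] by blast
  have \<psi>f: "skew.\<psi> K f = skew.\<psi> K 0"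
    unfolding skew.\<psi>_eq_iff
  proof
    fix k show "\<exists>t\<in>skew.low k. skew_part k (f - 0) + t \<in> rel_ideal K"
    proof (cases "k = m")
      case True
      then have "skew_part k f = f"
        using f hom_part_comp unfolding skew_comp by (auto simp: skew_part_def)
      then show ?thesis using t True by auto
    next
      case False
      then show ?thesis using f by (intro bexI[of _ 0]) (simp_all add: skew.low_closed rel_ideal_closed)
    qed
  qed
  have 0: "0 \<in> ?X" by simp
  show "f = 0"
  proof (rule tfun.surjective_endo_injective[OF sub S(2,1), of L])
    fix x y assume xy: "x \<in> ?X" "y \<in> ?X"
    have s: "x + y \<in> ?X" using xy tfun.subspace_add[OF sub] by blast
    have "to_sq_skew (L (x + y)) = to_sq_skew (L x + L y)"
      by (simp only: L(2)[OF s] to_sq_skew_props(3) L(2)[OF xy(1)] L(2)[OF xy(2)] skew.\<psi>_add \<phi>_add)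
    then show "L (x + y) = L x + L y"
      by (rule tinj) (intro L(1) s xy tfun.subspace_add[OF sub])+
  next
    fix c x assume x: "x \<in> ?X"
    have s: "(\<lambda>g. pm_scale c (x g)) \<in> ?X" using x tfun.subspace_scale[OF sub] by blast
    have "to_sq_skew (L (\<lambda>g. pm_scale c (x g))) = to_sq_skew (\<lambda>g. pm_scale c (L x g))"
      using \<phi>(2)[OF skew.\<psi>_carrier[of K x]] skew.\<psi>_smult[of K c x]
      by (simp add: L(2)[OF s] to_sq_skew_props(5) L(2)[OF x])
    then show "L (\<lambda>g. pm_scale c (x g)) = (\<lambda>g. pm_scale c (L x g))"
      by (rule tinj) (intro L(1) s x tfun.subspace_scale[OF sub])+
  next
    show "L ` ?X = ?X"
    proof (intro equalityI subsetI)
      fix y assume y: "y \<in> ?X"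
      then obtain x where x: "x \<in> ?X" "to_sq_skew y = \<phi> (skew.\<psi> K x)" using im by blast
      then have "y = L x" by (intro tinj) (use L[OF x(1)] y in auto)
      then show "y \<in> L ` ?X" using x by blast
    qed (use L in blast)
    show "f \<in> ?X" using f by blast
    have L00: "L (0 + 0) = L 0" by simp
    have "L f = L 0" by (simp add: L_def \<psi>f)
    also have "to_sq_skew (L 0 + L 0) = to_sq_skew (L 0)"
      unfolding to_sq_skew_props(3) L(2)[OF 0] \<phi>_add[symmetric] skew.\<psi>_add[symmetric] by simp
    then have "L 0 + L 0 = L 0"
      by (rule tinj) (intro L(1)[OF 0] tfun.subspace_add[OF sub])+
    then have "L 0 = 0" by simp
    finally show "L f = 0" .
  qed
qed

text \<open>
  The part of degree 1 vanishes by \<open>pbw_property_injective\<close>, and then the part of degree 0.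
\<close>

lemma pbw_property_low:
  assumes "has_pbw_property K" "f \<in> rel_ideal K" "f \<in> skew.low 2" shows "f = 0"
proof -
  have 2: "f \<in> skew.low (Suc 1)" using assms by (simp add: numeral_2_eq_2)
  have "skew_part 1 f = 0"
    by (rule pbw_property_injective[OF assms(1), of 1 _ "f - skew_part 1 f"])
      (use skew.P_low(2)[OF 2] assms(2) in \<open>auto simp: skew.P_P\<close>)
  then have 1: "f \<in> skew.low (Suc 0)" using skew.P_low(2)[OF 2] by simp
  have "skew_part 0 f = 0"
    by (rule pbw_property_injective[OF assms(1), of 0 _ "f - skew_part 0 f"])
      (use skew.P_low(2)[OF 1] assms(2) in \<open>auto simp: skew.P_P\<close>)
  then show ?thesis using skew.P_low(2)[OF 1] by (simp add: skew.low_0)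
qed

text \<open>
  Both identities come from elements of degree at most 1 in the ideal of relations: the
  difference of the conjugated relation for \<open>i\<close>, \<open>j\<close> and the relation for \<open>g i\<close>, \<open>g j\<close>, and the
  sum of the commutators of the relations with generators over the cyclic permutations of \<open>i\<close>,
  \<open>j\<close>, \<open>k\<close>. The terms of higher degree cancel.
\<close>

theorem pbw_property_pbw_coeffs:
  fixes K :: "'n::finite \<Rightarrow> 'n \<Rightarrow> 'n perm \<Rightarrow>\<^sub>0 complex"
  assumes iso: "has_pbw_property K" and diag: "\<And>i. K i i = 0" and sym: "\<And>i j. K i j = K j i"
  shows "pbw_coeffs K"
proof
  define r where "r i j = tensor_in_skew (q_commutator sign_q i j) - group_alg_in_skew (K i j)" for i j
  have r: "r i j \<in> rel_ideal K" for i j unfolding r_def by (rule rel_ideal_closed)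
  show "K i i = 0" for i by fact
  show "K i j = K j i" for i j by fact
  fix g h and i j k x :: 'n
  let ?f = "skew_mult (group_elt g) (skew_mult (r i j) (group_elt (inverse g))) - r (ap g i) (ap g j)"
  have "inverse g * y * g = 1 \<longleftrightarrow> y = 1" for y
  proof
    assume "inverse g * y * g = 1"
    then have "g * (inverse g * y * g) * inverse g = 1" by simp
    then show "y = 1" by (simp add: mult.assoc)
  qed simp
  then have f: "?f y = mon [] (coef (K (ap g i) (ap g j)) y - coef (K i j) (inverse g * y * g))" for y
    by (simp add: skew_mult_group_elt r_def tensor_in_skew_def group_alg_in_skew_def perm_act_diff
        perm_act_q_commutator single_diff mult.assoc)
  have "?f \<in> rel_ideal K" by (intro rel_ideal_closed r)
  moreover have "?f \<in> skew.low 2"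
    unfolding skew_low f by (auto simp: tensor_below_def)
  ultimately have "?f = 0" by (rule pbw_property_low[OF iso])
  from fun_cong[OF this, of "g * h * inverse g"]
  have "mon ([] :: 'n list) (coef (K (ap g i) (ap g j)) (g * h * inverse g) - coef (K i j) h) = 0"
    unfolding f by (simp add: mult.assoc)
  then show "coef (K (ap g i) (ap g j)) (g * h * inverse g) = coef (K i j) h"
    by (metis lookup_single_eq lookup_zero right_minus_eq)
next
  fix g and i j k x :: 'n
  assume ne: "i \<noteq> j" "j \<noteq> k" "i \<noteq> k"
  define r where "r i j = tensor_in_skew (q_commutator sign_q i j) - group_alg_in_skew (K i j)" for i j
  have r: "r i j \<in> rel_ideal K" for i j unfolding r_def by (rule rel_ideal_closed)
  define c where "c i j k = skew_mult (r i j) (tensor_in_skew (tgen k))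
      - skew_mult (tensor_in_skew (tgen k)) (r i j)" for i j k
  let ?f = "c i j k + c j k i + c k i j"
  have c: "c i j k y = (if y = 1 then q_commutator sign_q i j * tgen k
      - tgen k * q_commutator sign_q i j else 0)
      - pm_scale (coef (K i j) y) (tgen (ap y k) - tgen k)" for i j k y
  proof -
    have "mon [] d * tgen l = pm_scale d (tgen l)" "tgen l * mon [] d = pm_scale d (tgen l)" for d and l :: 'n
      by (simp_all add: tgen_def mult_single plus_list_def)
    moreover have "r i j y = (if y = 1 then q_commutator sign_q i j else 0) - mon [] (coef (K i j) y)"
      by (simp add: r_def tensor_in_skew_def group_alg_in_skew_def)
    moreover have "c i j k y = r i j y * tgen (ap y k) - tgen k * r i j y"
      by (simp add: c_def skew_mult_in_skew skew_mult_right_in_skew perm_act_tgen)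
    ultimately show ?thesis
      by (cases "y = 1") (simp_all add: left_diff_distrib right_diff_distrib pm_scale_diff)
  qed
  have f: "?f y = - (pm_scale (coef (K i j) y) (tgen (ap y k) - tgen k)
     + pm_scale (coef (K j k) y) (tgen (ap y i) - tgen i)
     + pm_scale (coef (K k i) y) (tgen (ap y j) - tgen j))" for y
  proof -
    have "(q_commutator sign_q i j * tgen k - tgen k * q_commutator sign_q i j) +
     (q_commutator sign_q j k * tgen i - tgen i * q_commutator sign_q j k) +
     (q_commutator sign_q k i * tgen j - tgen j * q_commutator sign_q k i) = 0"
      using ne by (simp add: q_commutator_def sign_q_def pm_scale_uminus algebra_simps)
    then show ?thesis by (cases "y = 1") (simp_all add: c algebra_simps)
  qed
  have "?f \<in> rel_ideal K" unfolding c_def by (intro rel_ideal_closed r)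
  moreover have "?f \<in> skew.low 2"
  proof -
    have "hom_part n (tgen l) = 0" if "n \<ge> 2" for n and l :: 'n using that by (simp add: tgen_def)
    moreover have "hom_part n (- p) = - hom_part n p" for n and p :: "'n list \<Rightarrow>\<^sub>0 complex"
        using hom_part_simps(2)[of n 0 p] by simp
    ultimately show ?thesis unfolding skew_low f tensor_below_iff by simp
  qed
  ultimately have "?f = 0" by (rule pbw_property_low[OF iso])
  have l: "coef (tgen a) [x] = of_bool (a = x)" for a
    by (simp add: tgen_def lookup_single when_def)
  from arg_cong[OF fun_cong[OF \<open>?f = 0\<close>, of g], of "\<lambda>p. coef p [x]"]
  show "coef (K i j) g * (of_bool (ap g k = x) - of_bool (k = x)) +
      coef (K j k) g * (of_bool (ap g i = x) - of_bool (i = x)) +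
      coef (K k i) g * (of_bool (ap g j = x) - of_bool (j = x)) = 0"
    unfolding f by (simp only: l lookup_uminus lookup_add lookup_minus lookup_pm_scale lookup_zero
        zero_fun_apply neg_equal_0_iff_equal)
qed

section \<open>The five families of coefficients\<close>

lemma apply_cyc: "ap (cyc xs :: 'n::finite perm) = cycle_of_list xs"
proof -
  have "bij (cycle_of_list xs)" using permutation_of_cycle permutation_bijective by blast
  then show ?thesis by (simp add: cyc_def Perm_inverse)
qed

lemma apply_cyc2: "ap (cyc [i, j] :: 'n::finite perm) x = (if x = i then j else if x = j then i else x)"
  by (simp add: apply_cyc transpose_def)

lemma apply_cyc3: "distinct [i, j, k] \<Longrightarrow> ap (cyc [i, j, k] :: 'n::finite perm) x = (if x = i then j else
    if x = j then k else if x = k then i else x)"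
  by (auto simp add: apply_cyc transpose_def)

lemma apply_cyc22: "distinct [i, j, k, l] \<Longrightarrow> ap (cyc [i, k] * cyc [j, l] ::
    'n::finite perm) x = (if x = i then k else if x = k then i else if x = j then l else
    if x = l then j else x)"
  by (auto simp add: apply_times apply_cyc2)

lemma conj_cyc: "distinct xs \<Longrightarrow> s * cyc xs * inverse s = cyc (map (ap s) xs)" for s :: "'n::finite perm"
  by (rule perm_eqI) (simp add: apply_times apply_inverse apply_cyc flip: conjugation_of_cycle)

lemma perm_exists_map:
  assumes "distinct xs" "distinct ys" "length xs = length ys"
  shows "\<exists>s :: 'n perm. map (ap s) xs = ys"
  using assms(3,1,2)
proof (induction rule: list_induct2)
  case (Cons x xs y ys)
  then obtain s :: "'n perm" where s: "map (ap s) xs = ys" by auto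
  let ?s = "Perm.swap (ap s x) y * s"
  have "ap ?s z = ap s z" if "z \<in> set xs" for z
  proof -
    have "ap s z \<in> set ys" using that s by auto
    then have "ap s z \<noteq> y" "ap s z \<noteq> ap s x"
      using Cons.prems that by (auto simp: apply_inj)
    then show ?thesis by (simp add: apply_times)
  qed
  then have "map (ap ?s) xs = ys" unfolding s[symmetric] by simp
  then have "map (ap ?s) (x # xs) = y # ys" by (simp add: apply_times)
  then show ?case by (rule exI)
qed simp

text \<open>
  Each permutation occurs at most once in the sums that define the five maps, so their
  coefficients are 0 or 1.
\<close>

lemma lookup_sum_gelt:
  assumes "inj_on \<phi> S" "finite S"
  shows "coef (\<Sum>x\<in>S. gelt (\<phi> x)) g = of_bool (\<exists>x\<in>S. g = \<phi> x)"
proof -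
  have "coef (\<Sum>x\<in>S. gelt (\<phi> x)) g = (\<Sum>x\<in>S. of_bool (\<phi> x = g))"
    by (simp add: lookup_sum lookup_single when_def of_bool_def)
  also have "\<dots> = (\<Sum>y\<in>\<phi> ` S. if y = g then 1 else 0)"
    by (simp add: sum.reindex[OF assms(1)] of_bool_def)
  also have "\<dots> = of_bool (\<exists>x\<in>S. g = \<phi> x)" using assms(2) by (auto simp: image_iff)
  finally show ?thesis .
qed

text \<open>
  The value on the diagonal is the one that \<open>kappa_admissible\<close> forces.
\<close>

definition coeffs_of :: "('n \<Rightarrow> 'n \<Rightarrow> 'g \<Rightarrow>\<^sub>0 complex) \<Rightarrow> 'n \<Rightarrow> 'n \<Rightarrow> 'g \<Rightarrow>\<^sub>0 complex"
  where "coeffs_of c i j = (if i = j then 0 else c i j)"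

definition coeff_one :: "'n \<Rightarrow> 'n \<Rightarrow> 'n::finite perm \<Rightarrow>\<^sub>0 complex" where "coeff_one i j = gelt 1"

definition coeff_swap :: "'n \<Rightarrow> 'n \<Rightarrow> 'n::finite perm \<Rightarrow>\<^sub>0 complex" where "coeff_swap i j = gelt (cyc [i, j])"

definition coeff_transp :: "'n \<Rightarrow> 'n \<Rightarrow> 'n::finite perm \<Rightarrow>\<^sub>0 complex"
  where "coeff_transp i j = (\<Sum>k\<in>UNIV - {i, j}. gelt (cyc [i, k]) + gelt (cyc [j, k]))"

definition coeff_double :: "'n \<Rightarrow> 'n \<Rightarrow> 'n::finite perm \<Rightarrow>\<^sub>0 complex"
  where "coeff_double i j = (\<Sum>(k, l) | k \<notin> {i, j} \<and> l \<notin> {i, j} \<and> k \<noteq> l. gelt (cyc [i, k] * cyc [j, l]))"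

definition coeff_cycle3 :: "'n \<Rightarrow> 'n \<Rightarrow> 'n::finite perm \<Rightarrow>\<^sub>0 complex"
  where "coeff_cycle3 i j = (\<Sum>k\<in>UNIV - {i, j}. gelt (cyc [i, j, k]) + gelt (cyc [i, k, j]))"

text \<open>
  The permutations in \<open>coeff_transp i j\<close>, \<open>coeff_double i j\<close> and \<open>coeff_cycle3 i j\<close>, described by
  their cycle type and their effect on \<open>i\<close> and \<open>j\<close>. In this form the behaviour under conjugation
  is evident, and the Jacobi identity is a matter of counting which of three letters are moved.
\<close>

definition transp_type :: "'n::finite \<Rightarrow> 'n \<Rightarrow> 'n perm \<Rightarrow> bool"
  where "transp_type i j g \<longleftrightarrow> (\<exists>a b. distinct [a, b] \<and> g = cyc [a, b]) \<and> (ap g i = i) \<noteq> (ap g j = j)"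

definition double_type :: "'n::finite \<Rightarrow> 'n \<Rightarrow> 'n perm \<Rightarrow> bool"
  where "double_type i j g \<longleftrightarrow> (\<exists>a b c d. distinct [a, b, c, d] \<and> g = cyc [a, b] * cyc [c, d]) \<and>
    ap g i \<noteq> i \<and> ap g j \<noteq> j \<and> ap g i \<noteq> j"

definition cycle3_type :: "'n::finite \<Rightarrow> 'n \<Rightarrow> 'n perm \<Rightarrow> bool"
  where "cycle3_type i j g \<longleftrightarrow> (\<exists>a b c. distinct [a, b, c] \<and> g = cyc [a, b, c]) \<and>
    ap g i \<noteq> i \<and> ap g j \<noteq> j"

lemma cyc2_commute: "cyc [a, b] = (cyc [b, a] :: 'n::finite perm)"
  by (rule perm_eqI) (auto simp: apply_cyc2)

lemma cyc3_rotate: "distinct [a, b, c] \<Longrightarrow> cyc [a, b, c] = (cyc [b, c, a] :: 'n::finite perm)"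
  by (rule perm_eqI) (auto simp: apply_cyc3)

lemma cyc22_commute: "distinct [a, b, c, d] \<Longrightarrow> cyc [a, b] * cyc [c, d] = (cyc [c, d] * cyc [a, b] ::
    'n::finite perm)"
  by (rule perm_eqI) (auto simp: apply_times apply_cyc2)

lemma lookup_coeff_one: "coef (coeff_one i j) g = of_bool (g = 1)"
  by (auto simp: coeff_one_def lookup_single when_def)

lemma lookup_coeff_swap: "coef (coeff_swap i j) g = of_bool (g = cyc [i, j])"
  by (auto simp: coeff_swap_def lookup_single when_def)

lemma lookup_coeff_transp:
  fixes i j :: "'n::finite"
  assumes "i \<noteq> j" shows "coef (coeff_transp i j) g = of_bool (transp_type i j g)"
proof -
  have inj: "inj_on (\<lambda>k. cyc [l, k] :: 'n perm) S" for l S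
    by (rule inj_onI, drule arg_cong[where f = "\<lambda>g. ap g l"]) (simp add: apply_cyc2)
  have "coef (coeff_transp i j) g = of_bool (\<exists>k\<in>UNIV - {i, j}. g = cyc [i, k]) + of_bool (\<exists>k\<in>UNIV - {i,
      j}. g = cyc [j, k])"
    by (simp add: coeff_transp_def sum.distrib lookup_add lookup_sum_gelt[OF inj])
  moreover have "\<not> ((\<exists>k\<in>UNIV - {i, j}. g = cyc [i, k]) \<and> (\<exists>k\<in>UNIV - {i, j}. g = cyc [j, k]))"
  proof
    assume "(\<exists>k\<in>UNIV - {i, j}. g = cyc [i, k]) \<and> (\<exists>k\<in>UNIV - {i, j}. g = cyc [j, k])"
    then obtain k l where "k \<notin> {i, j}" "l \<notin> {i, j}" "g = cyc [i, k]" "g = cyc [j, l]" by blast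
    then show False using apply_cyc2[of i k i] apply_cyc2[of j l i] assms by auto
  qed
  moreover have "transp_type i j g \<longleftrightarrow> (\<exists>k\<in>UNIV - {i, j}. g = cyc [i, k]) \<or> (\<exists>k\<in>UNIV - {i, j}. g = cyc [j, k])"
    (is "_ = ?R")
  proof
    assume "transp_type i j g"
    then obtain a b where ab: "a \<noteq> b" "g = cyc [a, b]" "(ap g i = i) \<noteq> (ap g j = j)"
      unfolding transp_type_def by auto
    have g: "g = cyc [b, a]" unfolding ab(2) by (rule cyc2_commute)
    have "i = a \<and> b \<noteq> j \<or> i = b \<and> a \<noteq> j \<or> j = a \<and> b \<noteq> i \<or> j = b \<and> a \<noteq> i"
    proof -
      have "ap g y = (if y = a then b else if y = b then a else y)" for y
        unfolding ab(2) by (rule apply_cyc2)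
      then show ?thesis using ab(1,3) assms
        by (cases "i = a"; cases "i = b"; cases "j = a"; cases "j = b") simp_all
    qed
    then show ?R
    proof (elim disjE conjE)
      assume "i = a" "b \<noteq> j"
      then have "b \<in> UNIV - {i, j}" "g = cyc [i, b]" using ab by auto
      then show ?R by blast
    next
      assume "i = b" "a \<noteq> j"
      then have "a \<in> UNIV - {i, j}" "g = cyc [i, a]" using ab g by auto
      then show ?R by blast
    next
      assume "j = a" "b \<noteq> i"
      then have "b \<in> UNIV - {i, j}" "g = cyc [j, b]" using ab by auto
      then show ?R by blast
    next
      assume "j = b" "a \<noteq> i"
      then have "a \<in> UNIV - {i, j}" "g = cyc [j, a]" using ab g by auto
      then show ?R by blast
    qed
  next
    assume ?R
    then obtain a b where ab: "distinct [a, b]" "g = cyc [a, b]" and "(i \<in> {a, b}) \<noteq> (j \<in> {a, b})"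
    proof (elim disjE bexE)
      fix k assume "k \<in> UNIV - {i, j}" "g = cyc [i, k]"
      with assms show thesis by (intro that[of i k]) auto
    next
      fix k assume "k \<in> UNIV - {i, j}" "g = cyc [j, k]"
      with assms show thesis by (intro that[of j k]) auto
    qed
    then have "(ap g i = i) \<noteq> (ap g j = j)" by (auto simp: apply_cyc2)
    with ab show "transp_type i j g" unfolding transp_type_def by blast
  qed
  ultimately show ?thesis by auto
qed

lemma lookup_coeff_cycle3:
  fixes i j :: "'n::finite"
  assumes "i \<noteq> j" shows "coef (coeff_cycle3 i j) g = of_bool (cycle3_type i j g)"
proof -
  have inj: "inj_on (\<lambda>k. cyc [i, j, k] :: 'n perm) (UNIV - {i, j})" "inj_on (\<lambda>k. cyc [i, k, j] ::
      'n perm) (UNIV - {i, j})"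
  proof (rule_tac [!] inj_onI)
    fix k l assume kl: "k \<in> UNIV - {i, j}" "l \<in> UNIV - {i, j}"
    show "cyc [i, j, k] = cyc [i, j, l] \<Longrightarrow> k = l"
      using apply_cyc3[of i j k j] apply_cyc3[of i j l j] kl assms by auto
    show "cyc [i, k, j] = cyc [i, l, j] \<Longrightarrow> k = l"
      using apply_cyc3[of i k j i] apply_cyc3[of i l j i] kl assms by auto
  qed
  have "coef (coeff_cycle3 i j) g = of_bool (\<exists>k\<in>UNIV - {i, j}. g = cyc [i, j, k]) + of_bool (\<exists>k\<in>UNIV - {i,
      j}. g = cyc [i, k, j])"
    by (simp add: coeff_cycle3_def sum.distrib lookup_add lookup_sum_gelt[OF inj(1)] lookup_sum_gelt[OF inj(2)])
  moreover have "\<not> ((\<exists>k\<in>UNIV - {i, j}. g = cyc [i, j, k]) \<and> (\<exists>k\<in>UNIV - {i, j}. g = cyc [i, k, j]))"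
  proof
    assume "(\<exists>k\<in>UNIV - {i, j}. g = cyc [i, j, k]) \<and> (\<exists>k\<in>UNIV - {i, j}. g = cyc [i, k, j])"
    then obtain k l where "k \<notin> {i, j}" "l \<notin> {i, j}" "g = cyc [i, j, k]" "g = cyc [i, l, j]" by blast
    then show False using apply_cyc3[of i j k i] apply_cyc3[of i l j i] assms by auto
  qed
  moreover have "cycle3_type i j g \<longleftrightarrow> (\<exists>k\<in>UNIV - {i, j}. g = cyc [i, j, k]) \<or>
      (\<exists>k\<in>UNIV - {i, j}. g = cyc [i, k, j])" (is "_ = ?R")
  proof
    assume "cycle3_type i j g"
    then obtain a b c where d: "distinct [a, b, c]" and g: "g = cyc [a, b, c]" and "ap g i \<noteq> i" "ap g j \<noteq> j"
      unfolding cycle3_type_def by blast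
    then have ij: "i \<in> {a, b, c}" "j \<in> {a, b, c}" by (auto simp: apply_cyc3 split: if_splits)
    have g': "g = cyc [b, c, a]" "g = cyc [c, a, b]" using g cyc3_rotate[of a b c] cyc3_rotate[of b c a] d
        by auto
    have R: ?R if "k \<notin> {i, j}" "g = cyc [i, j, k] \<or> g = cyc [i, k, j]" for k
      using that by blast
    have "(i, j) \<in> {(a, b), (b, c), (c, a), (a, c), (b, a), (c, b)}" using ij assms by auto
    then have "(i = a \<and> j = b) \<or> (i = b \<and> j = c) \<or> (i = c \<and> j = a) \<or> (i = a \<and> j = c) \<or> (i = b \<and> j = a) \<or>
        (i = c \<and> j = b)"
      by simp
    then show ?R
    proof (elim disjE conjE)
      assume h: "i = a" "j = b"
      show ?R
      proof (rule R[of c])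
        show "c \<notin> {i, j}" using d h by auto
        show "g = cyc [i, j, c] \<or> g = cyc [i, c, j]" unfolding h by (rule disjI1[OF g])
      qed
    next
      assume h: "i = b" "j = c"
      show ?R
      proof (rule R[of a])
        show "a \<notin> {i, j}" using d h by auto
        show "g = cyc [i, j, a] \<or> g = cyc [i, a, j]" unfolding h by (rule disjI1[OF g'(1)])
      qed
    next
      assume h: "i = c" "j = a"
      show ?R
      proof (rule R[of b])
        show "b \<notin> {i, j}" using d h by auto
        show "g = cyc [i, j, b] \<or> g = cyc [i, b, j]" unfolding h by (rule disjI1[OF g'(2)])
      qed
    next
      assume h: "i = a" "j = c"
      show ?R
      proof (rule R[of b])
        show "b \<notin> {i, j}" using d h by auto
        show "g = cyc [i, j, b] \<or> g = cyc [i, b, j]" unfolding h by (rule disjI2[OF g])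
      qed
    next
      assume h: "i = b" "j = a"
      show ?R
      proof (rule R[of c])
        show "c \<notin> {i, j}" using d h by auto
        show "g = cyc [i, j, c] \<or> g = cyc [i, c, j]" unfolding h by (rule disjI2[OF g'(1)])
      qed
    next
      assume h: "i = c" "j = b"
      show ?R
      proof (rule R[of a])
        show "a \<notin> {i, j}" using d h by auto
        show "g = cyc [i, j, a] \<or> g = cyc [i, a, j]" unfolding h by (rule disjI2[OF g'(2)])
      qed
    qed
  next
    assume ?R
    then obtain a b c where "distinct [a, b, c]" "g = cyc [a, b, c]" "i \<in> {a, b, c}" "j \<in> {a, b, c}"
    proof (elim disjE bexE)
      fix k assume "k \<in> UNIV - {i, j}" "g = cyc [i, j, k]"
      with assms show thesis by (intro that[of i j k]) auto
    next
      fix k assume "k \<in> UNIV - {i, j}" "g = cyc [i, k, j]"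
      with assms show thesis by (intro that[of i k j]) auto
    qed
    moreover from this have "ap g i \<noteq> i" "ap g j \<noteq> j" by (auto simp: apply_cyc3)
    ultimately show "cycle3_type i j g" unfolding cycle3_type_def by blast
  qed
  ultimately show ?thesis by auto
qed

lemma lookup_coeff_double:
  fixes i j :: "'n::finite"
  assumes "i \<noteq> j" shows "coef (coeff_double i j) g = of_bool (double_type i j g)"
proof -
  let ?S = "{(k, l). k \<notin> {i, j} \<and> l \<notin> {i, j} \<and> k \<noteq> l}"
  have inj: "inj_on (\<lambda>(k, l). cyc [i, k] * cyc [j, l] :: 'n perm) ?S"
  proof (rule inj_onI)
    fix x y assume xy: "x \<in> ?S" "y \<in> ?S"
      and e: "(\<lambda>(k, l). cyc [i, k] * cyc [j, l] :: 'n perm) x = (\<lambda>(k, l). cyc [i, k] * cyc [j, l]) y"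
    obtain k l k' l' where kl: "x = (k, l)" "y = (k', l')" by (cases x, cases y)
    then have d: "distinct [i, j, k, l]" "distinct [i, j, k', l']" using xy assms by auto
    note * = apply_cyc22[OF d(1)] apply_cyc22[OF d(2)]
    have "cyc [i, k] * cyc [j, l] = (cyc [i, k'] * cyc [j, l'] :: 'n perm)" using e kl by simp
    then show "x = y"
      using *(1)[of i] *(2)[of i] *(1)[of j] *(2)[of j] d kl by (simp split: if_splits)
  qed
  have "coeff_double i j = (\<Sum>x\<in>?S. gelt (case x of (k, l) \<Rightarrow> cyc [i, k] * cyc [j, l]))"
    unfolding coeff_double_def by (rule sum.cong) auto
  then have "coef (coeff_double i j) g = of_bool (\<exists>x\<in>?S. g = (case x of (k, l) \<Rightarrow> cyc [i, k] * cyc [j, l]))"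
    using lookup_sum_gelt[OF inj, of g] by simp
  moreover have "double_type i j g \<longleftrightarrow> (\<exists>x\<in>?S. g = (case x of (k, l) \<Rightarrow> cyc [i, k] * cyc [j, l]))" (is "_ = ?R")
  proof
    assume "double_type i j g"
    then obtain a b c d where d: "distinct [a, b, c, d]" and g: "g = cyc [a, b] * cyc [c, d]"
      and m: "ap g i \<noteq> i" "ap g j \<noteq> j" and n: "ap g i \<noteq> j"
      unfolding double_type_def by blast
    then have ij: "i \<in> {a, b, c, d}" "j \<in> {a, b, c, d}" by (auto simp: apply_times apply_cyc2 split: if_splits)
    have *: "g = cyc [x, y] * cyc [z, w]" if "(x, y, z, w) \<in> {(a, b, c, d), (a, b, d, c), (b, a, c, d),
        (b, a, d, c), (c, d, a, b), (c, d, b, a), (d, c, a, b), (d, c, b, a)}" for x y z w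
      using that d g by (auto simp: cyc2_commute[of b a] cyc2_commute[of d c] cyc22_commute)
    have "ap g a = b" "ap g b = a" "ap g c = d" "ap g d = c"
      using d by (auto simp: g apply_times apply_cyc2)
    then have "\<exists>k l. (i, k, j, l) \<in> {(a, b, c, d), (a, b, d, c), (b, a, c, d), (b, a, d, c), (c, d, a, b),
        (c, d, b, a), (d, c, a, b), (d, c, b, a)}"
      using ij n assms by auto
    then obtain k l where kl: "(i, k, j, l) \<in> {(a, b, c, d), (a, b, d, c), (b, a, c, d), (b, a, d, c), (c,
        d, a, b), (c, d, b, a), (d, c, a, b), (d, c, b, a)}" by blast
    from *[OF kl] kl d have "g = cyc [i, k] * cyc [j, l]" "(k, l) \<in> ?S" by auto
    then show ?R by (intro bexI[of _ "(k, l)"]) simp_all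
  next
    assume ?R
    then obtain x where x: "x \<in> ?S" "g = (\<lambda>(k, l). cyc [i, k] * cyc [j, l]) x" by blast
    obtain k l where "x = (k, l)" by (cases x)
    with x assms have "distinct [i, k, j, l]" "g = cyc [i, k] * cyc [j, l]" by auto
    moreover from this have "ap g i = k" "ap g j = l" by (auto simp: apply_times apply_cyc2)
    ultimately have "\<exists>a b c d. distinct [a, b, c, d] \<and> g = cyc [a, b] * cyc [c, d]"
        "ap g i \<noteq> i" "ap g j \<noteq> j" "ap g i \<noteq> j" by (blast, auto)
    then show "double_type i j g" unfolding double_type_def by blast
  qed
  ultimately show ?thesis by simp
qed

lemma pbw_coeffs_indicator:
  fixes Q :: "'n::finite \<Rightarrow> 'n \<Rightarrow> 'n perm \<Rightarrow> bool"
  assumes lk: "\<And>i j g. i \<noteq> j \<Longrightarrow> coef (c i j) g = of_bool (Q i j g)"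
    and sym: "\<And>i j g. i \<noteq> j \<Longrightarrow> Q i j g \<Longrightarrow> Q j i g"
    and equi: "\<And>i j g s. i \<noteq> j \<Longrightarrow> Q i j g \<Longrightarrow> Q (ap s i) (ap s j) (s * g * inverse s)"
    and jac: "\<And>i j k g x. i \<noteq> j \<Longrightarrow> j \<noteq> k \<Longrightarrow> i \<noteq> k \<Longrightarrow>
      of_bool (Q i j g) * (of_bool (ap g k = x) - of_bool (k = x)) +
      of_bool (Q j k g) * (of_bool (ap g i = x) - of_bool (i = x)) +
      of_bool (Q k i g) * (of_bool (ap g j = x) - of_bool (j = x)) = (0 :: complex)"
  shows "pbw_coeffs (coeffs_of c)"
proof
  fix i j k x :: 'n and g h :: "'n perm"
  show "coeffs_of c i i = 0" by (simp add: coeffs_of_def)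
  show "coeffs_of c i j = coeffs_of c j i"
    by (rule poly_mapping_eqI) (use sym in \<open>auto simp: coeffs_of_def lk\<close>)
  have "Q (ap g i) (ap g j) (g * h * inverse g) \<longleftrightarrow> Q i j h" if "i \<noteq> j"
    using equi[of "ap g i" "ap g j" "g * h * inverse g" "inverse g"] equi[of i j h g] that
    by (auto simp: apply_inj mult.assoc)
  then show "coef (coeffs_of c (ap g i) (ap g j)) (g * h * inverse g) = coef (coeffs_of c i j) h"
    by (simp add: coeffs_of_def apply_inj lk)
  show "i \<noteq> j \<Longrightarrow> j \<noteq> k \<Longrightarrow> i \<noteq> k \<Longrightarrow>
      coef (coeffs_of c i j) g * (of_bool (ap g k = x) - of_bool (k = x)) +
      coef (coeffs_of c j k) g * (of_bool (ap g i = x) - of_bool (i = x)) +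
      coef (coeffs_of c k i) g * (of_bool (ap g j = x) - of_bool (j = x)) = 0"
    using jac[of i j k g x] by (simp add: coeffs_of_def lk)
qed

lemma pbw_coeffs_coeff_one: "pbw_coeffs (coeffs_of coeff_one)"
  by (rule pbw_coeffs_indicator[OF lookup_coeff_one]) auto

lemma pbw_coeffs_coeff_swap: "pbw_coeffs (coeffs_of coeff_swap)"
proof (rule pbw_coeffs_indicator[OF lookup_coeff_swap])
  fix i j k x :: 'a and g s :: "'a perm"
  show "g = cyc [i, j] \<Longrightarrow> g = cyc [j, i]" by (simp add: cyc2_commute)
  show "i \<noteq> j \<Longrightarrow> g = cyc [i, j] \<Longrightarrow> s * g * inverse s = cyc [ap s i, ap s j]"
    by (simp add: conj_cyc)
  have t: "of_bool (g = cyc [u, w]) * (of_bool (ap g z = x) - of_bool (z = x)) = (0 :: complex)"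
    if "z \<noteq> u" "z \<noteq> w" for u w z
  proof (cases "g = cyc [u, w]")
    case True
    then have "ap g z = z" using that by (simp add: apply_cyc2)
    then show ?thesis by simp
  qed simp
  assume "i \<noteq> j" "j \<noteq> k" "i \<noteq> k"
  then show "of_bool (g = cyc [i, j]) * (of_bool (ap g k = x) - of_bool (k = x)) +
      of_bool (g = cyc [j, k]) * (of_bool (ap g i = x) - of_bool (i = x)) +
      of_bool (g = cyc [k, i]) * (of_bool (ap g j = x) - of_bool (j = x)) = (0 :: complex)"
    using t[of k i j] t[of i j k] t[of j k i] by simp
qed

lemma conj_apply: "ap (s * g * inverse s) (ap s i) = ap s (ap g i)"
  by (simp add: apply_times)

lemma conj_mult: "s * (g * h) * inverse s = (s * g * inverse s) * (s * h * inverse s)" for s :: "'a perm"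
  by (simp add: mult.assoc)

lemma pbw_coeffs_coeff_transp: "pbw_coeffs (coeffs_of coeff_transp)"
proof (rule pbw_coeffs_indicator[OF lookup_coeff_transp])
  fix i j k x :: 'a and g s :: "'a perm"
  show "transp_type i j g \<Longrightarrow> transp_type j i g" by (auto simp: transp_type_def)
  show "transp_type (ap s i) (ap s j) (s * g * inverse s)" if "transp_type i j g"
  proof -
    from that obtain a b where ab: "distinct [a, b]" "g = cyc [a, b]" unfolding transp_type_def by blast
    then have "s * g * inverse s = cyc [ap s a, ap s b]" "distinct [ap s a, ap s b]"
      by (auto simp: conj_cyc apply_inj)
    with that show ?thesis unfolding transp_type_def conj_apply by (auto simp only: apply_inj)
  qed
  assume ne: "i \<noteq> j" "j \<noteq> k" "i \<noteq> k"
  show "of_bool (transp_type i j g) * (of_bool (ap g k = x) - of_bool (k = x)) +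
      of_bool (transp_type j k g) * (of_bool (ap g i = x) - of_bool (i = x)) +
      of_bool (transp_type k i g) * (of_bool (ap g j = x) - of_bool (j = x)) = (0 :: complex)"
  proof (cases "\<exists>a b. distinct [a, b] \<and> g = cyc [a, b]")
    case True
    then obtain a b where ab: "a \<noteq> b" "g = cyc [a, b]" by auto
    have g: "ap g y = (if y = a then b else if y = b then a else y)" for y
      by (simp add: ab apply_cyc2)
    have Q: "transp_type u w g \<longleftrightarrow> (ap g u = u) \<noteq> (ap g w = w)" for u w
      using True by (simp add: transp_type_def)
    show ?thesis using ab(1) ne unfolding Q g by auto
  next
    case False
    then have "\<not> transp_type u w g" for u w by (auto simp: transp_type_def)
    then show ?thesis by simp
  qed
qed

lemma pbw_coeffs_coeff_cycle3: "pbw_coeffs (coeffs_of coeff_cycle3)"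
proof (rule pbw_coeffs_indicator[OF lookup_coeff_cycle3])
  fix i j k x :: 'a and g s :: "'a perm"
  show "cycle3_type i j g \<Longrightarrow> cycle3_type j i g" by (auto simp: cycle3_type_def)
  show "cycle3_type (ap s i) (ap s j) (s * g * inverse s)" if "cycle3_type i j g"
  proof -
    from that obtain a b c where ab: "distinct [a, b, c]" "g = cyc [a, b, c]" unfolding cycle3_type_def by blast
    then have "s * g * inverse s = cyc [ap s a, ap s b, ap s c]" "distinct [ap s a, ap s b, ap s c]"
      by (auto simp: conj_cyc apply_inj)
    with that show ?thesis unfolding cycle3_type_def conj_apply by (auto simp only: apply_inj)
  qed
  assume ne: "i \<noteq> j" "j \<noteq> k" "i \<noteq> k"
  show "of_bool (cycle3_type i j g) * (of_bool (ap g k = x) - of_bool (k = x)) +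
      of_bool (cycle3_type j k g) * (of_bool (ap g i = x) - of_bool (i = x)) +
      of_bool (cycle3_type k i g) * (of_bool (ap g j = x) - of_bool (j = x)) = (0 :: complex)"
  proof (cases "\<exists>a b c. distinct [a, b, c] \<and> g = cyc [a, b, c]")
    case True
    then obtain a b c where ab: "distinct [a, b, c]" "g = cyc [a, b, c]" by auto
    have g: "ap g y = (if y = a then b else if y = b then c else if y = c then a else y)" for y
      using ab by (simp add: apply_cyc3)
    have Q: "cycle3_type u w g \<longleftrightarrow> ap g u \<noteq> u \<and> ap g w \<noteq> w" for u w
      using True by (simp add: cycle3_type_def)
    show ?thesis using ab(1) ne unfolding Q g by auto
  next
    case False
    then have "\<not> cycle3_type u w g" for u w by (auto simp: cycle3_type_def)
    then show ?thesis by simp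
  qed
qed

text \<open>
  If \<open>g\<close> fixes one of the letters, only the term with the displacement of that letter can be
  present, and it is zero. Otherwise all three lie in the two transpositions, so \<open>g\<close> exchanges
  two of them, and the two terms with their displacements cancel.
\<close>

lemma pbw_coeffs_coeff_double: "pbw_coeffs (coeffs_of coeff_double)"
proof (rule pbw_coeffs_indicator[OF lookup_coeff_double])
  fix i j k x :: 'a and g s :: "'a perm"
  show "double_type i j g \<Longrightarrow> double_type j i g"
  proof -
    assume q: "double_type i j g"
    then obtain a b c d where "distinct [a, b, c, d]" "g = cyc [a, b] * cyc [c, d]"
        unfolding double_type_def by blast
    then have "ap g (ap g y) = y" for y by (auto simp: apply_times apply_cyc2)
    then show ?thesis using q unfolding double_type_def by metis
  qed
  show "double_type (ap s i) (ap s j) (s * g * inverse s)" if "double_type i j g"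
  proof -
    from that obtain a b c d where ab: "distinct [a, b, c, d]" "g = cyc [a, b] * cyc [c, d]"
        unfolding double_type_def by blast
    then have "s * g * inverse s = cyc [ap s a, ap s b] * cyc [ap s c, ap s d]"
      "distinct [ap s a, ap s b, ap s c, ap s d]"
      unfolding ab(2) conj_mult using ab(1) by (simp_all add: conj_cyc apply_inj)
    with that show ?thesis unfolding double_type_def conj_apply by (auto simp only: apply_inj)
  qed
  assume ne: "i \<noteq> j" "j \<noteq> k" "i \<noteq> k"
  show "of_bool (double_type i j g) * (of_bool (ap g k = x) - of_bool (k = x)) +
      of_bool (double_type j k g) * (of_bool (ap g i = x) - of_bool (i = x)) +
      of_bool (double_type k i g) * (of_bool (ap g j = x) - of_bool (j = x)) = (0 :: complex)"
  proof (cases "\<exists>a b c d. distinct [a, b, c, d] \<and> g = cyc [a, b] * cyc [c, d]")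
    case True
    then have Q: "double_type u w g \<longleftrightarrow> ap g u \<noteq> u \<and> ap g w \<noteq> w \<and> ap g u \<noteq> w" for u w
      by (simp add: double_type_def)
    from True obtain a b c d where ab: "distinct [a, b, c, d]" "g = cyc [a, b] * cyc [c, d]" by blast
    have inv: "ap g (ap g y) = y" for y using ab by (auto simp: apply_times apply_cyc2)
    have four: "u \<in> {a, b, c, d}" if "ap g u \<noteq> u" for u
      using that ab by (auto simp: apply_times apply_cyc2 split: if_splits)
    have pair: "ap g i = j \<or> ap g j = k \<or> ap g i = k"
      if "ap g i \<noteq> i" "ap g j \<noteq> j" "ap g k \<noteq> k"
      using four[OF that(1)] four[OF that(2)] four[OF that(3)] ne ab by (auto simp: apply_times apply_cyc2)
    show ?thesis
    proof (cases "ap g i \<noteq> i \<and> ap g j \<noteq> j \<and> ap g k \<noteq> k")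
      case True
      with pair consider "ap g i = j" "ap g j = i" | "ap g j = k" "ap g k = j" | "ap g i = k" "ap g k = i"
        using inv by metis
      then show ?thesis unfolding Q by cases (use True ne inv in \<open>auto simp: apply_inj\<close>)
    next
      case False
      then have "ap g i = i \<or> ap g j = j \<or> ap g k = k" by blast
      then show ?thesis unfolding Q by (elim disjE) simp_all
    qed
  next
    case False
    then have "\<not> double_type u w g" for u w by (auto simp: double_type_def)
    then show ?thesis by simp
  qed
qed

section \<open>Classification of the coefficients\<close>

lemma pbw_coeffs_add:
  assumes "pbw_coeffs K" "pbw_coeffs L" shows "pbw_coeffs (\<lambda>i j. K i j + L i j)"
proof
  interpret K: pbw_coeffs K by fact
  interpret L: pbw_coeffs L by fact
  fix i j k x :: 'a and g h :: "'a perm"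
  show "K i i + L i i = 0" by (simp add: K.diag L.diag)
  show "K i j + L i j = K j i + L j i" by (simp add: K.sym[of i j] L.sym[of i j])
  show "coef (K (ap g i) (ap g j) + L (ap g i) (ap g j)) (g * h * inverse g) = coef (K i j + L i j) h"
    by (simp add: lookup_add K.equivariant L.equivariant)
  show "i \<noteq> j \<Longrightarrow> j \<noteq> k \<Longrightarrow> i \<noteq> k \<Longrightarrow>
      coef (K i j + L i j) g * (of_bool (ap g k = x) - of_bool (k = x)) +
      coef (K j k + L j k) g * (of_bool (ap g i = x) - of_bool (i = x)) +
      coef (K k i + L k i) g * (of_bool (ap g j = x) - of_bool (j = x)) = 0"
    using K.jacobi[of i j k g x] L.jacobi[of i j k g x] by (simp add: lookup_add algebra_simps)
qed

lemma pbw_coeffs_scale: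
  assumes "pbw_coeffs K" shows "pbw_coeffs (\<lambda>i j. pm_scale r (K i j))"
proof
  interpret K: pbw_coeffs K by fact
  fix i j k x :: 'a and g h :: "'a perm"
  show "pm_scale r (K i i) = 0" by (simp add: K.diag)
  show "pm_scale r (K i j) = pm_scale r (K j i)" by (simp add: K.sym[of i j])
  show "coef (pm_scale r (K (ap g i) (ap g j))) (g * h * inverse g) = coef (pm_scale r (K i j)) h"
    by (simp add: K.equivariant)
  show "i \<noteq> j \<Longrightarrow> j \<noteq> k \<Longrightarrow> i \<noteq> k \<Longrightarrow>
      coef (pm_scale r (K i j)) g * (of_bool (ap g k = x) - of_bool (k = x)) +
      coef (pm_scale r (K j k)) g * (of_bool (ap g i = x) - of_bool (i = x)) +
      coef (pm_scale r (K k i)) g * (of_bool (ap g j = x) - of_bool (j = x)) = 0"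
    using K.jacobi[of i j k g x] unfolding lookup_pm_scale mult.assoc distrib_left[symmetric] by simp
qed

context pbw_coeffs
begin

text \<open>
  Compare coefficients in the Jacobi identity at the letters \<open>g k\<close> and \<open>k\<close>: the contribution of
  the displacement of \<open>k\<close> has to be cancelled by those of \<open>i\<close> and \<open>j\<close>.
\<close>

lemma moved_outside:
  assumes "i \<noteq> j" "k \<notin> {i, j}" "coef (K i j) g \<noteq> 0" "ap g k \<noteq> k"
  shows "(ap g k = i \<or> ap g k = j) \<and> (ap g i = k \<or> ap g j = k)"
proof -
  have ne: "i \<noteq> j" "j \<noteq> k" "i \<noteq> k" using assms by auto
  have "ap g k = i \<or> ap g k = j"
    using jacobi[OF ne, of g "ap g k"] assms by (auto simp: apply_inj)
  moreover have "ap g i = k \<or> ap g j = k"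
    using jacobi[OF ne, of g k] assms by (auto simp: of_bool_def split: if_splits)
  ultimately show ?thesis by blast
qed

lemma support_unmoved:
  assumes "i \<noteq> j" "coef (K i j) g \<noteq> 0" "\<And>k. k \<notin> {i, j} \<Longrightarrow> ap g k = k"
  shows "g = 1 \<or> g = cyc [i, j]"
proof -
  have stays: "ap g x \<in> {i, j}" if "x \<in> {i, j}" for x
  proof (rule ccontr)
    assume a: "ap g x \<notin> {i, j}"
    from assms(3)[OF this] have "ap g x = x" by (simp only: apply_inj)
    with a that show False by simp
  qed
  have "ap g i \<noteq> ap g j" using assms(1) by (simp add: apply_inj)
  then consider "ap g i = i" "ap g j = j" | "ap g i = j" "ap g j = i"
    using stays[of i] stays[of j] by auto
  then show ?thesis
  proof cases
    case 1
    have "ap g x = x" for x using 1 assms(3)[of x] by (cases "x \<in> {i, j}") auto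
    then show ?thesis by (simp add: perm_eq_iff)
  next
    case 2
    have "ap g x = ap (cyc [i, j]) x" for x
      using 2 assms(1) assms(3)[of x] by (cases "x \<in> {i, j}") (auto simp: apply_cyc2)
    then show ?thesis by (simp add: perm_eq_iff)
  qed
qed

text \<open>
  The first two cases are \<open>g i = k\<close>, where \<open>j\<close> is fixed or is exchanged with one more letter. If
  \<open>g j = k\<close>, then \<open>g\<close> is a 3-cycle, or the 4-cycle \<open>(i l j k)\<close> with \<open>l = g i\<close>; the latter is
  excluded by the coefficients of the Jacobi identity at \<open>l\<close> and at \<open>i\<close>.
\<close>

lemma support_moved:
  assumes ij: "i \<noteq> j" and nz: "coef (K i j) g \<noteq> 0" and k: "k \<notin> {i, j}" "ap g k = i"
  shows "g = cyc [i, k] \<or> (\<exists>l. l \<notin> {i, j, k} \<and> g = cyc [i, k] * cyc [j, l]) \<or> g = cyc [i, j, k]"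
proof -
  have gk: "ap g k \<noteq> k" using k by auto
  note out = moved_outside[OF ij _ nz]
  have pre: "ap g i = k \<or> ap g j = k" using out[OF k(1) gk] by blast
  have inj: "ap g x = ap g y \<Longrightarrow> x = y" for x y by (simp add: apply_inj)
  show ?thesis
  proof (cases "ap g i = k")
    case gi: True
    show ?thesis
    proof (cases "ap g j = j")
      case True
      have "ap g x = x" if "x \<notin> {i, j, k}" for x
      proof (rule ccontr)
        assume "ap g x \<noteq> x"
        with out[of x] that gi True inj[of x k] inj[of x j] k show False by auto
      qed
      then have "ap g x = ap (cyc [i, k]) x" for x
        using gi True k ij by (cases "x \<in> {i, j, k}") (auto simp: apply_cyc2)
      then have "g = cyc [i, k]" by (rule perm_eqI)
      then show ?thesis by blast
    next
      case False
      define l where "l = ap g j"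
      have l: "l \<notin> {i, j, k}" using False inj[of j k] inj[of j i] k gi ij unfolding l_def by auto
      have "ap g l \<noteq> l" using inj[of l j] l unfolding l_def by auto
      then have gl: "ap g l = j" using out[of l] l k inj[of l k] by auto
      have "ap g x = x" if "x \<notin> {i, j, k, l}" for x
      proof (rule ccontr)
        assume "ap g x \<noteq> x"
        with out[of x] that inj[of x k] inj[of x l] k gl show False by auto
      qed
      moreover have "distinct [i, j, k, l]" using ij k l by auto
      ultimately have "ap g x = ap (cyc [i, k] * cyc [j, l]) x" for x
        using gi gl k l_def by (cases "x \<in> {i, j, k, l}") (auto simp: apply_times apply_cyc2)
      then have "g = cyc [i, k] * cyc [j, l]" by (rule perm_eqI)
      then show ?thesis using l by blast
    qed
  next
    case False
    then have gj: "ap g j = k" using pre by blast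
    have gi: "ap g i = j"
    proof (rule ccontr)
      assume a: "ap g i \<noteq> j"
      \<comment> \<open>The 4-cycle \<open>(i l j k)\<close>.\<close>
      define l where "l = ap g i"
      have l: "l \<notin> {i, j, k}" using a False inj[of i k] k ij unfolding l_def by auto
      have ne: "i \<noteq> j" "j \<noteq> k" "i \<noteq> k" using ij k by auto
      have "coef (K j k) g = 0"
        using jacobi[OF ne, of g l] l k gj by (auto simp: l_def)
      then have "coef (K i j) g = 0"
        using jacobi[OF ne, of g i] l k gj ne by (auto simp: l_def)
      then show False using nz by simp
    qed
    have "ap g x = x" if "x \<notin> {i, j, k}" for x
    proof (rule ccontr)
      assume "ap g x \<noteq> x"
      with out[of x] that inj[of x k] inj[of x i] k gi show False by auto
    qed
    moreover have d: "distinct [i, j, k]" using ij k by auto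
    ultimately have "ap g x = ap (cyc [i, j, k]) x" for x
      using gi gj k by (cases "x \<in> {i, j, k}") (auto simp: apply_cyc3[OF d])
    then have "g = cyc [i, j, k]" by (rule perm_eqI)
    then show ?thesis by blast
  qed
qed

lemma lookup_transport:
  assumes "distinct xs" "distinct ys" "length xs = length ys"
    and "\<And>s :: 'n perm. map (ap s) xs = ys \<Longrightarrow> ap s i = i' \<and> ap s j = j' \<and> s * g * inverse s = g'"
  shows "coef (K i' j') g' = coef (K i j) g"
proof -
  obtain s :: "'n perm" where "map (ap s) xs = ys" using perm_exists_map assms by blast
  then show ?thesis using equivariant[of s i j g] assms(4)[of s] by simp
qed

text \<open>
  By equivariance the five values that vanish are representative for all permutations that
  \<open>moved_outside\<close>, \<open>support_unmoved\<close> and \<open>support_moved\<close> leave over; the permutations \<open>(jk)\<close>,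
  \<open>(ikj)\<close> are covered by exchanging \<open>i\<close> and \<open>j\<close>.
\<close>

lemma eq_zero_if_five_zero:
  assumes d: "distinct [a, b, c, d]"
    and z: "coef (K a b) 1 = 0" "coef (K a b) (cyc [a, b]) = 0"
      "coef (K a b) (cyc [a, c]) = 0" "coef (K a b) (cyc [a, c] * cyc [b, d]) = 0"
      "coef (K a b) (cyc [a, b, c]) = 0"
  shows "K i j = 0"
proof (rule poly_mapping_eqI, rule ccontr)
  fix g assume "coef (K i j) g \<noteq> coef 0 g"
  then have nz: "coef (K i j) g \<noteq> 0" by simp
  have ij: "i \<noteq> j" using nz diag by auto
  have 1: "coef (K i j) 1 = 0" if "i \<noteq> j" for i j
    using lookup_transport[of "[a, b]" "[i, j]" a i b j 1 1] that d z by auto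
  have 2: "coef (K i j) (cyc [i, j]) = 0" if "i \<noteq> j" for i j
    using lookup_transport[of "[a, b]" "[i, j]" a i b j "cyc [a, b]" "cyc [i, j]"] that d z by (auto simp:
        conj_cyc)
  have 3: "coef (K i j) (cyc [i, k]) = 0" "coef (K i j) (cyc [i, j, k]) = 0" if "distinct [i, j, k]" for i j k
    using lookup_transport[of "[a, b, c]" "[i, j, k]" a i b j "cyc [a, c]" "cyc [i, k]"]
      lookup_transport[of "[a, b, c]" "[i, j, k]" a i b j "cyc [a, b, c]" "cyc [i, j, k]"] that d z
          by (auto simp: conj_cyc)
  have 4: "coef (K i j) (cyc [i, k] * cyc [j, l]) = 0" if "distinct [i, j, k, l]" for i j k l
    using lookup_transport[of "[a, b, c, d]" "[i, j, k, l]" a i b j "cyc [a, c] * cyc [b, d]"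
        "cyc [i, k] * cyc [j, l]"] that d z
    by (auto simp: conj_cyc conj_mult simp del: mult.assoc)
  have moved: False if "i \<noteq> j" "coef (K i j) g \<noteq> 0" "k \<notin> {i, j}" "ap g k = i" for i j k
  proof -
    have "distinct [i, j, k]" using that by auto
    note zero = 3[OF this]
    from support_moved[OF that] show False
    proof (elim disjE exE conjE)
      fix l assume l: "l \<notin> {i, j, k}" "g = cyc [i, k] * cyc [j, l]"
      have "distinct [i, j, k, l]" using that l by auto
      from 4[OF this] show False using that(2) l(2) by simp
    qed (use zero that(2) in simp_all)
  qed
  show False
  proof (cases "\<forall>k. k \<notin> {i, j} \<longrightarrow> ap g k = k")
    case True
    then show False using support_unmoved[OF ij nz] 1[OF ij] 2[OF ij] nz by auto
  next
    case False
    then obtain k where k: "k \<notin> {i, j}" "ap g k \<noteq> k" by blast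
    then show False using moved_outside[OF ij k(1) nz k(2)] moved[OF ij nz k(1)] moved[of j i k] ij nz
        sym[of i j] by auto
  qed
qed
end

definition coeff_comb :: "(nat \<Rightarrow> complex) \<Rightarrow> 'n::finite \<Rightarrow> 'n \<Rightarrow> 'n perm \<Rightarrow>\<^sub>0 complex"
  where "coeff_comb u i j = pm_scale (u 1) (coeffs_of coeff_one i j)
      + pm_scale (u 2) (coeffs_of coeff_swap i j) + pm_scale (u 3) (coeffs_of coeff_transp i j)
    + pm_scale (u 4) (coeffs_of coeff_double i j) + pm_scale (u 5) (coeffs_of coeff_cycle3 i j)"

lemma pbw_coeffs_coeff_comb: "pbw_coeffs (coeff_comb u)"
  unfolding coeff_comb_def[abs_def]
  by (intro pbw_coeffs_add pbw_coeffs_scale pbw_coeffs_coeff_one pbw_coeffs_coeff_swap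
      pbw_coeffs_coeff_transp pbw_coeffs_coeff_double pbw_coeffs_coeff_cycle3)

lemma cycle3_type_pair:
  assumes "i \<noteq> j" "cycle3_type i j g" shows "(ap g i = j) \<noteq> (ap g j = i)"
proof -
  obtain a b c where d: "distinct [a, b, c]" and g: "g = cyc [a, b, c]" using assms(2)
      unfolding cycle3_type_def by blast
  have *: "ap g y = (if y = a then b else if y = b then c else if y = c then a else y)" for y
    using d by (simp add: g apply_cyc3)
  have "ap g i \<noteq> i" "ap g j \<noteq> j" using assms(2) by (auto simp: cycle3_type_def)
  then have "i \<in> {a, b, c}" "j \<in> {a, b, c}" by (auto simp: * split: if_splits)
  then show ?thesis using d assms(1) by (auto simp: * )
qed

text \<open>
  The five types are distinguished by whether \<open>a\<close> and \<open>b\<close> are fixed, exchanged, or mapped to each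
  other, so the coefficients can be read off.
\<close>

lemma five_values:
  fixes a b c d :: "'n::finite"
  assumes d: "distinct [a, b, c, d]"
  shows "coef (coeff_comb u a b) 1 = u 1" "coef (coeff_comb u a b) (cyc [a, b]) = u 2"
      "coef (coeff_comb u a b) (cyc [a, c]) = u 3" "coef (coeff_comb u a b) (cyc [a, c] * cyc [b, d]) = u 4"
      "coef (coeff_comb u a b) (cyc [a, b, c]) = u 5"
proof -
  note lk = coeff_comb_def coeffs_of_def lookup_add lookup_coeff_one lookup_coeff_swap lookup_coeff_transp
      lookup_coeff_double lookup_coeff_cycle3
  have ne: "a \<noteq> b" using d by auto
  show "coef (coeff_comb u a b) 1 = u 1"
  proof -
    have "1 \<noteq> (cyc [a, b] :: 'n perm)" "\<not> transp_type a b 1" "\<not> double_type a b 1" "\<not> cycle3_type a b 1"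
      using ne by (auto simp: transp_type_def double_type_def cycle3_type_def perm_eq_iff apply_cyc2)
    then show ?thesis by (simp add: lk ne)
  qed
  show "coef (coeff_comb u a b) (cyc [a, b]) = u 2"
  proof -
    let ?g = "cyc [a, b]"
    have g: "ap ?g a = b" "ap ?g b = a" by (simp_all add: apply_cyc2)
    then have "?g \<noteq> 1" "\<not> transp_type a b ?g" "\<not> double_type a b ?g" "\<not> cycle3_type a b ?g"
      using ne cycle3_type_pair[OF ne, of ?g] by (auto simp: transp_type_def double_type_def)
    then show ?thesis by (simp add: lk ne)
  qed
  show "coef (coeff_comb u a b) (cyc [a, c]) = u 3"
  proof -
    let ?g = "cyc [a, c]"
    have g: "ap ?g a = c" "ap ?g b = b" "ap (cyc [a, b]) a = b" using d by (auto simp: apply_cyc2)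
    then have "?g \<noteq> 1" "?g \<noteq> cyc [a, b]" "\<not> double_type a b ?g" "\<not> cycle3_type a b ?g"
      using d by (auto simp: double_type_def cycle3_type_def)
    moreover have "transp_type a b ?g" unfolding transp_type_def using d g by fastforce
    ultimately show ?thesis by (simp add: lk ne)
  qed
  show "coef (coeff_comb u a b) (cyc [a, c] * cyc [b, d]) = u 4"
  proof -
    let ?g = "cyc [a, c] * cyc [b, d]"
    have g: "ap ?g a = c" "ap ?g b = d" "ap (cyc [a, b]) a = b" using d by (auto simp: apply_times apply_cyc2)
    then have "?g \<noteq> 1" "?g \<noteq> cyc [a, b]" "\<not> transp_type a b ?g" "\<not> cycle3_type a b ?g"
      using d cycle3_type_pair[OF ne, of ?g] by (auto simp: transp_type_def)
    moreover have "distinct [a, c, b, d]" using d by auto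
    then have "double_type a b ?g" unfolding double_type_def using d g by fastforce
    ultimately show ?thesis by (simp add: lk ne)
  qed
  show "coef (coeff_comb u a b) (cyc [a, b, c]) = u 5"
  proof -
    let ?g = "cyc [a, b, c]"
    have g: "ap ?g a = b" "ap ?g b = c" "ap (cyc [a, b]) b = a" using d by (auto simp: apply_cyc2 apply_cyc3)
    then have "?g \<noteq> 1" "?g \<noteq> cyc [a, b]" "\<not> transp_type a b ?g" "\<not> double_type a b ?g"
      using d by (auto simp: transp_type_def double_type_def)
    moreover have "distinct [a, b, c]" using d by auto
    then have "cycle3_type a b ?g" unfolding cycle3_type_def using d g by fastforce
    ultimately show ?thesis by (simp add: lk ne)
  qed
qed

lemma four_distinct:
  assumes "card (UNIV :: 'n set) \<ge> 4" obtains a b c d where "distinct [a, b, c, d :: 'n]"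
proof -
  obtain T :: "'n set" where "card T = 4" "finite T" using assms obtain_subset_with_card_n by metis
  then obtain xs where "set xs = T" "distinct xs" using finite_distinct_list by blast
  then have "distinct xs" "length xs = 4" using distinct_card[of xs] \<open>card T = 4\<close> by auto
  then show thesis using that by (auto simp: length_Suc_conv numeral_eq_Suc)
qed

text \<open>
  Subtract the combination with the same five values; the difference satisfies the identities
  again and vanishes by \<open>eq_zero_if_five_zero\<close>.
\<close>

theorem pbw_coeffs_iff:
  fixes K :: "'n::finite \<Rightarrow> 'n \<Rightarrow> 'n perm \<Rightarrow>\<^sub>0 complex"
  assumes "card (UNIV :: 'n set) \<ge> 4"
  shows "pbw_coeffs K \<longleftrightarrow> (\<exists>u. K = coeff_comb u)"
proof
  assume K: "pbw_coeffs K"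
  obtain a b c d where d: "distinct [a, b, c, d :: 'n]" using four_distinct[OF assms] by blast
  define u :: "nat \<Rightarrow> complex" where "u n = (if n = 1 then coef (K a b) 1 else
      if n = 2 then coef (K a b) (cyc [a, b])
     else if n = 3 then coef (K a b) (cyc [a, c]) else if n = 4 then coef (K a b) (cyc [a, c] * cyc [b, d])
     else coef (K a b) (cyc [a, b, c]))" for n
  let ?L = "\<lambda>i j. K i j + pm_scale (- 1) (coeff_comb u i j)"
  have "pbw_coeffs ?L" by (intro pbw_coeffs_add pbw_coeffs_scale pbw_coeffs_coeff_comb K)
  then have "?L i j = 0" for i j
    by (rule pbw_coeffs.eq_zero_if_five_zero[OF _ d]) (auto simp:
        lookup_add lookup_minus five_values[OF d] u_def)
  then have "K i j = coeff_comb u i j" for i j using pm_scale_uminus(1)[of 1 "coeff_comb u i j"]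
      by (simp add: add_eq_0_iff2)
  then show "\<exists>u. K = coeff_comb u" by blast
qed (use pbw_coeffs_coeff_comb in blast)

section \<open>Bilinear maps and their values on the basis\<close>

locale permuted_basis =
  fixes sV :: "complex \<Rightarrow> 'v::ab_group_add \<Rightarrow> 'v" and v :: "'n::finite \<Rightarrow> 'v" and act :: "'n perm \<Rightarrow> 'v \<Rightarrow> 'v"
  assumes vector_space_V: "vector_space sV" and inj_v: "inj v"
    and indep_v: "\<not> Modules.module.dependent sV (range v)" and span_v: "Modules.module.span sV (range v) = UNIV"
    and act_v: "\<And>\<sigma> i. act \<sigma> (v i) = v (ap \<sigma> i)"
begin

interpretation V: vector_space sV by (rule vector_space_V)

interpretation VP: vector_space_pair sV "pm_scale :: complex \<Rightarrow> ('k \<Rightarrow>\<^sub>0 complex) \<Rightarrow> _"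
  by (intro vector_space_pair.intro V.vector_space_axioms) (unfold_locales, auto simp:
      pm_scale_add pm_scale_add_left)

lemma coord_v: "coord sV v (v j) i = (if i = j then 1 else 0)"
  using V.representation_basis[OF indep_v, of "v j"] inj_v by (auto simp: coord_def inj_eq)

lemma coord_add: "coord sV v (x + y) i = coord sV v x i + coord sV v y i"
  by (simp add: coord_def V.representation_add[OF indep_v] span_v)

lemma coord_scale: "coord sV v (sV r x) i = r * coord sV v x i"
  by (simp add: coord_def V.representation_scale[OF indep_v] span_v)

lemma tensor_act_eq: "tensor_act sV v act = perm_act"
proof (intro ext)
  fix g p
  have "tensor_incl sV v (v j) = tgen j" for j
    by (simp add: tensor_incl_def coord_v if_distrib[of "\<lambda>c. pm_scale c _"] cong: if_cong)
  then have "prod_list (map (\<lambda>i. tensor_incl sV v (act g (v i))) w) = mon (map (ap g) w) 1" for w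
    by (induction w) (simp_all add: act_v word_Cons zero_list_def flip: single_one)
  then show "tensor_act sV v act g p = perm_act g p"
    by (simp add: tensor_act_def perm_act_def lin_def)
qed

text \<open>
  The action on tensors permutes the letters, so the algebras in the definition are the ones
  considered before.
\<close>

lemma hecke_iff: "is_quantum_drinfeld_hecke sV v act sign_q \<kappa> \<longleftrightarrow> has_pbw_property (\<lambda>i j. \<kappa> (v i) (v j))"
proof -
  have I: "hecke_ideal sV v act sign_q \<kappa> = rel_ideal (\<lambda>i j. \<kappa> (v i) (v j))"
    by (simp add: hecke_ideal_def rel_ideal_def tensor_skew_def tensor_act_eq)
  have "hecke_filt sV v act sign_q \<kappa> = skew.filt (\<lambda>i j. \<kappa> (v i) (v j))"
    by (rule ext) (simp add: hecke_filt_def I tensor_skew_def tensor_act_eq hecke_filt)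
  then show ?thesis
    by (simp add: is_quantum_drinfeld_hecke_def has_pbw_property_def hecke_alg_def I tensor_skew_def
        tensor_act_eq sq_skew_def)
qed

lemma kappa_of_v: "kappa_of sV v c (v i) (v j) = coeffs_of c i j"
proof -
  have "kappa_of sV v c (v i) (v j) = (\<Sum>k\<in>UNIV. if k = i then (\<Sum>l\<in>UNIV - {k}.
      if l = j then c k l else 0) else 0)"
    unfolding kappa_of_def
    by (intro sum.cong refl) (auto simp: coord_v if_distrib[of "\<lambda>c. pm_scale c _"] cong: if_cong)
  then show ?thesis by (auto simp: coeffs_of_def)
qed

lemma linear_V_iff: "Vector_Spaces.linear sV pm_scale f \<longleftrightarrow>
    (\<forall>x y. f (x + y) = f x + f y) \<and> (\<forall>r x. f (sV r x) = pm_scale r (f x))"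
  using V.vector_space_axioms VP.vs2.vector_space_axioms V.module_axioms VP.vs2.module_axioms
  by (auto simp: Vector_Spaces.linear_def module_hom_def module_hom_axioms_def)

definition bilin :: "('v \<Rightarrow> 'v \<Rightarrow> 'n perm \<Rightarrow>\<^sub>0 complex) \<Rightarrow> bool" where
  "bilin \<kappa> \<longleftrightarrow> (\<forall>x. Vector_Spaces.linear sV pm_scale (\<kappa> x)) \<and> (\<forall>y. Vector_Spaces.linear sV pm_scale (\<lambda>x. \<kappa> x y))"

lemma bilin_kappa_of: "bilin (kappa_of sV v c)"
  unfolding bilin_def linear_V_iff kappa_of_def
  by (simp add: coord_add coord_scale distrib_left distrib_right pm_scale_add_left sum.distrib
      pm_scale_sum mult_ac)

lemma bilin_add: "bilin \<kappa> \<Longrightarrow> bilin \<kappa>' \<Longrightarrow> bilin (\<kappa> + \<kappa>')"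
  unfolding bilin_def linear_V_iff by (simp add: pm_scale_add algebra_simps)

lemma bilin_scale: "bilin \<kappa> \<Longrightarrow> bilin (kappa_scale r \<kappa>)"
  unfolding bilin_def linear_V_iff by (simp add: kappa_scale_def pm_scale_add mult.commute)

lemma bilin_eqI:
  assumes "bilin \<kappa>" "bilin \<kappa>'" "\<And>i j. \<kappa> (v i) (v j) = \<kappa>' (v i) (v j)" shows "\<kappa> = \<kappa>'"
proof (intro ext)
  fix x y
  have x: "x \<in> V.span (range v)" and y: "y \<in> V.span (range v)" by (simp_all add: span_v)
  have "\<kappa> (v i) y = \<kappa>' (v i) y" for i
  proof (rule VP.linear_eq_on[OF _ _ y])
    show "Vector_Spaces.linear sV pm_scale (\<kappa> (v i))" "Vector_Spaces.linear sV pm_scale (\<kappa>' (v i))"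
      using assms(1,2) by (simp_all add: bilin_def)
  qed (use assms(3) in blast)
  note * = this
  show "\<kappa> x y = \<kappa>' x y"
  proof (rule VP.linear_eq_on[OF _ _ x])
    show "Vector_Spaces.linear sV pm_scale (\<lambda>x. \<kappa> x y)" "Vector_Spaces.linear sV pm_scale (\<lambda>x. \<kappa>' x y)"
      using assms(1,2) by (simp_all add: bilin_def)
  qed (use * in blast)
qed

text \<open>
  As \<open>sign_q i i = 1\<close>, the value at \<open>(v\<^sub>i, v\<^sub>i)\<close> equals its negative.
\<close>

lemma admissible_iff: "kappa_admissible sV v sign_q \<kappa> \<longleftrightarrow> bilin \<kappa> \<and> (\<forall>i. \<kappa> (v i) (v i) = 0) \<and>
    (\<forall>i j. \<kappa> (v i) (v j) = \<kappa> (v j) (v i))"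
proof -
  have "p = pm_scale (- 1) p \<longleftrightarrow> p = 0" for p :: "'n perm \<Rightarrow>\<^sub>0 complex"
  proof
    assume e: "p = pm_scale (- 1) p"
    have "coef p k = 0" for k
      using arg_cong[OF e, of "\<lambda>p. coef p k"] by simp
    then show "p = 0" by (simp add: poly_mapping_eqI)
  qed simp
  then have "(\<forall>i j. \<kappa> (v i) (v j) = pm_scale (- sign_q i j) (\<kappa> (v j) (v i))) \<longleftrightarrow>
    (\<forall>i. \<kappa> (v i) (v i) = 0) \<and> (\<forall>i j. \<kappa> (v i) (v j) = \<kappa> (v j) (v i))"
    unfolding sign_q_def by (smt (verit) minus_minus pm_scale_one)
  then show ?thesis by (auto simp: kappa_admissible_def bilin_def)
qed

lemma qdh_maps_iff: "\<kappa> \<in> qdh_maps sV v act sign_q \<longleftrightarrow> bilin \<kappa> \<and> pbw_coeffs (\<lambda>i j. \<kappa> (v i) (v j))"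
proof -
  let ?K = "\<lambda>i j. \<kappa> (v i) (v j)"
  have "pbw_coeffs ?K \<longleftrightarrow> (\<forall>i. ?K i i = 0) \<and> (\<forall>i j. ?K i j = ?K j i) \<and> has_pbw_property ?K"
  proof
    assume a: "pbw_coeffs ?K"
    then show "(\<forall>i. ?K i i = 0) \<and> (\<forall>i j. ?K i j = ?K j i) \<and> has_pbw_property ?K"
      using pbw_coeffs.diag[OF a] pbw_coeffs.sym[OF a] pbw_coeffs.graded_isomorphic[OF a] by blast
  next
    assume "(\<forall>i. ?K i i = 0) \<and> (\<forall>i j. ?K i j = ?K j i) \<and> has_pbw_property ?K"
    then show "pbw_coeffs ?K" by (intro pbw_property_pbw_coeffs) blast+
  qed
  then show ?thesis by (auto simp: qdh_maps_def admissible_iff hecke_iff)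
qed

end

section \<open>The space of maps\<close>

lemma (in vector_space) family_basis:
  assumes "finite S" "\<And>u. (\<Sum>t\<in>S. scale (u t) (b t)) = 0 \<Longrightarrow> \<forall>t\<in>S. u t = 0"
  shows "inj_on b S" "independent (b ` S)" "span (b ` S) = range (\<lambda>u. \<Sum>t\<in>S. scale (u t) (b t))"
proof -
  show inj: "inj_on b S"
  proof (rule inj_onI, rule ccontr)
    fix s t assume st: "s \<in> S" "t \<in> S" "b s = b t" "s \<noteq> t"
    let ?u = "\<lambda>x. if x = s then 1 else if x = t then - 1 else 0"
    have "(\<Sum>x\<in>S. scale (?u x) (b x)) = (\<Sum>x\<in>S. (if x = s then b s else 0) - (if x = t then b t else 0))"
      by (intro sum.cong) (use st in auto)
    also have "\<dots> = 0" using st assms(1) by (simp add: sum_subtractf)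
    finally have "\<forall>x\<in>S. (?u x :: 'a) = 0" using assms(2)[of ?u] by blast
    then show False using st(1) by auto
  qed
  show "independent (b ` S)"
  proof (rule independent_if_scalars_zero)
    fix f x assume "(\<Sum>x\<in>b ` S. scale (f x) x) = 0" "x \<in> b ` S"
    then show "f x = 0" using assms(2)[of "\<lambda>t. f (b t)"] by (auto simp: sum.reindex[OF inj])
  qed (use assms(1) in auto)
  show "span (b ` S) = range (\<lambda>u. \<Sum>t\<in>S. scale (u t) (b t))"
  proof (intro equalityI span_minimal subsetI)
    fix x assume "x \<in> b ` S"
    then obtain s where s: "s \<in> S" "x = b s" by blast
    have "(\<Sum>t\<in>S. scale (if t = s then 1 else 0) (b t)) = (\<Sum>t\<in>S. if t = s then b s else 0)"
      by (intro sum.cong) auto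
    then have "x = (\<Sum>t\<in>S. scale (if t = s then 1 else 0) (b t))" using s assms(1) by simp
    then show "x \<in> range (\<lambda>u. \<Sum>t\<in>S. scale (u t) (b t))"
      by (rule range_eqI[of _ _ "\<lambda>t. if t = s then 1 else 0"])
  next
    show "subspace (range (\<lambda>u. \<Sum>t\<in>S. scale (u t) (b t)))"
    proof (rule subspaceI, goal_cases)
      case 1 show ?case by (rule range_eqI[of _ _ "\<lambda>t. 0"]) simp
    next
      case (2 x y)
      then obtain u w where "x = (\<Sum>t\<in>S. scale (u t) (b t))" "y = (\<Sum>t\<in>S. scale (w t) (b t))" by blast
      then show ?case by (intro range_eqI[of _ _ "\<lambda>t. u t + w t"]) (simp add: scale_left_distrib sum.distrib)
    next
      case (3 r x)
      then obtain u where "x = (\<Sum>t\<in>S. scale (u t) (b t))" by blast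
      then show ?case by (intro range_eqI[of _ _ "\<lambda>t. r * u t"]) (simp add: scale_sum_right)
    qed
  next
    fix x assume "x \<in> range (\<lambda>u. \<Sum>t\<in>S. scale (u t) (b t))"
    then show "x \<in> span (b ` S)" by (auto intro!: span_sum span_scale intro: span_base)
  qed
qed

theorem theorem6p9:
  fixes sV :: "complex \<Rightarrow> 'v::ab_group_add \<Rightarrow> 'v"
    and v :: "'n::finite \<Rightarrow> 'v"
    and act :: "'n perm \<Rightarrow> 'v \<Rightarrow> 'v"
    and q :: "'n \<Rightarrow> 'n \<Rightarrow> complex"
    and \<kappa>1 \<kappa>2 \<kappa>3 \<kappa>4 \<kappa>5 :: "'v \<Rightarrow> 'v \<Rightarrow> 'n perm \<Rightarrow>\<^sub>0 complex"
  defines "\<kappa>1 \<equiv> kappa_of sV v (\<lambda>i j. gelt 1)"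
    and "\<kappa>2 \<equiv> kappa_of sV v (\<lambda>i j. gelt (cyc [i, j]))"
    and "\<kappa>3 \<equiv> kappa_of sV v (\<lambda>i j. \<Sum>k\<in>UNIV - {i, j}. gelt (cyc [i, k]) + gelt (cyc [j, k]))"
    and "\<kappa>4 \<equiv> kappa_of sV v (\<lambda>i j. \<Sum>(k, l) | k \<notin> {i, j} \<and> l \<notin> {i, j} \<and> k \<noteq> l.
                 gelt (cyc [i, k] * cyc [j, l]))"
    and "\<kappa>5 \<equiv> kappa_of sV v (\<lambda>i j. \<Sum>k\<in>UNIV - {i, j}.
                 gelt (cyc [i, j, k]) + gelt (cyc [i, k, j]))"
  assumes "card (UNIV :: 'n set) \<ge> 4"
    and "vector_space sV"
    and "inj v"
    and "\<not> Modules.module.dependent sV (range v)"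
    and "Modules.module.span sV (range v) = UNIV"
    and "\<And>\<sigma>. Vector_Spaces.linear sV sV (act \<sigma>)"
    and "\<And>\<sigma> i. act \<sigma> (v i) = v (Perm.apply \<sigma> i)"
    and "\<And>i. q i i = 1"
    and "\<And>i j. i \<noteq> j \<Longrightarrow> q i j = - 1"
  shows "kappa_space.subspace (qdh_maps sV v act q)
    \<and> kappa_space.dim (qdh_maps sV v act q) = 5
    \<and> card {\<kappa>1, \<kappa>2, \<kappa>3, \<kappa>4, \<kappa>5} = 5
    \<and> kappa_space.independent {\<kappa>1, \<kappa>2, \<kappa>3, \<kappa>4, \<kappa>5}
    \<and> kappa_space.span {\<kappa>1, \<kappa>2, \<kappa>3, \<kappa>4, \<kappa>5} = qdh_maps sV v act q"
proof -
  interpret permuted_basis sV v act by (rule permuted_basis.intro) fact+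
  have q: "q = sign_q" using assms(13,14) by (auto simp: sign_q_def fun_eq_iff)
  \<comment> \<open>A family indexed by 1 to 5, as \<open>family_basis\<close> and \<open>coeff_comb\<close> expect.\<close>
  define b where "b t = (if t = 1 then \<kappa>1 else if t = 2 then \<kappa>2 else if t = 3 then \<kappa>3 else
      if t = 4 then \<kappa>4 else \<kappa>5)" for t :: nat
  let ?S = "{1, 2, 3, 4, 5 :: nat}"
  let ?comb = "\<lambda>u. \<Sum>t\<in>?S. kappa_scale (u t) (b t)"
  have bS: "b ` ?S = {\<kappa>1, \<kappa>2, \<kappa>3, \<kappa>4, \<kappa>5}" by (simp add: b_def insert_commute)
  have \<kappa>: "\<kappa>1 = kappa_of sV v coeff_one" "\<kappa>2 = kappa_of sV v coeff_swap" "\<kappa>3 = kappa_of sV v coeff_transp"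
      "\<kappa>4 = kappa_of sV v coeff_double" "\<kappa>5 = kappa_of sV v coeff_cycle3"
    unfolding \<kappa>1_def \<kappa>2_def \<kappa>3_def \<kappa>4_def \<kappa>5_def coeff_one_def[abs_def] coeff_swap_def[abs_def]
        coeff_transp_def[abs_def] coeff_double_def[abs_def] coeff_cycle3_def[abs_def] by (rule refl)+
  have comb_v: "?comb u (v i) (v j) = coeff_comb u i j" for u i j
    by (simp add: b_def \<kappa> kappa_scale_def kappa_of_v coeff_comb_def add.assoc)
  have comb_bilin: "bilin (?comb u)" for u
    by (simp add: b_def \<kappa> bilin_add bilin_scale bilin_kappa_of)
  have qdh: "qdh_maps sV v act q = range ?comb"
  proof (intro equalityI subsetI)
    fix \<kappa> assume "\<kappa> \<in> qdh_maps sV v act q"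
    then have "bilin \<kappa>" and "\<exists>u. (\<lambda>i j. \<kappa> (v i) (v j)) = coeff_comb u"
      using qdh_maps_iff[of \<kappa>] pbw_coeffs_iff[OF assms(6)] q by auto
    then obtain u where "\<And>i j. \<kappa> (v i) (v j) = ?comb u (v i) (v j)" unfolding comb_v by metis
    then have "\<kappa> = ?comb u" by (rule bilin_eqI[OF \<open>bilin \<kappa>\<close> comb_bilin])
    then show "\<kappa> \<in> range ?comb" by blast
  next
    fix \<kappa> assume "\<kappa> \<in> range ?comb"
    then obtain u where "\<kappa> = ?comb u" by blast
    then show "\<kappa> \<in> qdh_maps sV v act q"
      using comb_bilin[of u] pbw_coeffs_coeff_comb[of u] unfolding q qdh_maps_iff by (simp only: comb_v)
  qed
  obtain a b' c d where d: "distinct [a, b', c, d :: 'n]" using four_distinct[OF assms(6)] by blast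
  have zero: "\<forall>t\<in>?S. u t = 0" if "?comb u = 0" for u
  proof -
    have "coeff_comb u a b' = 0" using comb_v[of u a b'] unfolding that by simp
    then show ?thesis using five_values[OF d, of u] by simp
  qed
  note basis = kappa_space.family_basis[of ?S b, OF _ zero, unfolded bS]
  have card: "card {\<kappa>1, \<kappa>2, \<kappa>3, \<kappa>4, \<kappa>5} = 5"
    using card_image[OF basis(1)] unfolding bS by simp
  have ind: "kappa_space.independent {\<kappa>1, \<kappa>2, \<kappa>3, \<kappa>4, \<kappa>5}" by (rule basis(2)) auto
  have span: "kappa_space.span {\<kappa>1, \<kappa>2, \<kappa>3, \<kappa>4, \<kappa>5} = qdh_maps sV v act q"
    unfolding qdh by (rule basis(3)) auto
  show ?thesis
    using card ind span kappa_space.subspace_span kappa_space.dim_span_eq_card_independent[OF ind] by metis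
qed

end
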